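(* Let $\Pi^{\tau}$ be a toroidal embedding of a 2-regular digraph with no contractible directed cycles, representing the period parallelogram of a doubly periodic bobbin lace ground with a fixed direction of monotonicity (the vertical, meridional direction). Then $\Pi^{\tau}$ is thread conserving if and only if, when the torus is cut along a circle in the direction of monotonicity (a meridian circle), the number of arcs crossing the cut in one direction equals the number of arcs crossing it in the opposite direction.
   Context: A 2-regular digraph is a directed graph in which every vertex has in-degree 2 and out-degree 2. A bobbin lace ground is modeled by an infinite directed graph embedded in the plane that is invariant under translations by two independent vectors; identifying opposite sides of a period parallelogram gives a finite embedding $\Pi^{\tau}$ on the torus. Vertices are interactions (places where two pairs of threads are braided together) and each arc is a pair of threads travelling from one interaction to the next; there is a preferred downward direction (the direction of monotonicity) along which the lace is worked, and the meridian circles of the torus correspond to lines in this direction. A directed cycle is a directed path starting and ending at the same vertex in which every vertex other than the first/last appears only once; a cycle on a surface $S$ is contractible if cutting $S$ along it separates $S$ into a topological disk and its complement. The embedding is thread conserving if, once started, a rectangular patch of the ground of fixed width (measured perpendicular to the direction of monotonicity) can be worked to any length in the direction of monotonicity using a fixed set of threads, without adding or removing threads. *)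

theory Defs
  imports "HOL-Analysis.Analysis" "Graph_Theory.Digraph" "Graph_Theory.Arc_Walk"
begin

section \<open>Doubly periodic grounds and their toroidal embeddings\<close>

text \<open>
  The plane is \<^typ>\<open>real \<times> real\<close>; the direction of monotonicity is vertical and lace is worked
  downwards, i.e. towards decreasing second coordinate.

  The periods are \<^term>\<open>period D = (p, q)\<close> and \<^term>\<open>(0, vperiod D)\<close>.  One of them is vertical
  because the lines in the direction of monotonicity have to close up to (meridian) circles on the
  torus; the other one is arbitrary, so the period parallelogram may be sheared.

  Vertices and arcs are those of the finite quotient digraph.  \<^term>\<open>place D v\<close> and
  \<^term>\<open>curve D e\<close> choose one plane lift of the vertex \<open>v\<close> and of the arc \<open>e\<close>; the two choices need
  not be related to each other.
\<close>

record ('a, 'b) ground =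
  digraph :: "('a, 'b) pre_digraph"
  period :: "real \<times> real"
  vperiod :: real
  place :: "'a \<Rightarrow> real \<times> real"
  curve :: "'b \<Rightarrow> real \<Rightarrow> real \<times> real"

definition two_regular :: "('a, 'b) pre_digraph \<Rightarrow> bool" where
  "two_regular G \<longleftrightarrow> fin_digraph G \<and> (\<forall>v\<in>verts G. in_degree G v = 2 \<and> out_degree G v = 2)"

definition torus :: "(complex \<times> complex) set" where
  "torus = sphere 0 1 \<times> sphere 0 1"

text \<open>
  The point \<open>r (p, q) + s (0, h)\<close> of the plane goes to \<open>(cis (2 pi r), cis (2 pi s))\<close>, so two points
  have the same image iff they differ by a lattice vector.
\<close>

definition to_torus :: "('a, 'b) ground \<Rightarrow> real \<times> real \<Rightarrow> complex \<times> complex" where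
  "to_torus D z =
     (let r = fst z / fst (period D); s = (snd z - r * snd (period D)) / vperiod D
      in (cis (2 * pi * r), cis (2 * pi * s)))"

definition toroidal_embedding :: "('a, 'b) ground \<Rightarrow> bool" where
  "toroidal_embedding D \<longleftrightarrow>
     fst (period D) > 0 \<and> vperiod D > 0 \<and>
     inj_on (\<lambda>v. to_torus D (place D v)) (verts (digraph D)) \<and>
     (\<forall>e\<in>arcs (digraph D).
        path (curve D e) \<and>
        to_torus D (curve D e 0) = to_torus D (place D (tail (digraph D) e)) \<and>
        to_torus D (curve D e 1) = to_torus D (place D (head (digraph D) e))) \<and>
     inj_on (\<lambda>(e, t). to_torus D (curve D e t)) (arcs (digraph D) \<times> {0<..<1}) \<and>
     (\<forall>e\<in>arcs (digraph D). \<forall>t\<in>{0<..<1}. \<forall>v\<in>verts (digraph D).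
        to_torus D (curve D e t) \<noteq> to_torus D (place D v))"

definition contractible_curve :: "(complex \<times> complex) set \<Rightarrow> bool" where
  "contractible_curve C \<longleftrightarrow>
     (\<exists>U\<in>components (torus - C). U \<noteq> torus - C \<and> U homeomorphic (ball 0 1 :: complex set))"

definition cycle_trace :: "('a, 'b) ground \<Rightarrow> 'b list \<Rightarrow> (complex \<times> complex) set" where
  "cycle_trace D es = (\<Union>e\<in>set es. to_torus D ` path_image (curve D e))"

definition no_contractible_directed_cycles :: "('a, 'b) ground \<Rightarrow> bool" where
  "no_contractible_directed_cycles D \<longleftrightarrow>
     (\<forall>es. pre_digraph.cycle (digraph D) es \<longrightarrow> \<not> contractible_curve (cycle_trace D es))"

section \<open>Cutting along a meridian circle\<close>

definition meridian :: "('a, 'b) ground \<Rightarrow> real \<Rightarrow> (complex \<times> complex) set" where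
  "meridian D c = to_torus D ` ({c} \<times> UNIV)"

definition general_position :: "('a, 'b) ground \<Rightarrow> real \<Rightarrow> bool" where
  "general_position D c \<longleftrightarrow>
     (\<forall>v\<in>verts (digraph D). to_torus D (place D v) \<notin> meridian D c) \<and>
     (\<forall>e\<in>arcs (digraph D). finite {t\<in>{0..1}. to_torus D (curve D e t) \<in> meridian D c})"

text \<open>
  A crossing is an arc together with the parameter at which it crosses, so an arc that crosses the
  circle several times is counted with multiplicity.  An arc that touches the circle and turns back
  to the same side does not cross it.
\<close>

definition rightward_crossings :: "('a, 'b) ground \<Rightarrow> real \<Rightarrow> ('b \<times> real) set" where
  "rightward_crossings D c =
     {(e, t). e \<in> arcs (digraph D) \<and> t \<in> {0<..<1} \<and> to_torus D (curve D e t) \<in> meridian D c \<and>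
        (\<forall>\<^sub>F s in at_left t. fst (curve D e s) < fst (curve D e t)) \<and>
        (\<forall>\<^sub>F s in at_right t. fst (curve D e s) > fst (curve D e t))}"

definition leftward_crossings :: "('a, 'b) ground \<Rightarrow> real \<Rightarrow> ('b \<times> real) set" where
  "leftward_crossings D c =
     {(e, t). e \<in> arcs (digraph D) \<and> t \<in> {0<..<1} \<and> to_torus D (curve D e t) \<in> meridian D c \<and>
        (\<forall>\<^sub>F s in at_left t. fst (curve D e s) > fst (curve D e t)) \<and>
        (\<forall>\<^sub>F s in at_right t. fst (curve D e s) < fst (curve D e t))}"

section \<open>Working a patch\<close>

text \<open>
  The arcs of the infinite ground are the translates \<^term>\<open>lift D e k\<close> of the chosen lifts.  Inside a
  vertical strip \<open>a < x < b\<close> they fall into strands, the maximal stretches that run inside the strip.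
  A strand begins either at a vertex (parameter 0 of its arc) or on a side of the strip, and
  likewise ends at a vertex (parameter 1) or on a side.
\<close>

definition lift :: "('a, 'b) ground \<Rightarrow> 'b \<Rightarrow> int \<times> int \<Rightarrow> real \<Rightarrow> real \<times> real" where
  "lift D e k t = curve D e t + of_int (fst k) *\<^sub>R period D + of_int (snd k) *\<^sub>R (0, vperiod D)"

record 'b strand =
  on_arc :: 'b
  cell :: "int \<times> int"
  start :: real
  stop :: real

definition point :: "('a, 'b) ground \<Rightarrow> 'b strand \<Rightarrow> real \<Rightarrow> real \<times> real" where
  "point D P = lift D (on_arc P) (cell P)"

definition strands :: "('a, 'b) ground \<Rightarrow> real \<Rightarrow> real \<Rightarrow> 'b strand set" where
  "strands D a b =
     {P. on_arc P \<in> arcs (digraph D) \<and> 0 \<le> start P \<and> start P < stop P \<and> stop P \<le> 1 \<and>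
         (\<forall>t\<in>{start P<..<stop P}. a < fst (point D P t) \<and> fst (point D P t) < b) \<and>
         (start P = 0 \<or> fst (point D P (start P)) \<in> {a, b}) \<and>
         (stop P = 1 \<or> fst (point D P (stop P)) \<in> {a, b})}"

definition patch_strands ::
    "('a, 'b) ground \<Rightarrow> real \<Rightarrow> real \<Rightarrow> real \<Rightarrow> real \<Rightarrow> 'b strand set" where
  "patch_strands D a b d l =
     {P\<in>strands D a b. \<exists>t\<in>{start P..stop P}. snd (point D P t) \<in> {d - l..d}}"

text \<open>
  A thread that has run along \<open>P\<close> may continue along \<open>Q\<close> if \<open>P\<close> ends and \<open>Q\<close> starts at the same
  interaction, where the four incoming threads may be distributed in any way over the two outgoing
  arcs, or if \<open>P\<close> leaves the patch through one side and \<open>Q\<close> enters it through the same side, not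
  above the exit since the lace is worked downwards.  A thread cannot be carried across the finished
  lace from one side of the patch to the other without being worked.
\<close>

definition continues ::
    "('a, 'b) ground \<Rightarrow> real \<Rightarrow> real \<Rightarrow> 'b strand \<Rightarrow> 'b strand \<Rightarrow> bool" where
  "continues D a b P Q \<longleftrightarrow>
     (let z = point D P (stop P); w = point D Q (start Q) in
        stop P = 1 \<and> start Q = 0 \<and> z = w \<or>
        fst z = a \<and> fst w = a \<and> snd w \<le> snd z \<or>
        fst z = b \<and> fst w = b \<and> snd w \<le> snd z)"

text \<open>
  Each member of the list \<open>ws\<close> is the route of one thread through the rectangle with sides
  \<open>x = a\<close> and \<open>x = b\<close>, top \<open>y = d\<close> and length \<open>l\<close> (the empty route is that of an idle thread).  Every
  strand is a pair of threads.  No route begins or ends at an interaction of the rectangle, that is,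
  no thread is added or cut off inside the lace.
\<close>

definition works_patch ::
    "('a, 'b) ground \<Rightarrow> real \<Rightarrow> real \<Rightarrow> real \<Rightarrow> real \<Rightarrow> 'b strand list list \<Rightarrow> bool" where
  "works_patch D a b d l ws \<longleftrightarrow>
     (\<forall>w\<in>set ws. set w \<subseteq> patch_strands D a b d l \<and> successively (continues D a b) w \<and>
        (w \<noteq> [] \<longrightarrow>
           point D (hd w) (start (hd w)) \<notin> {a<..<b} \<times> {d - l..d} \<and>
           point D (last w) (stop (last w)) \<notin> {a<..<b} \<times> {d - l..d})) \<and>
     (\<forall>P\<in>patch_strands D a b d l. (\<Sum>w\<leftarrow>ws. count_list w P) = 2)"

text \<open>
  The number \<open>n\<close> of threads may depend on the width and position of the patch, but not on the length
  to which it is worked.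
\<close>

definition thread_conserving :: "('a, 'b) ground \<Rightarrow> bool" where
  "thread_conserving D \<longleftrightarrow>
     (\<forall>a b d. a < b \<and> general_position D a \<and> general_position D b \<longrightarrow>
        (\<exists>n. \<forall>l\<ge>0. \<exists>ws. length ws = n \<and> works_patch D a b d l ws))"

end

theory Submission
  imports Defs "HOL-Complex_Analysis.Riemann_Mapping" "HOL-Library.Multiset"
begin

text \<open>
  In the strip between two meridians, vertices emit as many strands as they absorb, so the excess
  \<open>N\<close> of rightward over leftward crossings is the same for every meridian.  Along either side of a
  strip, up to sign, \<open>N\<close> is the excess of entering over leaving strands per vertical period.  A route
  can enter through a side only at its beginning or after leaving through the same side, so if
  \<open>N \<noteq> 0\<close> the number of routes grows linearly with the length of the patch.

  If \<open>N = 0\<close>, cut the patch at its boundary and decompose it into trails that begin and end at the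
  boundary.  The only obstruction would be a finite set of lifted arcs closed under sharing an
  endpoint; a minimal one is disjoint from all its lattice translates, so a directed cycle in it is a
  Jordan curve whose interior embeds in the torus, that is, a contractible directed cycle.  Then join
  trails across the sides, going through the entries from top to bottom: apart from those within a
  bounded distance of the top, each entry finds at least two unused exits above it, one of which
  belongs to another trail.  Only boundedly many trails remain, and each is used by two threads.
\<close>

section \<open>Jordan curves disjoint from their lattice translates\<close>

text \<open>Arcs need not be straight or monotone: an arc may wind up and down, leave a strip and
  return, or touch a side. This shapes all counting. A strip is invariant only under the vertical
  period, so its strands fall into finitely many classes of vertical translates, and the height of a
  strand is replaced by that of its cell, with an error \<open>M\<close> that depends on the strip
  alone. The number of strands of some kind in a patch is then the number of classes times the
  length divided by \<open>h\<close>, up to a constant, and only these slopes have to be compared.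
  Touchings drop out in a similar way: they contribute equally, once or not at all, to the two
  one-sided counts whose difference is the net crossing number.

  A finite set of lifted arcs closed under sharing an endpoint is an obstruction because everything
  that an interaction receives is passed on within the set, so that a route covering it could
  neither begin nor end. Elsewhere strands can be treated as single tokens: a partition of the
  strands into routes, taken twice, serves both threads of every strand.\<close>

lemma connected_disjoint_inside_or_outside:
  fixes C X :: "'a::real_normed_vector set"
  assumes "closed C" "connected X" "X \<inter> C = {}"
  shows "X \<subseteq> inside C \<or> X \<subseteq> outside C"
proof (rule ccontr)
  assume "\<not> ?thesis"
  then have "X \<inter> inside C \<noteq> {}" "X - inside C \<noteq> {}"
    using inside_Un_outside[of C] assms(3) by blast+
  then have "X \<inter> frontier (inside C) \<noteq> {}"
    by (rule connected_Int_frontier[OF assms(2)])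
  then show False using frontier_inside_subset[OF assms(1)] assms(3) by blast
qed

lemma connected_translate: "connected S \<Longrightarrow> connected ((+) v ` S)" for v :: "'a::real_normed_vector"
  by (rule connected_continuous_image) (auto intro: continuous_intros)

lemma translate_Compl: "(+) v ` (- S) = - (+) v ` (S :: 'a::real_vector set)"
  by (rule bij_image_Compl_eq) (simp add: bij_def surj_plus)

text \<open>The translated outside is still connected and unbounded, so it misses the inside of the
  translated curve. This gives one inclusion; the other is the same inclusion for the translated
  curve and the shift \<open>-v\<close>.\<close>

lemma inside_Jordan_translation:
  fixes g :: "real \<Rightarrow> complex"
  assumes "simple_path g" "pathfinish g = pathstart g"
  shows "inside ((+) v ` path_image g) = (+) v ` inside (path_image g)"
proof -
  have *: "inside ((+) v ` path_image g) \<subseteq> (+) v ` inside (path_image g)"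
    if "simple_path g" "pathfinish g = pathstart g" for v and g :: "real \<Rightarrow> complex"
  proof (rule inside_subset)
    note J = Jordan_inside_outside[OF that]
    show "connected ((+) v ` outside (path_image g))"
      by (rule connected_translate) (use J in simp)
    show "\<not> bounded ((+) v ` outside (path_image g))"
    proof
      assume "bounded ((+) v ` outside (path_image g))"
      then have "bounded ((+) (- v) ` (+) v ` outside (path_image g))"
        by (rule bounded_translation)
      then show False using J by (simp add: image_image)
    qed
    show "(+) v ` inside (path_image g) \<union> (+) v ` outside (path_image g) = - (+) v ` path_image g"
      by (simp add: translate_Compl image_Un[symmetric])
  qed
  have "simple_path ((+) v \<circ> g)" "pathfinish ((+) v \<circ> g) = pathstart ((+) v \<circ> g)"
    using assms by (simp_all add: simple_path_translation_eq pathfinish_def pathstart_def)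
  from *[OF this, of "- v"]
  have "inside (path_image g) \<subseteq> (+) (- v) ` inside ((+) v ` path_image g)"
    by (simp add: path_image_compose image_image)
  then have "(+) v ` inside (path_image g) \<subseteq> (+) v ` (+) (- v) ` inside ((+) v ` path_image g)"
    by blast
  then have "(+) v ` inside (path_image g) \<subseteq> inside ((+) v ` path_image g)"
    by (simp add: image_image)
  with *[OF assms, of v] show ?thesis by blast
qed

text \<open>Otherwise adding \<open>v\<close> would carry the whole inside into itself, and
  iterating it would leave every bounded set.\<close>

lemma Jordan_translate_not_inside:
  fixes g :: "real \<Rightarrow> complex"
  assumes g: "simple_path g" "pathfinish g = pathstart g" and "v \<noteq> 0"
  shows "\<not> (+) v ` path_image g \<subseteq> inside (path_image g)"
proof
  let ?I = "inside (path_image g)"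
  note J = Jordan_inside_outside[OF g]
  assume "(+) v ` path_image g \<subseteq> ?I"
  then have "inside ((+) v ` path_image g) \<subseteq> ?I"
    using g by (intro inside_inside_compact_connected)
      (auto simp: compact_simple_path_image connected_simple_path_image closed_translation
          closed_simple_path_image)
  then have step: "v + x \<in> ?I" if "x \<in> ?I" for x
    using that inside_Jordan_translation[OF g] by blast
  obtain x where x: "x \<in> ?I" using J by blast
  have n: "of_nat n * v + x \<in> ?I" for n :: nat
  proof (induction n)
    case (Suc n)
    from step[OF this] show ?case by (simp add: algebra_simps)
  qed (use x in simp)
  obtain B where B: "norm y \<le> B" if "y \<in> ?I" for y
    using J by (meson bounded_iff)
  obtain n :: nat where "(B + norm x) / norm v < real n" using reals_Archimedean2 by blast
  then have "B + norm x < real n * norm v" using \<open>v \<noteq> 0\<close> by (simp add: field_simps)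
  moreover have "real n * norm v \<le> norm (of_nat n * v + x) + norm x"
    using norm_triangle_ineq4[of "of_nat n * v + x" x] by (simp add: norm_mult)
  ultimately show False using B[OF n[of n]] by simp
qed

text \<open>Applied to the shifts \<open>v\<close> and \<open>-v\<close>, the preceding lemma puts
  each of the two curves outside the other. The shifted inside is then connected and misses the
  curve, and it cannot lie inside because its closure contains the shifted curve.\<close>

lemma Jordan_translate_disjoint:
  fixes g :: "real \<Rightarrow> complex"
  assumes g: "simple_path g" "pathfinish g = pathstart g" and v: "v \<noteq> 0"
    and dis: "path_image g \<inter> (+) v ` path_image g = {}"
  shows "(path_image g \<union> inside (path_image g)) \<inter>
    (+) v ` (path_image g \<union> inside (path_image g)) = {}"
proof -
  let ?C = "path_image g" let ?I = "inside ?C" let ?O = "outside ?C"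
  note J = Jordan_inside_outside[OF g]
  have cl: "closed ?C" and con: "connected ?C"
    using g by (auto simp: closed_simple_path_image connected_simple_path_image)
  have out: "(+) w ` ?C \<subseteq> ?O" if "w \<noteq> 0" "(+) w ` ?C \<inter> ?C = {}" for w
    using connected_disjoint_inside_or_outside[OF cl connected_translate[OF con] that(2)]
      Jordan_translate_not_inside[OF g that(1)] by (elim disjE) (erule (1) notE, assumption)
  have 1: "(+) v ` ?C \<subseteq> ?O" using v dis by (intro out) (simp_all add: Int_commute)
  have "(+) (- v) ` ?C \<inter> ?C = {}"
  proof -
    have "(+) (- v) ` (?C \<inter> (+) v ` ?C) = {}" using dis by simp
    then show ?thesis by (auto simp: image_Int image_image)
  qed
  then have "(+) (- v) ` ?C \<subseteq> ?O" using v by (intro out) simp_all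
  then have "(+) v ` (+) (- v) ` ?C \<subseteq> (+) v ` ?O" by (rule image_mono)
  then have 2: "?C \<subseteq> (+) v ` ?O" by (simp add: image_image)
  have "(+) v ` ?I \<inter> (+) v ` ?O = {}" by auto (metis IntI empty_iff inside_Int_outside)
  with 2 have 3: "(+) v ` ?I \<inter> ?C = {}" by blast
  have "connected ((+) v ` ?I)" using J by (intro connected_translate) simp
  from connected_disjoint_inside_or_outside[OF cl this 3]
  have "(+) v ` ?I \<subseteq> ?I \<or> (+) v ` ?I \<subseteq> ?O" .
  moreover have "\<not> (+) v ` ?I \<subseteq> ?I"
  proof
    assume "(+) v ` ?I \<subseteq> ?I"
    then have "closure ((+) v ` ?I) \<subseteq> closure ?I" by (rule closure_mono)
    then have "(+) v ` closure ?I \<subseteq> closure ?I" by (simp add: closure_translation)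
    moreover have "?C \<subseteq> closure ?I" using J by (metis Diff_subset frontier_def)
    moreover have "closure ?I \<subseteq> ?C \<union> ?I" by (rule closure_inside_subset[OF cl])
    ultimately have "(+) v ` ?C \<subseteq> ?C \<union> ?I" by blast
    moreover have "(?C \<union> ?I) \<inter> ?O = {}" using J by (auto simp: union_with_inside)
    moreover have "?C \<noteq> {}" by simp
    ultimately show False using 1 by blast
  qed
  ultimately have 4: "(+) v ` ?I \<subseteq> ?O" by blast
  have "(?C \<union> ?I) \<inter> ?O = {}" by (auto simp: union_with_inside)
  with 1 4 show ?thesis by blast
qed

section \<open>Simple loops that embed in a quotient of the plane\<close>

text \<open>\<open>f\<close> is the quotient map for the periods \<open>L\<close>, and the compact
  set \<open>K\<close> meets every fibre. Injectivity on the loop separates the loop from its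
  translates, hence also the closed disc that it bounds, which therefore embeds. What remains is
  that the open disc is a whole component of the complement and not all of it.\<close>

theorem simple_loop_bounds_disc_in_quotient:
  fixes f :: "complex \<Rightarrow> 'x::t2_space" and L :: "complex set" and g :: "real \<Rightarrow> complex"
  assumes cont: "continuous_on UNIV f"
    and eq: "\<And>z w. f z = f w \<longleftrightarrow> w - z \<in> L"
    and K: "compact K" "f ` K = range f"
    and discrete: "\<And>r. finite (L \<inter> cball 0 r)"
    and g: "simple_path g" "pathfinish g = pathstart g"
    and inj: "inj_on f (path_image g)"
  shows "\<exists>U\<in>components (range f - f ` path_image g).
    U \<noteq> range f - f ` path_image g \<and> U homeomorphic (ball 0 1 :: complex set)"
proof -
  let ?C = "path_image g" let ?I = "inside ?C" let ?O = "outside ?C"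
  define \<Delta> where "\<Delta> = ?C \<union> ?I"
  let ?U = "f ` ?I" let ?R = "range f"
  note J = Jordan_inside_outside[OF g]
  have cl: "closed ?C" and con: "connected ?C"
    using g by (auto simp: closed_simple_path_image connected_simple_path_image)
  have L0: "0 \<in> L" using eq[of 0 0] by simp
  have dis: "\<Delta> \<inter> (+) v ` \<Delta> = {}" if "v \<in> L" "v \<noteq> 0" for v
    unfolding \<Delta>_def
  proof (rule Jordan_translate_disjoint[OF g that(2)])
    show "?C \<inter> (+) v ` ?C = {}"
    proof (rule ccontr)
      assume "\<not> ?thesis"
      then obtain z where z: "z \<in> ?C" "v + z \<in> ?C"
        unfolding disjoint_iff by (metis imageE)
      have "f z = f (v + z)" by (simp add: eq that)
      then have "z = v + z" using inj z by (metis inj_onD)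
      then show False using that(2) by simp
    qed
  qed
  have same: "x = y" if "x \<in> \<Delta>" "y \<in> \<Delta>" "f x = f y" for x y
  proof (rule ccontr)
    assume "x \<noteq> y"
    then have "\<Delta> \<inter> (+) (y - x) ` \<Delta> = {}" using that(3) by (intro dis) (simp_all add: eq)
    moreover have "y \<in> (+) (y - x) ` \<Delta>" using that(1) by (rule rev_image_eqI) simp
    ultimately show False using that(2) by (metis disjoint_iff)
  qed
  then have inj\<Delta>: "inj_on f \<Delta>" by (auto simp: inj_on_def)
  have "compact (closure ?I)" using J by (simp add: compact_closure)
  moreover have "closure ?I = \<Delta>"
    using J closure_Un_frontier[of ?I] by (auto simp: \<Delta>_def)
  ultimately have com: "compact \<Delta>" by simp
  obtain h where h: "homeomorphism \<Delta> (f ` \<Delta>) f h"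
    using homeomorphism_compact[OF com continuous_on_subset[OF cont] refl inj\<Delta>] by blast
  have "homeomorphism ?I ?U f h"
    by (rule homeomorphism_of_subsets[OF h, where T''="{}"]) (auto simp: \<Delta>_def)
  then have "?I homeomorphic ?U" by (auto simp: homeomorphic_def)
  moreover have "?I homeomorphic (ball 0 1 :: complex set)"
    using simply_connected_eq_homeomorphic_to_disc[of ?I] J simply_connected_inside_simple_path[OF g(1)]
    by blast
  ultimately have hom: "?U homeomorphic (ball 0 1 :: complex set)"
    using homeomorphic_sym homeomorphic_trans by blast
  have conU: "connected ?U"
    using J by (intro connected_continuous_image continuous_on_subset[OF cont]) simp_all
  have sub: "?U \<subseteq> ?R - f ` ?C"
  proof
    fix u assume "u \<in> ?U"
    then obtain x where x: "x \<in> ?I" "u = f x" by blast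
    have "f x \<noteq> f c" if "c \<in> ?C" for c
      using same[of x c] that x inside_no_overlap[of ?C] unfolding \<Delta>_def disjoint_iff by blast
    then show "u \<in> ?R - f ` ?C" using x by auto
  qed
  \<comment> \<open>This is the full preimage of \<open>?U\<close>, so that the rest of the quotient
    is the image of the compact set \<open>K - A\<close>.\<close>
  define A where "A = (\<Union>v\<in>L. (+) v ` ?I)"
  have "open A" unfolding A_def using J by (auto intro!: open_translation)
  have A: "f x \<in> ?U \<longleftrightarrow> x \<in> A" for x
  proof
    assume "f x \<in> ?U"
    then obtain y where "y \<in> ?I" "f y = f x" by (metis imageE)
    then have "x - y \<in> L" by (simp add: eq)
    moreover have "x \<in> (+) (x - y) ` ?I" using \<open>y \<in> ?I\<close> by (rule rev_image_eqI) simp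
    ultimately show "x \<in> A" unfolding A_def by (rule UN_I)
  next
    assume "x \<in> A"
    then obtain v y where "v \<in> L" "y \<in> ?I" "x = v + y" by (auto simp: A_def)
    then have "f y = f x" by (simp add: eq)
    then show "f x \<in> ?U" using \<open>y \<in> ?I\<close> by (metis imageI)
  qed
  have "?R - ?U = f ` (K - A)"
  proof (intro equalityI subsetI)
    fix u assume u: "u \<in> ?R - ?U"
    then obtain k where "k \<in> K" "u = f k" using K(2) by (metis DiffD1 imageE)
    then show "u \<in> f ` (K - A)" using u A by auto
  next
    fix u assume "u \<in> f ` (K - A)"
    then obtain k where "k \<notin> A" "u = f k" by auto
    then show "u \<in> ?R - ?U" using A[of k] by simp
  qed
  moreover have "compact (f ` (K - A))"
    using K(1) \<open>open A\<close>
    by (intro compact_continuous_image continuous_on_subset[OF cont] compact_diff) simp_all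
  ultimately have "closed (?R - ?U)" using compact_imp_closed by metis
  \<comment> \<open>The type of the values of \<open>f\<close> may be larger than the range, so
    \<open>?U\<close> itself need not be open in it; this set is open and meets the range exactly in
    \<open>?U\<close>.\<close>
  then have opn: "open (- (?R - ?U))" by (rule open_Compl)
  have clo: "closed (f ` \<Delta>)"
    using com by (intro compact_imp_closed compact_continuous_image continuous_on_subset[OF cont]) simp_all
  have comp: "?U \<in> components (?R - f ` ?C)"
    unfolding in_components_maximal
  proof (intro conjI allI impI)
    show "?U \<noteq> {}" using J by simp
    fix D assume D: "D \<noteq> {} \<and> ?U \<subseteq> D \<and> D \<subseteq> ?R - f ` ?C \<and> connected D"
    have *: "U = E \<inter> - (R - U)" "U = E \<inter> (C \<union> U)"
      if "U \<subseteq> E" "E \<subseteq> R - C" for U E R C :: "'x set"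
      using that by blast+
    have D': "?U \<subseteq> D" "D \<subseteq> ?R - f ` ?C" "connected D" using D by simp_all
    have "openin (top_of_set D) ?U"
      unfolding openin_open using opn *(1)[OF D'(1,2)] by (intro exI conjI)
    moreover have "closedin (top_of_set D) ?U"
      unfolding closedin_closed using clo *(2)[OF D'(1,2)]
      by (intro exI[of _ "f ` \<Delta>"] conjI) (simp_all add: \<Delta>_def image_Un)
    moreover have "?U \<noteq> {}" using J by simp
    ultimately show "D = ?U" using D'(3) unfolding connected_clopen by (metis (no_types))
  qed (use sub conU in auto)
  have "?U \<noteq> ?R - f ` ?C"
  proof
    assume "?U = ?R - f ` ?C"
    \<comment> \<open>The translates of the closed disc would now cover the plane. Only finitely
      many of them come near a point \<open>c\<close> of the loop, and none of the shifted ones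
      contains \<open>c\<close>, so a small ball around \<open>c\<close> lies in the disc. But
      \<open>c\<close> is a limit of points outside.\<close>
    then have cover: "?R = f ` \<Delta>" using sub by (auto simp: \<Delta>_def)
    obtain c where c: "c \<in> ?C" by (meson path_image_nonempty ex_in_conv)
    obtain B where B: "norm y \<le> B" if "y \<in> \<Delta>" for y
      using compact_imp_bounded[OF com] by (meson bounded_iff)
    \<comment> \<open>A point within distance 1 of \<open>c\<close> and a point of the disc differ
      by at most \<open>(B + 1) + B\<close> in norm, so \<open>V\<close> contains every nonzero
      shift that matters near \<open>c\<close>.\<close>
    define V where "V = L \<inter> cball 0 (2 * B + 1) - {0}"
    define W where "W = (\<Union>v\<in>V. (+) v ` \<Delta>)"
    have "finite V" unfolding V_def using discrete by blast
    then have "closed W"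
      unfolding W_def using com by (intro closed_UN) (auto intro: closed_translation compact_imp_closed)
    moreover have "c \<in> \<Delta>" using c by (simp add: \<Delta>_def)
    have "c \<notin> W"
    proof
      assume "c \<in> W"
      then obtain v where v: "v \<in> V" "c \<in> (+) v ` \<Delta>" unfolding W_def by (rule UN_E)
      then have "\<Delta> \<inter> (+) v ` \<Delta> = {}" by (intro dis) (simp_all add: V_def)
      then show False using \<open>c \<in> \<Delta>\<close> v(2) by (metis disjoint_iff)
    qed
    ultimately obtain \<epsilon> where e: "\<epsilon> > 0" "ball c \<epsilon> \<subseteq> - W"
      by (metis ComplI openE open_Compl)
    have bal: "ball c (min \<epsilon> 1) \<subseteq> \<Delta>"
    proof
      fix x assume x: "x \<in> ball c (min \<epsilon> 1)"
      obtain y where y: "y \<in> \<Delta>" "f y = f x" using cover by (metis imageE rangeI)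
      then have v: "x - y \<in> L" by (simp add: eq)
      have "norm x \<le> norm c + 1"
        using x norm_triangle_sub[of x c] by (simp add: dist_norm norm_minus_commute[of c x])
      then have "norm (x - y) \<le> 2 * B + 1"
        using B[OF y(1)] B[of c] c norm_triangle_ineq4[of x y] by (simp add: \<Delta>_def)
      then have "x - y \<in> V \<or> x = y" using v by (auto simp: V_def)
      moreover have "x \<in> (+) (x - y) ` \<Delta>" using y(1) by (rule rev_image_eqI) simp
      moreover have "x \<notin> W" using subsetD[OF e(2), of x] x by simp
      ultimately show "x \<in> \<Delta>" using y(1) unfolding W_def by (metis UN_I)
    qed
    have "c \<in> closure ?O" using J c by (metis Diff_iff frontier_def)
    then have "\<exists>y\<in>?O. dist y c < min \<epsilon> 1"
      using e(1) unfolding closure_approachable by (elim allE[of _ "min \<epsilon> 1"] mp) simp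
    then obtain y where y1: "y \<in> ?O" and "dist y c < min \<epsilon> 1" by (rule bexE)
    then have y2: "y \<in> ball c (min \<epsilon> 1)" unfolding mem_ball by (simp only: dist_commute)
    have "y \<in> \<Delta> \<inter> ?O" by (rule IntI[OF subsetD[OF bal y2] y1])
    moreover have "\<Delta> \<inter> ?O = {}" unfolding \<Delta>_def union_with_inside by (rule Compl_disjoint2)
    ultimately show False by (simp only: empty_iff)
  qed
  with comp hom show ?thesis by (intro bexI[of _ ?U] conjI)
qed

section \<open>Trail decompositions of finite balanced digraphs\<close>

text \<open>\<open>t x\<close> and \<open>h x\<close> are the ends of \<open>x\<close>; \<open>None\<close> marks an end through which no trail may pass.\<close>

definition trail :: "('s \<Rightarrow> 'n option) \<Rightarrow> ('s \<Rightarrow> 'n option) \<Rightarrow> 's list \<Rightarrow> bool" where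
  "trail t h w \<longleftrightarrow> w \<noteq> [] \<and> successively (\<lambda>x y. h x = t y \<and> h x \<noteq> None) w"

lemma trail_append:
  "trail t h (v @ w)" if "trail t h v" "trail t h w" "h (last v) = t (hd w)" "h (last v) \<noteq> None"
  using that by (auto simp: trail_def successively_append_iff)

lemma trail_append_iff:
  assumes "v \<noteq> []" "w \<noteq> []"
  shows "trail t h (v @ w) \<longleftrightarrow>
    trail t h v \<and> trail t h w \<and> h (last v) = t (hd w) \<and> h (last v) \<noteq> None"
  using assms by (auto simp: trail_def successively_append_iff)

lemma trail_splice_before:
  assumes "trail t h (p @ y # q)" "trail t h r" "h (last r) = t y" "t (hd r) = t y" "t y \<noteq> None"
  shows "trail t h (p @ r @ y # q)"
proof -
  have r: "r \<noteq> []" using assms(2) by (simp add: trail_def)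
  show ?thesis using assms by (cases "p = []") (simp_all add: trail_append_iff r)
qed

lemma trail_splice_after:
  assumes "trail t h (p @ y # q)" "trail t h r" "h (last r) = h y" "t (hd r) = h y" "h y \<noteq> None"
  shows "trail t h ((p @ [y]) @ r @ q)"
proof -
  have ne: "r \<noteq> []" using assms(2) by (simp add: trail_def)
  have pq: "trail t h ((p @ [y]) @ q)" using assms(1) by simp
  have "trail t h (p @ [y])"
    using pq by (cases "q = []") (use trail_append_iff[of "p @ [y]" q t h] in auto)
  then have pr: "trail t h ((p @ [y]) @ r)" using assms(2-) trail_append[of t h "p @ [y]" r] by simp
  show ?thesis
  proof (cases "q = []")
    case False
    then have "trail t h q" "h y = t (hd q)" using pq trail_append_iff[of "p @ [y]" q t h] by auto
    then have "trail t h (((p @ [y]) @ r) @ q)" using pr assms(3,5) ne trail_append[of t h "(p @ [y]) @ r" q] by simp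
    then show ?thesis by simp
  qed (use pr in simp)
qed

text \<open>Within a trail every arrival at \<open>v\<close> is paired with the departure that
  follows it. Only a departure at the very beginning and an arrival at the very end lack a
  partner.\<close>

lemma trail_count:
  assumes "trail t h w"
  shows "length (filter (\<lambda>x. h x = Some v) w) + of_bool (t (hd w) = Some v)
    = length (filter (\<lambda>x. t x = Some v) w) + of_bool (h (last w) = Some v)"
  using assms
proof (induction w)
  case (Cons x w)
  show ?case
  proof (cases w)
    case Nil
    then show ?thesis by simp
  next
    case (Cons y w')
    then have "trail t h w" "h x = t (hd w)" using Cons.prems by (auto simp: trail_def)
    with Cons.IH Cons show ?thesis
      by (cases "h x = Some v"; cases "t x = Some v"; simp del: filter.simps add: filter.simps(2)[of _ x])
  qed
qed (simp add: trail_def)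

text \<open>Summing \<open>trail_count\<close> over the partition, arrivals and departures at
  \<open>v\<close> cancel by balance, and only the unpaired ends are left.\<close>

lemma size_filter_starts_eq_ends:
  assumes fin: "finite S" and bal: "card {x\<in>S. h x = Some v} = card {x\<in>S. t x = Some v}"
    and tr: "\<forall>w\<in>#M. trail t h w" and part: "(\<Sum>w\<in>#M. mset w) = mset_set S"
  shows "size {#w\<in>#M. t (hd w) = Some v#} = size {#w\<in>#M. h (last w) = Some v#}"
proof -
  have sz: "(\<Sum>w\<in>#M. length (filter P w)) = card {x\<in>S. P x}" for P
  proof -
    have "(\<Sum>w\<in>#M. length (filter P w)) = size (filter_mset P (\<Sum>w\<in>#M. mset w))"
      by (induction M) (auto simp flip: size_mset)
    then show ?thesis by (simp add: part filter_mset_mset_set fin)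
  qed
  have of: "size {#w\<in>#M. P w#} = (\<Sum>w\<in>#M. of_bool (P w))" for P :: "_ \<Rightarrow> bool"
    by (induction M) auto
  have "(\<Sum>w\<in>#M. length (filter (\<lambda>x. h x = Some v) w)) + (\<Sum>w\<in>#M. of_bool (t (hd w) = Some v))
     = (\<Sum>w\<in>#M. length (filter (\<lambda>x. t x = Some v) w)) + (\<Sum>w\<in>#M. of_bool (h (last w) = Some v))"
    unfolding sum_mset.distrib[symmetric]
    by (rule arg_cong[where f=sum_mset], rule image_mset_cong, rule trail_count) (use tr in simp)
  then show ?thesis using bal by (simp add: sz of)
qed

lemma trail_inner:
  assumes "trail t h w" "x \<in> set w"
  shows "x = hd w \<or> (\<exists>y\<in>set w. h y = t x \<and> h y \<noteq> None)" "x = last w \<or> (\<exists>y\<in>set w. h x = t y \<and> h x \<noteq> None)"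
proof -
  obtain p q where w: "w = p @ x # q" using split_list[OF assms(2)] by blast
  show "x = hd w \<or> (\<exists>y\<in>set w. h y = t x \<and> h y \<noteq> None)"
    using assms(1) by (cases p rule: rev_cases) (auto simp: w trail_def successively_append_iff)
  show "x = last w \<or> (\<exists>y\<in>set w. h x = t y \<and> h x \<noteq> None)"
    using assms(1) by (cases q) (auto simp: w trail_def successively_append_iff)
qed

text \<open>A closed trail can be opened at any of its elements; this is what allows it to be
  spliced in wherever another trail meets it.\<close>

lemma trail_rotate:
  assumes w: "trail t h (p @ x # q)" and closed: "h (last (p @ x # q)) = t (hd (p @ x # q))"
    and some: "t (hd (p @ x # q)) \<noteq> None"
  shows "trail t h (x # q @ p)" "h (last (x # q @ p)) = t x"
proof -
  have *: "trail t h ((x # q) @ p) \<and> h (last ((x # q) @ p)) = t x"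
  proof (cases "p = []")
    case False
    then have "trail t h p" "trail t h (x # q)" "h (last (x # q)) = t (hd p)" "t (hd p) \<noteq> None" "h (last p) = t x"
      using assms by (auto simp: trail_append_iff hd_append)
    then show ?thesis using False trail_append[of t h "x # q" p] by simp
  qed (use assms in simp)
  show "trail t h (x # q @ p)" "h (last (x # q @ p)) = t x" using * by simp_all
qed

text \<open>
  A partition into as few trails as possible does it: otherwise one of its trails is closed, and
  splicing it into a trail that it meets would save one.
\<close>

lemma trail_partition:
  fixes t h :: "'s \<Rightarrow> 'n option"
  assumes fin: "finite S"
    and bal: "\<And>v. card {x\<in>S. h x = Some v} = card {x\<in>S. t x = Some v}"
    and open_ended: "\<And>T. \<lbrakk>T \<subseteq> S; T \<noteq> {}; \<forall>x\<in>T. t x \<noteq> None \<and> h x \<noteq> None;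
      \<forall>x\<in>T. \<forall>y\<in>S. {t x, h x} \<inter> {t y, h y} \<noteq> {} \<longrightarrow> y \<in> T\<rbrakk> \<Longrightarrow> False"
  shows "\<exists>M. (\<Sum>w\<in>#M. mset w) = mset_set S \<and>
    (\<forall>w. w \<in># M \<longrightarrow> trail t h w \<and> t (hd w) = None \<and> h (last w) = None)"
proof -
  define ok where "ok M \<longleftrightarrow> (\<forall>w\<in>#M. trail t h w) \<and> (\<Sum>w\<in>#M. mset w) = mset_set S" for M
  have sing: "(\<Sum>w\<in>#image_mset (\<lambda>x. [x]) N. mset w) = N" for N :: "'s multiset"
    by (induction N) auto
  have "ok (image_mset (\<lambda>x. [x]) (mset_set S))"
    unfolding ok_def sing using fin by (auto simp: trail_def)
  from ex_has_least_nat[of ok, OF this, of size]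
  obtain M where M: "ok M" and least: "\<forall>M'. ok M' \<longrightarrow> size M \<le> size M'"
    by (elim exE conjE)
  then have min: "size M \<le> size M'" if "ok M'" for M' using that by simp
  have tr: "\<And>w. w \<in># M \<Longrightarrow> trail t h w" and part: "(\<Sum>w\<in>#M. mset w) = mset_set S"
    using M by (auto simp: ok_def)
  have no_merge: False if sub: "{#w1, w2#} \<subseteq># M" and "trail t h w" "mset w = mset w1 + mset w2" for w w1 w2
  proof -
    obtain R where R: "M = {#w1, w2#} + R"
      using sub unfolding mset_subset_eq_exists_conv by (rule exE)
    have "(\<Sum>w\<in>#add_mset w R. mset w) = mset_set S"
      using part unfolding R by (simp add: that(3) add.assoc)
    moreover have "trail t h u" if "u \<in># R" for u using tr[of u] that by (simp add: R)
    ultimately have "ok (add_mset w R)" using \<open>trail t h w\<close> unfolding ok_def by simp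
    from min[OF this] have "size M \<le> size (add_mset w R)" .
    then show False unfolding R by simp
  qed
  have two: "{#w1, w2#} \<subseteq># M" if "w1 \<in># M" "w2 \<in># M" "w1 \<noteq> w2" for w1 w2
    using that by (simp add: insert_subset_eq_iff in_diff_count)
  \<comment> \<open>As many trails end at a node as start there, so a trail that is not closed but
    has an end at \<open>v\<close> finds a different trail to be concatenated with, against
    minimality.\<close>
  have closed: "h (last w) = t (hd w)" if w: "w \<in># M" "t (hd w) \<noteq> None \<or> h (last w) \<noteq> None" for w
  proof (rule ccontr)
    assume ne: "h (last w) \<noteq> t (hd w)"
    obtain v where v: "t (hd w) = Some v \<or> h (last w) = Some v" using w(2) by auto
    have eq: "size {#w\<in>#M. t (hd w) = Some v#} = size {#w\<in>#M. h (last w) = Some v#}"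
      by (rule size_filter_starts_eq_ends[OF fin bal _ part]) (use tr in simp)
    have ex: "size {#w\<in>#M. P w#} \<noteq> 0 \<longleftrightarrow> (\<exists>w. w \<in># M \<and> P w)" for P
      by (induction M) auto
    have "(\<exists>w. w \<in># M \<and> h (last w) = Some v) \<longleftrightarrow> (\<exists>w. w \<in># M \<and> t (hd w) = Some v)"
      using ex[of "\<lambda>w. h (last w) = Some v"] ex[of "\<lambda>w. t (hd w) = Some v"] eq by simp
    then have "\<exists>w1. w1 \<in># M \<and> h (last w1) = Some v" "\<exists>w2. w2 \<in># M \<and> t (hd w2) = Some v"
      using v w(1) by auto
    then obtain w1 w2 where w1: "w1 \<in># M" "h (last w1) = Some v" "w2 \<in># M" "t (hd w2) = Some v"
      by (elim exE conjE)
    have *: False if u: "u1 \<in># M" "h (last u1) = Some v" "u2 \<in># M" "t (hd u2) = Some v" "u1 \<noteq> u2" for u1 u2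
    proof (rule no_merge[OF two[OF u(1,3,5)]])
      show "trail t h (u1 @ u2)" using tr[OF u(1)] tr[OF u(3)] u(2,4) by (intro trail_append) simp_all
    qed simp
    show False using v
    proof
      assume a: "t (hd w) = Some v"
      have "w1 \<noteq> w" using ne a w1(2) by auto
      then show False by (rule *[OF w1(1,2) w(1) a])
    next
      assume a: "h (last w) = Some v"
      have "w \<noteq> w2" using ne a w1(4) by auto
      then show False by (rule *[OF w(1) a w1(3,4)])
    qed
  qed
  \<comment> \<open>A closed trail that nothing else meets would have an element set excluded by
    \<open>open_ended\<close>.\<close>
  have none: "t (hd w) = None \<and> h (last w) = None" if w: "w \<in># M" for w
  proof (rule ccontr)
    assume n: "\<not> ?thesis"
    then have cl: "h (last w) = t (hd w)" "t (hd w) \<noteq> None" using closed[OF w] by auto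
    note tw = tr[OF w]
    have wS: "set w' \<subseteq> S" if "w' \<in># M" for w'
    proof -
      have "set_mset (\<Sum>w\<in>#M. mset w) = S" unfolding part using fin by simp
      then show ?thesis using that unfolding set_mset_Union_mset by auto
    qed
    have t_some: "t x \<noteq> None" if "x \<in> set w" for x
      using trail_inner(1)[OF tw that]
    proof
      assume "x = hd w" then show ?thesis using cl(2) by simp
    qed (elim bexE conjE, simp)
    have "hd w \<in> set w" using tw by (simp add: trail_def)
    have h_t: "\<exists>y\<in>set w. h x = t y" if "x \<in> set w" for x
      using trail_inner(2)[OF tw that]
    proof
      assume "x = last w"
      then show ?thesis using cl(1) by (intro bexI[of _ "hd w"] \<open>hd w \<in> set w\<close>) simp
    next
      assume "\<exists>y\<in>set w. h x = t y \<and> h x \<noteq> None"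
      then obtain y where "y \<in> set w" "h x = t y" by (elim bexE conjE)
      then show ?thesis by (rule bexI[rotated])
    qed
    have h_some: "h x \<noteq> None" if x: "x \<in> set w" for x
    proof -
      obtain y where "y \<in> set w" "h x = t y" using h_t[OF x] by (rule bexE)
      then show ?thesis using t_some[of y] by simp
    qed
    \<comment> \<open>Comparing with the tail of \<open>x\<close> is enough: by \<open>h_t\<close>
      the head of \<open>x\<close> is the tail of another element of the closed trail.\<close>
    have key: "y \<in> set w" if x: "x \<in> set w" and y: "y \<in> S" "t x = t y \<or> t x = h y" for x y
    proof (rule ccontr)
      assume yn: "y \<notin> set w"
      have "y \<in># (\<Sum>w\<in>#M. mset w)" unfolding part using fin y(1) by simp
      then have "\<exists>w'. w' \<in># M \<and> y \<in> set w'" unfolding in_Union_mset_iff by auto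
      then obtain w' where w': "w' \<in># M" "y \<in> set w'" by (elim exE conjE)
      have ww': "w \<noteq> w'" using yn w'(2) by metis
      note mm = no_merge[OF two[OF w w'(1) ww']]
      obtain p q where pq: "w = p @ x # q" using split_list[OF x] by blast
      obtain p' q' where pq': "w' = p' @ y # q'" using split_list[OF w'(2)] by blast
      note tw' = tr[OF w'(1), unfolded pq']
      note r = trail_rotate[OF tw[unfolded pq] cl[unfolded pq]]
      show False using y(2)
      proof
        assume e: "t x = t y"
        have "h (last (x # q @ p)) = t y" using r(2) e by (rule trans)
        moreover have "t (hd (x # q @ p)) = t y" unfolding list.sel by (rule e)
        moreover have "t y \<noteq> None" using t_some[OF x] unfolding e .
        ultimately have "trail t h (p' @ (x # q @ p) @ y # q')"
          by (rule trail_splice_before[OF tw' r(1)])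
        then show False by (rule mm) (simp add: multiset_eq_iff pq pq')
      next
        assume e: "t x = h y"
        have "h (last (x # q @ p)) = h y" using r(2) e by (rule trans)
        moreover have "t (hd (x # q @ p)) = h y" unfolding list.sel by (rule e)
        moreover have "h y \<noteq> None" using t_some[OF x] unfolding e .
        ultimately have "trail t h ((p' @ [y]) @ (x # q @ p) @ q')"
          by (rule trail_splice_after[OF tw' r(1)])
        then show False by (rule mm) (simp add: multiset_eq_iff pq pq')
      qed
    qed
    show False
    proof (rule open_ended[of "set w"])
      show "set w \<noteq> {}" using tw by (simp add: trail_def)
      show "\<forall>x\<in>set w. \<forall>y\<in>S. {t x, h x} \<inter> {t y, h y} \<noteq> {} \<longrightarrow> y \<in> set w"
      proof (intro ballI impI)
        fix x y assume x: "x \<in> set w" and y: "y \<in> S" "{t x, h x} \<inter> {t y, h y} \<noteq> {}"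
        obtain z where z: "z \<in> set w" "h x = t z" using h_t[OF x] by (rule bexE)
        have "t y = t x \<or> t y = h x \<or> h y = t x \<or> h y = h x" using y(2) by simp
        then show "y \<in> set w" using key[OF x y(1)] key[OF z(1) y(1)] unfolding z(2) by metis
      qed
      show "\<forall>x\<in>set w. t x \<noteq> None \<and> h x \<noteq> None" using t_some h_some by metis
    qed (rule wS[OF w])
  qed
  show ?thesis by (intro exI[of _ M] conjI allI impI part tr none[THEN conjunct1] none[THEN conjunct2])
qed

lemma successively_next_some:
  assumes "successively (\<lambda>x y. h x = t y \<and> h x \<noteq> None) (x # w)"
  shows "\<forall>z\<in>set w. t z \<noteq> None"
  using assms
proof (induction w arbitrary: x)
  case (Cons a w)
  note pr = Cons.prems[unfolded successively.simps]
  have "t a \<noteq> None" using pr[THEN conjunct1, THEN conjunct2] unfolding pr[THEN conjunct1, THEN conjunct1] .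
  moreover have "\<forall>z\<in>set w. t z \<noteq> None" by (rule Cons.IH[OF pr[THEN conjunct2]])
  ultimately show ?case by auto
qed simp

lemma successively_prev_some:
  assumes "successively (\<lambda>x y. h x = t y \<and> h x \<noteq> None) (w @ [x])"
  shows "\<forall>z\<in>set w. h z \<noteq> None"
  using assms
proof (induction w)
  case (Cons a w)
  have suc: "successively (\<lambda>x y. h x = t y \<and> h x \<noteq> None) (w @ [x])"
    using Cons.prems by (cases w) (simp_all del: not_None_eq)
  have "h a \<noteq> None"
    using Cons.prems by (cases w) (simp_all del: not_None_eq, (erule conjE)+, metis, (erule conjE)+, metis)
  with Cons.IH[OF suc] show ?case by auto
qed simp

text \<open>An element with tail \<open>None\<close> can only be the first of its trail, so the
  first elements of the trails are exactly these, each once; the same holds for the last elements.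
  These two multisets are what the joining of routes keeps track of.\<close>

lemma trail_decomposition:
  fixes t h :: "'s \<Rightarrow> 'n option"
  assumes fin: "finite S"
    and bal: "\<And>v. card {x\<in>S. h x = Some v} = card {x\<in>S. t x = Some v}"
    and open_ended: "\<And>T. \<lbrakk>T \<subseteq> S; T \<noteq> {}; \<forall>x\<in>T. t x \<noteq> None \<and> h x \<noteq> None;
      \<forall>x\<in>T. \<forall>y\<in>S. {t x, h x} \<inter> {t y, h y} \<noteq> {} \<longrightarrow> y \<in> T\<rbrakk> \<Longrightarrow> False"
  shows "\<exists>M. (\<Sum>w\<in>#M. mset w) = mset_set S \<and> (\<forall>w. w \<in># M \<longrightarrow> trail t h w) \<and>
    image_mset hd M = mset_set {x\<in>S. t x = None} \<and> image_mset last M = mset_set {x\<in>S. h x = None}"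
proof -
  have "\<exists>M. (\<Sum>w\<in>#M. mset w) = mset_set S \<and>
    (\<forall>w. w \<in># M \<longrightarrow> trail t h w \<and> t (hd w) = None \<and> h (last w) = None)"
    by (rule trail_partition[OF fin bal]) (erule (3) open_ended)
  then obtain M where M1: "(\<Sum>w\<in>#M. mset w) = mset_set S"
    and all: "\<forall>w. w \<in># M \<longrightarrow> trail t h w \<and> t (hd w) = None \<and> h (last w) = None"
    by (elim exE conjE)
  note M = M1 all[rule_format]
  have 1: "filter_mset (\<lambda>x. t x = None) (mset w) = {#hd w#}"
    if "trail t h w" "t (hd w) = None" for w
    using that
  proof (induction w)
    case (Cons x w)
    have "filter_mset (\<lambda>x. t x = None) (mset w) = {#}"
    proof -
      have "successively (\<lambda>x y. h x = t y \<and> h x \<noteq> None) (x # w)"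
        using Cons.prems(1) unfolding trail_def by (rule conjunct2)
      then have "filter (\<lambda>x. t x = None) w = []"
        unfolding filter_empty_conv by (rule successively_next_some)
      then show ?thesis unfolding mset_filter[symmetric] by simp
    qed
    then show ?case using Cons.prems(2) by simp
  qed (simp add: trail_def)
  have 2: "filter_mset (\<lambda>x. h x = None) (mset w) = {#last w#}"
    if "trail t h w" "h (last w) = None" for w
    using that
  proof (induction w rule: rev_induct)
    case (snoc x w)
    have "filter_mset (\<lambda>x. h x = None) (mset w) = {#}"
    proof -
      have "successively (\<lambda>x y. h x = t y \<and> h x \<noteq> None) (w @ [x])"
        using snoc.prems(1) unfolding trail_def by (rule conjunct2)
      then have "filter (\<lambda>x. h x = None) w = []"
        unfolding filter_empty_conv by (rule successively_prev_some)
      then show ?thesis unfolding mset_filter[symmetric] by simp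
    qed
    then show ?case using snoc.prems(2) by simp
  qed (simp add: trail_def)
  have f: "(\<Sum>w\<in>#N. filter_mset Q (mset w)) = filter_mset Q (\<Sum>w\<in>#N. mset w)" for Q and N :: "'s list multiset"
    by (induction N) auto
  have "image_mset hd M = (\<Sum>w\<in>#M. {#hd w#})" by (induction M) auto
  also have "\<dots> = (\<Sum>w\<in>#M. filter_mset (\<lambda>x. t x = None) (mset w))"
  proof (rule arg_cong[where f=sum_mset], rule image_mset_cong)
    fix w assume w: "w \<in># M"
    show "{#hd w#} = filter_mset (\<lambda>x. t x = None) (mset w)"
      by (rule 1[symmetric]) (use M(2)[OF w] in simp_all)
  qed
  finally have hd: "image_mset hd M = mset_set {x\<in>S. t x = None}"
    unfolding f M(1) using fin by (simp add: filter_mset_mset_set)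
  have "image_mset last M = (\<Sum>w\<in>#M. {#last w#})" by (induction M) auto
  also have "\<dots> = (\<Sum>w\<in>#M. filter_mset (\<lambda>x. h x = None) (mset w))"
  proof (rule arg_cong[where f=sum_mset], rule image_mset_cong)
    fix w assume w: "w \<in># M"
    show "{#last w#} = filter_mset (\<lambda>x. h x = None) (mset w)"
      by (rule 2[symmetric]) (use M(2)[OF w] in simp_all)
  qed
  finally have last: "image_mset last M = mset_set {x\<in>S. h x = None}"
    unfolding f M(1) using fin by (simp add: filter_mset_mset_set)
  show ?thesis by (rule exI[of _ M]) (simp add: M(1) hd last M(2)[THEN conjunct1])
qed

text \<open>
  The condition provides two unused exits above an entry, of which one ends a route other than the
  route that starts with the entry, so that no closed route arises.
\<close>

lemma join_routes:
  fixes en ex :: "'s \<Rightarrow> real"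
  assumes "finite F" "finite E"
    and "mset_set F \<subseteq># image_mset hd M" "mset_set E \<subseteq># image_mset last M"
    and "\<And>w. w \<in># M \<Longrightarrow> w \<noteq> [] \<and> successively R w"
    and R: "\<And>P Q. P \<in> E \<Longrightarrow> Q \<in> F \<Longrightarrow> en Q \<le> ex P \<Longrightarrow> R P Q"
    and "\<And>Q. Q \<in> F \<Longrightarrow> card {Q'\<in>F. en Q \<le> en Q'} < card {P\<in>E. en Q \<le> ex P}"
  shows "\<exists>M' X. X \<subseteq> E \<and> card X = card F \<and> (\<Sum>w\<in>#M'. mset w) = (\<Sum>w\<in>#M. mset w) \<and>
    (\<forall>w. w \<in># M' \<longrightarrow> w \<noteq> [] \<and> successively R w) \<and>
    image_mset hd M = image_mset hd M' + mset_set F \<and>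
    image_mset last M = image_mset last M' + mset_set X"
  using assms
proof (induction "card F" arbitrary: F)
  case 0
  then show ?case by (intro exI[of _ M] exI[of _ "{}"]) auto
next
  case (Suc n)
  then have "F \<noteq> {}" by auto
  then have "Min (en ` F) \<in> en ` F" using Suc.prems(1) by simp
  then obtain Q where "Q \<in> F" "Min (en ` F) = en Q" by (rule imageE)
  then have Q: "Q \<in> F" "\<And>Q'. Q' \<in> F \<Longrightarrow> en Q \<le> en Q'"
    using Suc.prems(1) by (metis, metis Min_le finite_imageI imageI)
  \<comment> \<open>The lowest entry is set aside and joined last. All of \<open>F\<close> lies at
    its height or above, so the counting condition for \<open>Q\<close> compares with the whole of
    \<open>F\<close>.\<close>
  let ?F = "F - {Q}"
  have F: "mset_set F = add_mset Q (mset_set ?F)"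
    using Q(1) Suc.prems(1) by (simp add: mset_set.remove)
  have "\<exists>M' X. X \<subseteq> E \<and> card X = card ?F \<and> (\<Sum>w\<in>#M'. mset w) = (\<Sum>w\<in>#M. mset w) \<and>
    (\<forall>w. w \<in># M' \<longrightarrow> w \<noteq> [] \<and> successively R w) \<and>
    image_mset hd M = image_mset hd M' + mset_set ?F \<and>
    image_mset last M = image_mset last M' + mset_set X"
  proof (rule Suc.hyps(1))
    show "n = card ?F" using Suc.hyps(2) Q(1) by simp
    show "mset_set ?F \<subseteq># image_mset hd M"
      using subset_mset.order_trans[OF _ Suc.prems(3)] by (simp add: F)
    fix Q' assume Q': "Q' \<in> ?F"
    have "card {Q''\<in>?F. en Q' \<le> en Q''} \<le> card {Q''\<in>F. en Q' \<le> en Q''}"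
      using Suc.prems(1) by (intro card_mono) auto
    also have "\<dots> < card {P\<in>E. en Q' \<le> ex P}" using Suc.prems(7) Q' by blast
    finally show "card {Q''\<in>?F. en Q' \<le> en Q''} < card {P\<in>E. en Q' \<le> ex P}" .
  qed (use Suc.prems in auto)
  then obtain M' X where X: "X \<subseteq> E" "card X = card ?F"
    and M': "(\<Sum>w\<in>#M'. mset w) = (\<Sum>w\<in>#M. mset w)" "\<And>w. w \<in># M' \<Longrightarrow> w \<noteq> [] \<and> successively R w"
      "image_mset hd M = image_mset hd M' + mset_set ?F"
      "image_mset last M = image_mset last M' + mset_set X"
    by blast
  have finX: "finite X" using X(1) Suc.prems(2) finite_subset by blast
  have "Q \<in># image_mset hd M'"
    using Suc.prems(1,3) unfolding M'(3) F by (simp add: insert_subset_eq_iff)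
  then obtain w where w: "w \<in># M'" "hd w = Q" by auto
  let ?E = "{P\<in>E. en Q \<le> ex P}"
  have "{Q'\<in>F. en Q \<le> en Q'} = F" using Q(2) by auto
  then have "card F < card ?E" using Suc.prems(7)[OF Q(1)] by simp
  moreover have "card ?E - card X \<le> card (?E - X)" using finX by (rule diff_card_le_card_Diff)
  \<comment> \<open>At least \<open>card F + 1\<close> exits are high enough for \<open>Q\<close>
    and only \<open>card F - 1\<close> are used up. One free exit would not be enough, as it might
    be the end of the route \<open>w\<close> itself.\<close>
  ultimately have "2 \<le> card (?E - X)" using X(2) Q(1) Suc.prems(1) Suc.hyps(2) by simp
  then have "\<not> card (?E - X) \<le> card {last w}" by simp
  then have "\<not> ?E - X \<subseteq> {last w}"
    by (rule contrapos_nn) (rule card_mono, simp_all)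
  then have "\<exists>P\<in>?E - X. P \<notin> {last w}" unfolding subset_eq by simp
  then obtain P where "P \<in> ?E - X" "P \<notin> {last w}" by (rule bexE)
  then have P: "P \<in> E" "en Q \<le> ex P" "P \<notin> X" "P \<noteq> last w" by simp_all
  have "count (image_mset last M) P \<ge> count (mset_set E) P"
    using Suc.prems(4) by (simp add: mset_subset_eq_count)
  then have "P \<in># image_mset last M'"
    using P Suc.prems(2) finX unfolding M'(4) by (simp flip: count_greater_zero_iff)
  then obtain w2 where w2: "w2 \<in># M'" "last w2 = P" by auto
  then have "w \<noteq> w2" using P by auto
  then have "{#w, w2#} \<subseteq># M'" using w w2 by (simp add: insert_subset_eq_iff in_diff_count)
  then obtain N where N: "M' = {#w, w2#} + N" by (metis mset_subset_eq_exists_conv)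
  have ne: "w \<noteq> []" "w2 \<noteq> []" "successively R w" "successively R w2" using M'(2) w w2 by auto
  show ?case
  proof (intro exI[of _ "add_mset (w2 @ w) N"] exI[of _ "insert P X"] conjI)
    show "insert P X \<subseteq> E" using X P by simp
    show "card (insert P X) = card F" using P(3) X(2) finX Q(1) Suc.prems(1) Suc.hyps(2) by simp
    show "(\<Sum>w\<in>#add_mset (w2 @ w) N. mset w) = (\<Sum>w\<in>#M. mset w)"
      unfolding M'(1)[symmetric] N by (simp add: ac_simps)
    have "successively R (w2 @ w)"
      using ne Suc.prems(6)[OF P(1) Q(1) P(2)] w(2) w2(2) by (simp add: successively_append_iff)
    moreover have "x \<noteq> [] \<and> successively R x" if "x \<in># N" for x using M'(2)[of x] that N by simp
    ultimately show "\<forall>x. x \<in># add_mset (w2 @ w) N \<longrightarrow> x \<noteq> [] \<and> successively R x"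
      using ne by auto
    show "image_mset hd M = image_mset hd (add_mset (w2 @ w) N) + mset_set F"
      using M'(3) ne w unfolding N F by simp
    show "image_mset last M = image_mset last (add_mset (w2 @ w) N) + mset_set (insert P X)"
      using M'(4) ne w2 P(3) finX unfolding N by simp
  qed
qed

text \<open>To be read with \<open>A\<close> for entries and \<open>B\<close> for exits at one side:
  each entry after the first strand of a route has an exit just before it. In the companion lemma
  each exit other than a final one has an entry just after it.\<close>

lemma successively_filter_le:
  assumes "successively R (x # w)" "\<And>y z. R y z \<Longrightarrow> A z \<Longrightarrow> B y"
  shows "length (filter A w) \<le> length (filter B (x # w))"
  using assms(1)
proof (induction w arbitrary: x)
  case (Cons y w)
  then have "R x y" "length (filter A w) \<le> length (filter B (y # w))" by simp_all
  then show ?case using assms(2)[of x y] by auto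
qed simp

lemma successively_filter_ge:
  assumes "successively R (x # w)" "\<And>y z. R y z \<Longrightarrow> B y \<Longrightarrow> A z"
  shows "length (filter B (x # w)) \<le> length (filter A w) + 1"
  using assms(1)
proof (induction w arbitrary: x)
  case (Cons y w)
  then have "R x y" "length (filter B (y # w)) \<le> length (filter A w) + 1" by simp_all
  then show ?case using assms(2)[of x y] by auto
qed simp

lemma sum_count_list_filter:
  assumes "finite A"
  shows "(\<Sum>x\<in>A. count_list w x) = length (filter (\<lambda>x. x \<in> A) w)"
proof (induction w)
  case (Cons y w)
  have "(\<Sum>x\<in>A. count_list (y # w) x) = (\<Sum>x\<in>A. (if x = y then 1 else 0) + count_list w x)"
    by (rule sum.cong) auto
  then show ?case using Cons assms by (simp add: sum.distrib sum.delta)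
qed simp

text \<open>Up to constants the two sides grow in \<open>l\<close> with slopes \<open>m / h\<close>
  and \<open>m' / h\<close>, so a single large \<open>l\<close> decides.\<close>

lemma growth_le:
  fixes m m' n :: nat and h M :: real
  assumes h: "h > 0" and M: "M \<ge> 0"
    and le: "\<And>l. l \<ge> 0 \<Longrightarrow> m * ((l - 2 * M) / h - 1) \<le> n + m' * max 0 ((l + 2 * M) / h + 1)"
  shows "m \<le> m'"
proof (rule ccontr)
  assume "\<not> m \<le> m'"
  then have mm: "real m' + 1 \<le> real m" by simp
  define k where "k = 2 * M / h"
  have k: "k \<ge> 0" using h M by (simp add: k_def)
  \<comment> \<open>This is the length in units of \<open>h\<close>. If \<open>m\<close> were at
    least \<open>m' + 1\<close>, the inequality at \<open>l = y * h\<close> would give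
    \<open>y \<le> n + (m + m') * (k + 1)\<close>; the final \<open>+ 1\<close> contradicts
    that.\<close>
  define y where "y = real n + (real m + real m') * (k + 1) + 1"
  have y: "y \<ge> 1" using k by (simp add: y_def)
  have e: "(y * h - 2 * M) / h = y - k" "(y * h + 2 * M) / h = y + k" using h by (simp_all add: k_def field_simps)
  have "m * (y - k - 1) \<le> n + m' * max 0 (y + k + 1)"
    using le[of "y * h"] y h unfolding e by simp
  also have "max 0 (y + k + 1) = y + k + 1" using y k by simp
  finally have "(real m - real m') * y \<le> n + (real m + real m') * (k + 1)" by (simp add: algebra_simps)
  moreover have "1 * y \<le> (real m - real m') * y" using mm y by (intro mult_right_mono) simp_all
  ultimately show False unfolding y_def by simp
qed

section \<open>Level crossings of a real function\<close>

text \<open>The conditions on the parameters of a strand, detached from the ground. Maximality is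
  expressed by requiring every end other than 0 and 1 to lie on a level.\<close>

definition ivals :: "(real \<Rightarrow> real) \<Rightarrow> real \<Rightarrow> real \<Rightarrow> (real \<times> real) set" where
  "ivals f a b = {(s, t). 0 \<le> s \<and> s < t \<and> t \<le> 1 \<and> (\<forall>u\<in>{s<..<t}. a < f u \<and> f u < b) \<and>
     (s = 0 \<or> f s \<in> {a, b}) \<and> (t = 1 \<or> f t \<in> {a, b})}"

lemma stays_inside:
  fixes f :: "real \<Rightarrow> real"
  assumes cont: "continuous_on {s..t} f" and no: "\<forall>u\<in>{s<..<t}. f u \<notin> {a, b}"
    and u0: "u0 \<in> {s<..<t}" "a < f u0" "f u0 < b" and u: "u \<in> {s<..<t}"
  shows "a < f u \<and> f u < b"
proof -
  have con: "connected (f ` {s<..<t})"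
    by (intro connected_continuous_image continuous_on_subset[OF cont] connected_Ioo) auto
  have "a \<notin> f ` {s<..<t}" "b \<notin> f ` {s<..<t}" using no by auto
  moreover have "f u \<in> f ` {s<..<t}" "f u0 \<in> f ` {s<..<t}" using u0 u by simp_all
  ultimately show ?thesis
    using connectedD_interval[OF con, of "f u" "f u0" a] connectedD_interval[OF con, of "f u0" "f u" b] u0
    by (meson less_le not_le)
qed

text \<open>Of two different intervals with a common end, the shorter one would have its other end
  on a level and in the interior of the longer one, where levels are avoided.\<close>

lemma ivals_unique:
  assumes "(s, t) \<in> ivals f a b" "(s', t') \<in> ivals f a b" "s = s' \<or> t = t'"
  shows "s = s' \<and> t = t'"
proof -
  have 1: "\<not> t1 < t2" if "(s, t1) \<in> ivals f a b" "(s, t2) \<in> ivals f a b" for s t1 t2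
  proof
    assume "t1 < t2"
    with that have "t1 \<in> {s<..<t2}" "f t1 \<in> {a, b}" by (auto simp: ivals_def)
    with that(2) show False by (auto simp: ivals_def)
  qed
  have 2: "\<not> s1 < s2" if "(s1, t) \<in> ivals f a b" "(s2, t) \<in> ivals f a b" for t s1 s2
  proof
    assume "s1 < s2"
    with that have "s2 \<in> {s1<..<t}" "f s2 \<in> {a, b}" by (auto simp: ivals_def)
    with that(1) show False by (auto simp: ivals_def)
  qed
  from assms(3) show ?thesis
  proof
    assume s: "s = s'"
    show ?thesis using 1[OF assms(1), of t'] 1[of s t' t] assms(1,2) s by simp
  next
    assume t: "t = t'"
    show ?thesis using 2[OF assms(1), of s'] 2[of s' t s] assms(1,2) t by simp
  qed
qed

text \<open>The other end is the first parameter after \<open>s\<close> at which a level is met, or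
  1. It exists because levels are met only finitely often.\<close>

lemma ivals_start:
  assumes cont: "continuous_on {0..1} f" and fin: "finite {t\<in>{0..1}. f t \<in> {a, b}}"
    and s: "0 \<le> s" "s < 1" "s = 0 \<or> f s \<in> {a, b}"
    and ev: "\<forall>\<^sub>F u in at_right s. a < f u \<and> f u < b"
  shows "\<exists>t. (s, t) \<in> ivals f a b"
proof -
  define Z where "Z = insert 1 {t\<in>{s<..1}. f t \<in> {a, b}}"
  have "finite Z" unfolding Z_def by (rule finite.insertI, rule finite_subset[OF _ fin]) (use s in auto)
  moreover have "Z \<noteq> {}" by (simp add: Z_def)
  ultimately have Min: "Min Z \<in> Z" "\<And>z. z \<in> Z \<Longrightarrow> Min Z \<le> z" by simp_all
  define t where "t = Min Z"
  have t: "s < t" "t \<le> 1" "t = 1 \<or> f t \<in> {a, b}" using Min(1) s by (auto simp: t_def Z_def)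
  have no: "\<forall>u\<in>{s<..<t}. f u \<notin> {a, b}"
  proof
    fix u assume u: "u \<in> {s<..<t}"
    show "f u \<notin> {a, b}"
    proof
      assume "f u \<in> {a, b}"
      then have "u \<in> Z" using u t(2) by (simp add: Z_def)
      from Min(2)[OF this] show False using u by (simp add: t_def)
    qed
  qed
  obtain r where r: "r > s" "\<forall>y>s. y < r \<longrightarrow> a < f y \<and> f y < b"
    using ev t(1) unfolding eventually_at_right[OF t(1)] by auto
  define u0 where "u0 = (s + min r t) / 2"
  have u0: "u0 \<in> {s<..<t}" "a < f u0" "f u0 < b" using r t(1) by (auto simp: u0_def)
  have "continuous_on {s..t} f" by (rule continuous_on_subset[OF cont]) (use s t in auto)
  from stays_inside[OF this no u0] show ?thesis
    using s t by (intro exI[of _ t]) (simp add: ivals_def)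
qed

lemma ivals_stop:
  assumes cont: "continuous_on {0..1} f" and fin: "finite {t\<in>{0..1}. f t \<in> {a, b}}"
    and t: "0 < t" "t \<le> 1" "t = 1 \<or> f t \<in> {a, b}"
    and ev: "\<forall>\<^sub>F u in at_left t. a < f u \<and> f u < b"
  shows "\<exists>s. (s, t) \<in> ivals f a b"
proof -
  define Z where "Z = insert 0 {s\<in>{0..<t}. f s \<in> {a, b}}"
  have "finite Z" unfolding Z_def by (rule finite.insertI, rule finite_subset[OF _ fin]) (use t in auto)
  moreover have "Z \<noteq> {}" by (simp add: Z_def)
  ultimately have Max: "Max Z \<in> Z" "\<And>z. z \<in> Z \<Longrightarrow> z \<le> Max Z" by simp_all
  define s where "s = Max Z"
  have s: "s < t" "0 \<le> s" "s = 0 \<or> f s \<in> {a, b}" using Max(1) t by (auto simp: s_def Z_def)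
  have no: "\<forall>u\<in>{s<..<t}. f u \<notin> {a, b}"
  proof
    fix u assume u: "u \<in> {s<..<t}"
    show "f u \<notin> {a, b}"
    proof
      assume "f u \<in> {a, b}"
      then have "u \<in> Z" using u s(2) by (simp add: Z_def)
      from Max(2)[OF this] show False using u by (simp add: s_def)
    qed
  qed
  obtain r where r: "r < t" "\<forall>y>r. y < t \<longrightarrow> a < f y \<and> f y < b"
    using ev s(1) unfolding eventually_at_left[OF s(1)] by auto
  define u0 where "u0 = (max r s + t) / 2"
  have u0: "u0 \<in> {s<..<t}" "a < f u0" "f u0 < b" using r s(1) by (auto simp: u0_def)
  have "continuous_on {s..t} f" by (rule continuous_on_subset[OF cont]) (use s t in auto)
  from stays_inside[OF this no u0] show ?thesis
    using s t by (intro exI[of _ s]) (simp add: ivals_def)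
qed

lemma ivals_eventually:
  assumes "(s, t) \<in> ivals f a b"
  shows "\<forall>\<^sub>F u in at_right s. a < f u \<and> f u < b" "\<forall>\<^sub>F u in at_left t. a < f u \<and> f u < b"
proof -
  have st: "s < t" and *: "\<forall>u\<in>{s<..<t}. a < f u \<and> f u < b" using assms by (auto simp: ivals_def)
  show "\<forall>\<^sub>F u in at_right s. a < f u \<and> f u < b"
    unfolding eventually_at_right[OF st] using st * by (intro exI[of _ t]) simp
  show "\<forall>\<^sub>F u in at_left t. a < f u \<and> f u < b"
    unfolding eventually_at_left[OF st] using st * by (intro exI[of _ s]) simp
qed

lemma eventually_right_continuous:
  fixes f :: "real \<Rightarrow> real"
  assumes cont: "continuous_on {0..1} f" and s: "0 \<le> s" "s < 1" and S: "open S" "f s \<in> S"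
  shows "\<forall>\<^sub>F u in at_right s. f u \<in> S"
proof -
  have "(f \<longlongrightarrow> f s) (at s within {0..1})" using cont s by (auto simp: continuous_on)
  then have "(f \<longlongrightarrow> f s) (at s within {s..1})" by (rule tendsto_within_subset) (use s in auto)
  then have "(f \<longlongrightarrow> f s) (at_right s)" using s by (simp add: at_within_Icc_at_right)
  from topological_tendstoD[OF this S] show ?thesis .
qed

lemma eventually_left_continuous:
  fixes f :: "real \<Rightarrow> real"
  assumes cont: "continuous_on {0..1} f" and s: "0 < s" "s \<le> 1" and S: "open S" "f s \<in> S"
  shows "\<forall>\<^sub>F u in at_left s. f u \<in> S"
proof -
  have "(f \<longlongrightarrow> f s) (at s within {0..1})" using cont s by (auto simp: continuous_on)
  then have "(f \<longlongrightarrow> f s) (at s within {0..s})" by (rule tendsto_within_subset) (use s in auto)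
  then have "(f \<longlongrightarrow> f s) (at_left s)" using s by (simp add: at_within_Icc_at_left)
  from topological_tendstoD[OF this S] show ?thesis .
qed

lemma eventually_sign_connected:
  fixes f :: "real \<Rightarrow> real"
  assumes con: "connected (f ` I)" and c: "c \<notin> f ` I" and F: "F \<noteq> bot" and ev: "\<forall>\<^sub>F u in F. u \<in> I"
  shows "(\<forall>\<^sub>F u in F. f u < c) \<longleftrightarrow> \<not> (\<forall>\<^sub>F u in F. f u > c)"
proof -
  have "\<exists>m. m \<in> I" using eventually_happens[OF ev] F by simp
  then obtain m where m: "m \<in> I" by (rule exE)
  have side: "f u \<noteq> c \<and> (f u < c) = (f m < c)" if u: "u \<in> I" for u
  proof -
    have "f u \<noteq> c" "f m \<noteq> c" using c imageI[OF u, of f] imageI[OF m, of f] by metis+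
    then show ?thesis
      using connectedD_interval[OF con imageI[OF u] imageI[OF m], of c]
        connectedD_interval[OF con imageI[OF m] imageI[OF u], of c] c by linarith
  qed
  have not_both: "\<not> ((\<forall>\<^sub>F u in F. f u < c) \<and> (\<forall>\<^sub>F u in F. f u > c))"
  proof
    assume "(\<forall>\<^sub>F u in F. f u < c) \<and> (\<forall>\<^sub>F u in F. f u > c)"
    then have "\<forall>\<^sub>F u in F. f u < c \<and> c < f u" unfolding eventually_conj_iff .
    then have "\<forall>\<^sub>F u in F. False" by (rule eventually_mono) auto
    then show False using F by simp
  qed
  show ?thesis
  proof (cases "f m < c")
    case True
    have "\<forall>\<^sub>F u in F. f u < c" by (rule eventually_mono[OF ev]) (use side True in simp)
    then show ?thesis using not_both by simp
  next
    case False
    have "\<forall>\<^sub>F u in F. f u > c"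
    proof (rule eventually_mono[OF ev])
      fix u assume "u \<in> I"
      from side[OF this] show "f u > c" using False by linarith
    qed
    then show ?thesis using not_both by simp
  qed
qed

text \<open>Finiteness isolates \<open>t\<close> among the parameters at level \<open>c\<close>. On
  a short interval to either side the function avoids \<open>c\<close> and so keeps its sign, which
  turns the failure of one inequality into the opposite one.\<close>

lemma eventually_sides:
  fixes f :: "real \<Rightarrow> real"
  assumes cont: "continuous_on {0..1} f" and fin: "finite {t\<in>{0..1}. f t = c}" and t: "t \<in> {0<..<1}"
  shows "(\<forall>\<^sub>F u in at_right t. f u < c) \<longleftrightarrow> \<not> (\<forall>\<^sub>F u in at_right t. f u > c)"
    and "(\<forall>\<^sub>F u in at_left t. f u < c) \<longleftrightarrow> \<not> (\<forall>\<^sub>F u in at_left t. f u > c)"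
proof -
  have "\<not> t islimpt {s\<in>{0..1}. f s = c}" by (rule islimpt_finite[OF fin])
  then obtain r where r: "r > 0" "\<forall>s\<in>{s\<in>{0..1}. f s = c}. s \<noteq> t \<longrightarrow> r \<le> dist s t"
    unfolding islimpt_approachable by (auto simp: not_less)
  define d where "d = min r (min t (1 - t))"
  have d: "d > 0" using r(1) t by (simp add: d_def)
  have no: "c \<notin> f ` I" and con: "connected (f ` I)"
    if I: "I \<subseteq> {t - d<..<t + d} - {t}" "connected I" for I
  proof -
    have near: "t - d < s" "s < t + d" "s \<noteq> t" if "s \<in> I" for s using subsetD[OF I(1) that] by simp_all
    have dt: "d \<le> t" "d \<le> 1 - t" "d \<le> r" by (simp_all add: d_def)
    have I01: "I \<subseteq> {0..1}"
    proof
      fix s assume "s \<in> I"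
      from near(1,2)[OF this] show "s \<in> {0..1}" using dt by simp
    qed
    show "c \<notin> f ` I"
    proof
      assume "c \<in> f ` I"
      then obtain s where s: "s \<in> I" "f s = c" by auto
      then have "s \<in> {s\<in>{0..1}. f s = c}" using I01 by auto
      then have "r \<le> dist s t" using r(2) near(3)[OF s(1)] by simp
      then show False using near(1,2)[OF s(1)] dt(3) unfolding dist_real_def by linarith
    qed
    show "connected (f ` I)"
      by (rule connected_continuous_image[OF continuous_on_subset[OF cont I01] I(2)])
  qed
  have "{t<..<t + d} \<subseteq> {t - d<..<t + d} - {t}" "{t - d<..<t} \<subseteq> {t - d<..<t + d} - {t}" by auto
  note r_side = no[OF this(1) connected_Ioo] con[OF this(1) connected_Ioo]
    and l_side = no[OF this(2) connected_Ioo] con[OF this(2) connected_Ioo]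
  have tr: "t < t + d" and tl: "t - d < t" using d by simp_all
  have "\<forall>\<^sub>F u in at_right t. u \<in> {t<..<t + d}"
    unfolding eventually_at_right[OF tr] using d by (intro exI[of _ "t + d"]) simp
  then show "(\<forall>\<^sub>F u in at_right t. f u < c) \<longleftrightarrow> \<not> (\<forall>\<^sub>F u in at_right t. f u > c)"
    by (intro eventually_sign_connected[OF r_side(2,1)]) simp_all
  have "\<forall>\<^sub>F u in at_left t. u \<in> {t - d<..<t}"
    unfolding eventually_at_left[OF tl] using d by (intro exI[of _ "t - d"]) simp
  then show "(\<forall>\<^sub>F u in at_left t. f u < c) \<longleftrightarrow> \<not> (\<forall>\<^sub>F u in at_left t. f u > c)"
    by (intro eventually_sign_connected[OF l_side(2,1)]) simp_all
qed

text \<open>The count is \<open>floor (y / h) - ceiling (x / h) + 1\<close>, cut off at 0 when the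
  interval is empty; hence the \<open>max\<close> in the upper bound.\<close>

lemma card_multiples_in:
  fixes h :: real
  assumes h: "h > 0"
  shows "finite {j::int. x \<le> of_int j * h \<and> of_int j * h \<le> y}"
    and "real (card {j::int. x \<le> of_int j * h \<and> of_int j * h \<le> y}) \<le> max 0 ((y - x) / h + 1)"
    and "(y - x) / h - 1 \<le> real (card {j::int. x \<le> of_int j * h \<and> of_int j * h \<le> y})"
proof -
  define u where "u = \<lceil>x / h\<rceil>"
  define v where "v = \<lfloor>y / h\<rfloor>"
  have lev: "x \<le> of_int j * h \<and> of_int j * h \<le> y \<longleftrightarrow> u \<le> j \<and> j \<le> v" for j :: int
    unfolding u_def v_def ceiling_le_iff le_floor_iff using h by (simp add: field_simps)
  have eq: "{j::int. x \<le> of_int j * h \<and> of_int j * h \<le> y} = {u..v}" unfolding lev by auto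
  show "finite {j::int. x \<le> of_int j * h \<and> of_int j * h \<le> y}" unfolding eq by simp
  have d: "(y - x) / h = y / h - x / h" by (rule diff_divide_distrib)
  have uv: "x / h \<le> of_int u" "of_int u < x / h + 1" "of_int v \<le> y / h" "y / h < of_int v + 1"
    unfolding u_def v_def by linarith+
  have c: "real (card {u..v}) = max 0 (of_int v - of_int u + 1)" by (simp add: max_def)
  show "real (card {j::int. x \<le> of_int j * h \<and> of_int j * h \<le> y}) \<le> max 0 ((y - x) / h + 1)"
    unfolding eq c d using uv by (intro max.mono) linarith+
  show "(y - x) / h - 1 \<le> real (card {j::int. x \<le> of_int j * h \<and> of_int j * h \<le> y})"
    unfolding eq c d using uv by linarith
qed

section \<open>The lattice cover of a toroidal embedding\<close>

lemma cis_eq_iff: "cis (2 * pi * x) = cis (2 * pi * y) \<longleftrightarrow> (\<exists>n::int. y = x + of_int n)"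
proof -
  have "cis (2 * pi * x) = cis (2 * pi * y) \<longleftrightarrow>
      sin (2 * pi * y) = sin (2 * pi * x) \<and> cos (2 * pi * y) = cos (2 * pi * x)"
    by (auto simp: complex_eq_iff)
  also have "\<dots> \<longleftrightarrow> (\<exists>n::int. 2 * pi * y = 2 * pi * x + 2 * pi * of_int n)"
    by (rule sin_cos_eq_iff)
  also have "\<dots> \<longleftrightarrow> (\<exists>n::int. y = x + of_int n)"
    unfolding distrib_left[symmetric] by simp
  finally show ?thesis .
qed

section \<open>Concatenated curves and directed walks\<close>

fun join_paths :: "('e \<Rightarrow> real \<Rightarrow> 'v::topological_space) \<Rightarrow> 'e list \<Rightarrow> real \<Rightarrow> 'v" where
  "join_paths g [] = g undefined"
| "join_paths g [e] = g e"
| "join_paths g (e # e' # es) = g e +++ join_paths g (e' # es)"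

lemma pathstart_join_paths: "es \<noteq> [] \<Longrightarrow> pathstart (join_paths g es) = pathstart (g (hd es))"
  by (induction g es rule: join_paths.induct) simp_all

lemma pathfinish_join_paths: "es \<noteq> [] \<Longrightarrow> pathfinish (join_paths g es) = pathfinish (g (last es))"
  by (induction g es rule: join_paths.induct) simp_all

lemma path_image_join_paths:
  assumes "successively (\<lambda>e e'. pathfinish (g e) = pathstart (g e')) es" "es \<noteq> []"
  shows "path_image (join_paths g es) = (\<Union>e\<in>set es. path_image (g e))"
  using assms
proof (induction g es rule: join_paths.induct)
  case (3 g e e' es)
  then have "pathfinish (g e) = pathstart (join_paths g (e' # es))" by (simp add: pathstart_join_paths)
  from path_image_join[OF this] show ?case using 3 by simp
qed simp_all

lemma cas_arcs_update: "pre_digraph.cas (H\<lparr>arcs := A\<rparr>) u es v = pre_digraph.cas H u es v"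
  by (induction es arbitrary: u) (simp_all add: pre_digraph.cas.simps)

lemma awalk_verts_cas:
  "pre_digraph.cas H u es v \<Longrightarrow> pre_digraph.awalk_verts H u es = u # map (head H) es"
  by (induction es arbitrary: u) (simp_all add: pre_digraph.cas.simps pre_digraph.awalk_verts.simps)

lemma cas_chain:
  "pre_digraph.cas H u es v \<Longrightarrow> successively (\<lambda>e e'. head H e = tail H e') es \<and>
     (es \<noteq> [] \<longrightarrow> tail H (hd es) = u \<and> head H (last es) = v)"
  by (induction es arbitrary: u)
    (auto simp: pre_digraph.cas.simps successively_Cons split: if_splits)

text \<open>Common elements cancel. For the one-sided sets at a meridian these are the points where
  an arc touches it from the right.\<close>

lemma card_Diff_diff:
  assumes "finite A" "finite B"
  shows "int (card (A - B)) - int (card (B - A)) = int (card A) - int (card B)"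
proof -
  have "card A = card (A - B) + card (A \<inter> B)" "card B = card (B - A) + card (A \<inter> B)"
    using assms card_Diff_subset_Int[of A B] card_Diff_subset_Int[of B A]
      card_mono[OF assms(1), of "A \<inter> B"] card_mono[OF assms(2), of "A \<inter> B"]
    by (simp_all add: Int_commute)
  then show ?thesis by simp
qed

locale toroidal_ground =
  fixes D :: "('a, 'b) ground"
  assumes reg: "two_regular (digraph D)" and emb: "toroidal_embedding D"
begin

abbreviation "G \<equiv> digraph D"
abbreviation "p \<equiv> fst (period D)"
abbreviation "q \<equiv> snd (period D)"
abbreviation "h \<equiv> vperiod D"

definition latt :: "int \<times> int \<Rightarrow> real \<times> real" where
  "latt k = of_int (fst k) *\<^sub>R period D + of_int (snd k) *\<^sub>R (0, h)"

lemma p_pos: "p > 0" and h_pos: "h > 0"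
  using emb by (simp_all add: toroidal_embedding_def)

lemma fin_digraph_G: "fin_digraph G"
  using reg by (simp add: two_regular_def)

lemma finite_arcs_G: "finite (arcs G)" and finite_verts_G: "finite (verts G)"
  using fin_digraph.finite_arcs[OF fin_digraph_G] fin_digraph.finite_verts[OF fin_digraph_G] .

lemma wf_digraph_G: "wf_digraph G"
  using fin_digraph_G by (simp add: fin_digraph_def)

lemma ends_in_verts:
  assumes "e \<in> arcs G"
  shows "tail G e \<in> verts G" "head G e \<in> verts G"
  using wf_digraph.tail_in_verts[OF wf_digraph_G assms] wf_digraph.head_in_verts[OF wf_digraph_G assms]
  by simp_all

lemma degree: "v \<in> verts G \<Longrightarrow> card {e\<in>arcs G. tail G e = v} = 2"
  "v \<in> verts G \<Longrightarrow> card {e\<in>arcs G. head G e = v} = 2"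
  using reg by (simp_all add: two_regular_def in_degree_def out_degree_def in_arcs_def out_arcs_def)

lemma latt_eq: "latt k = (of_int (fst k) * p, of_int (fst k) * q + of_int (snd k) * h)"
  by (simp add: latt_def prod_eq_iff)

lemma latt_add: "latt (k + l) = latt k + latt l"
  and latt_0 [simp]: "latt 0 = 0"
  and latt_minus: "latt (- k) = - latt k"
  and latt_diff: "latt (k - l) = latt k - latt l"
  by (simp_all add: latt_eq prod_eq_iff algebra_simps)

lemma latt_eq_0_iff: "latt k = 0 \<longleftrightarrow> k = 0"
  using p_pos h_pos by (auto simp: latt_eq prod_eq_iff)

lemma lift_eq: "lift D e k t = curve D e t + latt k"
  by (simp add: lift_def latt_def add.assoc)

lemma to_torus_eq_iff: "to_torus D z = to_torus D w \<longleftrightarrow> (\<exists>k. w = z + latt k)"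
proof
  assume "to_torus D z = to_torus D w"
  then have "(\<exists>n::int. fst w / p = fst z / p + of_int n) \<and>
      (\<exists>m::int. (snd w - fst w / p * q) / h = (snd z - fst z / p * q) / h + of_int m)"
    unfolding to_torus_def Let_def prod.inject cis_eq_iff .
  then obtain n m :: int where n: "fst w / p = fst z / p + of_int n"
    and m: "(snd w - fst w / p * q) / h = (snd z - fst z / p * q) / h + of_int m"
    by (elim conjE exE)
  have 1: "fst w = fst z + of_int n * p" using n p_pos by (simp add: field_simps)
  have "snd w - fst w / p * q = snd z - fst z / p * q + of_int m * h"
    using m h_pos by (simp add: field_simps)
  then have "snd w = snd z + of_int n * q + of_int m * h" unfolding n by (simp add: algebra_simps)
  with 1 show "\<exists>k. w = z + latt k"
    by (intro exI[of _ "(n, m)"]) (simp add: latt_eq prod_eq_iff)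
next
  assume "\<exists>k. w = z + latt k"
  then obtain k where w: "w = z + latt k" by (rule exE)
  have 1: "fst w / p = fst z / p + of_int (fst k)" using p_pos by (simp add: w latt_eq field_simps)
  have "(snd w - fst w / p * q) / h = (snd z - fst z / p * q) / h + of_int (snd k)"
    unfolding 1 using h_pos by (simp add: w latt_eq field_simps)
  with 1 show "to_torus D z = to_torus D w"
    unfolding to_torus_def Let_def prod.inject cis_eq_iff by (intro conjI exI)
qed

lemma to_torus_lift [simp]: "to_torus D (lift D e k t) = to_torus D (curve D e t)"
  by (rule sym, unfold to_torus_eq_iff, rule exI[of _ k], rule lift_eq)

lemma to_torus_ends:
  assumes "e \<in> arcs G"
  shows "to_torus D (curve D e 0) = to_torus D (place D (tail G e))"
    "to_torus D (curve D e 1) = to_torus D (place D (head G e))"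
  using emb assms by (simp_all add: toroidal_embedding_def)

lemma place_inj:
  assumes "to_torus D (place D v) = to_torus D (place D w)" "v \<in> verts G" "w \<in> verts G"
  shows "v = w"
  using emb assms unfolding toroidal_embedding_def by (blast dest: inj_onD)

lemma continuous_lift: "e \<in> arcs G \<Longrightarrow> continuous_on {0..1} (lift D e k)"
  unfolding lift_eq using emb
  by (intro continuous_intros) (simp add: toroidal_embedding_def path_def)

lemma curves_meet:
  assumes e: "e \<in> arcs G" "e' \<in> arcs G" and s: "s \<in> {0..1}" "s' \<in> {0..1}"
    and eq: "to_torus D (curve D e s) = to_torus D (curve D e' s')"
  shows "e = e' \<and> s = s' \<or> s \<in> {0, 1} \<and> s' \<in> {0, 1}"
proof -
  have inj: "inj_on (\<lambda>(e, t). to_torus D (curve D e t)) (arcs G \<times> {0<..<1})"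
    and off: "\<forall>e\<in>arcs G. \<forall>t\<in>{0<..<1}. \<forall>v\<in>verts G. to_torus D (curve D e t) \<noteq> to_torus D (place D v)"
    using emb by (simp_all add: toroidal_embedding_def)
  have at_end: "\<exists>v\<in>verts G. to_torus D (curve D e t) = to_torus D (place D v)"
    if "e \<in> arcs G" "t \<in> {0, 1}" for e t
  proof (cases "t = 0")
    case True
    then show ?thesis using to_torus_ends(1)[OF that(1)] ends_in_verts(1)[OF that(1)] by auto
  next
    case False
    then have "t = 1" using that(2) by simp
    then show ?thesis using to_torus_ends(2)[OF that(1)] ends_in_verts(2)[OF that(1)] by auto
  qed
  have c: "t \<in> {0<..<1} \<or> t \<in> {0, 1}" if "t \<in> {0..1}" for t :: real using that by auto
  consider "s \<in> {0<..<1}" "s' \<in> {0<..<1}" | "s \<in> {0, 1}" "s' \<in> {0, 1}"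
    | "s \<in> {0<..<1}" "s' \<in> {0, 1}" | "s \<in> {0, 1}" "s' \<in> {0<..<1}"
    using c[OF s(1)] c[OF s(2)] by argo
  then show ?thesis
  proof cases
    case 1
    have "(e, s) = (e', s')" by (rule inj_onD[OF inj]) (use 1 e eq in simp_all)
    then show ?thesis by simp
  next
    case 3
    obtain v where "v \<in> verts G" "to_torus D (curve D e' s') = to_torus D (place D v)"
      using at_end[OF e(2) 3(2)] by (rule bexE)
    then show ?thesis using off e(1) 3(1) eq by metis
  next
    case 4
    obtain v where "v \<in> verts G" "to_torus D (curve D e s) = to_torus D (place D v)"
      using at_end[OF e(1) 4(1)] by (rule bexE)
    then show ?thesis using off e(2) 4(2) eq by metis
  qed simp
qed

section \<open>Finite closed sets of lifted arcs\<close>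

definition arc_ends :: "'b \<times> int \<times> int \<Rightarrow> (real \<times> real) set" where
  "arc_ends x = {lift D (fst x) (snd x) 0, lift D (fst x) (snd x) 1}"

text \<open>Such a set consists of all arcs of some connected components of the infinite ground,
  directions being ignored.\<close>

definition arc_closed :: "('b \<times> int \<times> int) set \<Rightarrow> bool" where
  "arc_closed T \<longleftrightarrow> fst ` T \<subseteq> arcs G \<and>
     (\<forall>x\<in>T. \<forall>y. fst y \<in> arcs G \<longrightarrow> arc_ends x \<inter> arc_ends y \<noteq> {} \<longrightarrow> y \<in> T)"

definition shift_arc :: "int \<times> int \<Rightarrow> 'b \<times> int \<times> int \<Rightarrow> 'b \<times> int \<times> int" where
  "shift_arc v x = (fst x, snd x + v)"

lemma arc_ends_shift: "z \<in> arc_ends (shift_arc v x) \<longleftrightarrow> z - latt v \<in> arc_ends x"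
  by (simp add: arc_ends_def shift_arc_def lift_eq latt_add algebra_simps)

lemma arc_closedD:
  "\<lbrakk>arc_closed T; x \<in> T; fst y \<in> arcs G; z \<in> arc_ends x; z \<in> arc_ends y\<rbrakk> \<Longrightarrow> y \<in> T"
  unfolding arc_closed_def by (metis disjoint_iff)

lemma arc_closed_shift:
  assumes "arc_closed T"
  shows "arc_closed (shift_arc v ` T)"
  unfolding arc_closed_def
proof (intro conjI ballI allI impI)
  show "fst ` shift_arc v ` T \<subseteq> arcs G"
    using assms by (auto simp: arc_closed_def shift_arc_def)
  fix x y assume "x \<in> shift_arc v ` T" and y: "fst y \<in> arcs G" "arc_ends x \<inter> arc_ends y \<noteq> {}"
  then obtain x' where x': "x' \<in> T" "x = shift_arc v x'" by (elim imageE)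
  obtain z where z: "z \<in> arc_ends x" "z \<in> arc_ends y" using y(2) by (meson disjoint_iff)
  have 1: "z - latt v \<in> arc_ends x'" using z(1) unfolding x'(2) arc_ends_shift .
  have 2: "z - latt v \<in> arc_ends (shift_arc (- v) y)"
    using z(2) unfolding arc_ends_shift latt_minus by simp
  have "shift_arc (- v) y \<in> T"
    by (rule arc_closedD[OF assms x'(1) _ 1 2]) (use y(1) in \<open>simp add: shift_arc_def\<close>)
  then have "shift_arc v (shift_arc (- v) y) \<in> shift_arc v ` T" by (rule imageI)
  then show "y \<in> shift_arc v ` T" by (simp add: shift_arc_def)
qed

text \<open>Closed sets are stable under translation and intersection, so a closed set of least size
  that meets its translate by \<open>v\<close> is equal to that translate. A nonempty finite set is
  invariant only under the zero translation.\<close>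

lemma minimal_arc_closed:
  assumes "arc_closed T" "finite T" "T \<noteq> {}"
  obtains T' where "arc_closed T'" "finite T'" "T' \<noteq> {}"
    "\<forall>x\<in>T'. \<forall>y\<in>T'. \<forall>z v. z \<in> arc_ends x \<longrightarrow> z + latt v \<in> arc_ends y \<longrightarrow> v = 0"
proof -
  define ok where "ok T \<longleftrightarrow> arc_closed T \<and> finite T \<and> T \<noteq> {}" for T
  have "ok T" using assms by (simp add: ok_def)
  from ex_has_least_nat[of ok, OF this, of card]
  obtain T' where T': "ok T'" and least: "\<forall>S. ok S \<longrightarrow> card T' \<le> card S" by (elim exE conjE)
  have cl: "arc_closed T'" and fin: "finite T'" and ne: "T' \<noteq> {}" using T' by (simp_all add: ok_def)
  have *: "v = 0" if x: "x \<in> T'" and y: "y \<in> T'" and z: "z \<in> arc_ends x" "z + latt v \<in> arc_ends y" for x y z v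
  proof -
    let ?S = "shift_arc v ` T'"
    note clS = arc_closed_shift[OF cl, of v]
    have ya: "fst y \<in> arcs G" using cl y by (auto simp: arc_closed_def)
    have "z + latt v \<in> arc_ends (shift_arc v x)" unfolding arc_ends_shift using z(1) by simp
    then have "y \<in> ?S" using arc_closedD[OF clS imageI[OF x] ya _ z(2)] by simp
    have "arc_closed (T' \<inter> ?S)"
      unfolding arc_closed_def
    proof (intro conjI ballI allI impI)
      show "fst ` (T' \<inter> ?S) \<subseteq> arcs G" using cl by (auto simp: arc_closed_def)
      fix a b assume a: "a \<in> T' \<inter> ?S" and b: "fst b \<in> arcs G" "arc_ends a \<inter> arc_ends b \<noteq> {}"
      obtain w where w: "w \<in> arc_ends a" "w \<in> arc_ends b" using b(2) by (meson disjoint_iff)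
      show "b \<in> T' \<inter> ?S"
        using arc_closedD[OF cl _ b(1) w] arc_closedD[OF clS _ b(1) w] a by simp
    qed
    then have "ok (T' \<inter> ?S)" using fin y \<open>y \<in> ?S\<close> by (auto simp: ok_def)
    then have "card T' \<le> card (T' \<inter> ?S)" using least by simp
    then have "T' \<inter> ?S = T'" using fin by (intro card_subset_eq) (simp_all add: card_mono le_antisym)
    then have "T' \<subseteq> ?S" by (simp only: inf.absorb_iff1)
    have inj: "inj_on (shift_arc v) T'" by (rule inj_onI) (simp add: shift_arc_def prod_eq_iff)
    have "T' = ?S"
      using \<open>T' \<subseteq> ?S\<close> fin by (intro card_subset_eq) (simp_all add: card_image[OF inj])
    \<comment> \<open>Comparing the sums of the cells turns invariance into
      \<open>card T' * v = 0\<close>, coordinate by coordinate.\<close>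
    then have "(\<Sum>x\<in>T'. snd x) = (\<Sum>x\<in>?S. snd x)" by (rule arg_cong)
    also have "\<dots> = (\<Sum>x\<in>T'. snd x + v)"
      unfolding sum.reindex[OF inj] by (simp add: shift_arc_def)
    finally have "(\<Sum>x\<in>T'. v) = 0" unfolding sum.distrib by simp
    moreover have "fst (\<Sum>x\<in>T'. v) = int (card T') * fst v" "snd (\<Sum>x\<in>T'. v) = int (card T') * snd v"
      unfolding fst_sum snd_sum by simp_all
    ultimately show "v = 0" using fin ne by (simp add: prod_eq_iff)
  qed
  show thesis by (rule that[OF cl fin ne], intro ballI allI impI, rule *)
qed

lemma tail_in_heads:
  assumes "successively (\<lambda>e e'. head G e = tail G e') (e # es)" "e' \<in> set es"
  shows "tail G e' \<in> head G ` set (e # es)"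
  using assms by (induction es arbitrary: e) auto

text \<open>Distinct heads, none of them the initial vertex, mean that the walk repeats no vertex.
  Since different arcs meet only at their ends, the first lift can meet the remaining ones only at
  its own head.\<close>

lemma arc_join_paths:
  assumes es: "es \<noteq> []" "set es \<subseteq> arcs G"
    and conn: "\<And>e e'. \<lbrakk>e \<in> set es; e' \<in> set es; head G e = tail G e'\<rbrakk> \<Longrightarrow> lift D e (k e) 1 = lift D e' (k e') 0"
    and chain: "successively (\<lambda>e e'. head G e = tail G e') es"
    and dist: "distinct (map (head G) es)" "tail G (hd es) \<notin> head G ` set es"
  shows "arc (join_paths (\<lambda>e. lift D e (k e)) es)"
  using assms
proof (induction es)
  case (Cons e es)
  let ?g = "\<lambda>e. lift D e (k e)"
  have eA: "e \<in> arcs G" using Cons.prems(2) by simp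
  have arc_e: "arc (?g e)"
    unfolding arc_def
  proof (intro conjI inj_onI)
    show "path (lift D e (k e))" unfolding path_def by (rule continuous_lift[OF eA])
    fix s t assume st: "s \<in> {0..1}" "t \<in> {0..1}" and "lift D e (k e) s = lift D e (k e) t"
    then have eq: "to_torus D (curve D e s) = to_torus D (curve D e t)" by (simp add: lift_eq)
    have ne: "to_torus D (curve D e 0) \<noteq> to_torus D (curve D e 1)"
      unfolding to_torus_ends[OF eA]
      using place_inj[OF _ ends_in_verts[OF eA]] Cons.prems(6) by auto
    from curves_meet[OF eA eA st eq] show "s = t"
    proof
      assume "s \<in> {0, 1} \<and> t \<in> {0, 1}"
      then show "s = t" using eq ne by auto
    qed simp
  qed
  show ?case
  proof (cases es)
    case Nil
    then show ?thesis using arc_e by simp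
  next
    case es: (Cons e' es')
    have ch: "successively (\<lambda>e e'. head G e = tail G e') es" "head G e = tail G e'"
      using Cons.prems(4) unfolding es by simp_all
    have "arc (join_paths ?g es)"
    proof (rule Cons.IH)
      show "tail G (hd es) \<notin> head G ` set es" using ch(2) Cons.prems(5) by (simp add: es)
    qed (use Cons.prems ch es in auto)
    moreover have fs: "pathfinish (?g e) = pathstart (join_paths ?g es)"
    proof -
      have "lift D e (k e) 1 = lift D e' (k e') 0"
        by (rule Cons.prems(3)) (use ch es in simp_all)
      then show ?thesis using pathstart_join_paths[of es ?g] by (simp add: es pathfinish_def pathstart_def)
    qed
    moreover have "path_image (?g e) \<inter> path_image (join_paths ?g es) \<subseteq> {pathstart (join_paths ?g es)}"
    proof
      fix z assume z: "z \<in> path_image (?g e) \<inter> path_image (join_paths ?g es)"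
      have "successively (\<lambda>e e'. pathfinish (?g e) = pathstart (?g e')) es"
        by (rule successively_mono[OF ch(1)]) (use Cons.prems(3) in \<open>simp add: pathfinish_def pathstart_def\<close>)
      from path_image_join_paths[OF this] es
      have im: "path_image (join_paths ?g es) = (\<Union>e\<in>set es. path_image (?g e))" by simp
      obtain s where s: "s \<in> {0..1}" "z = ?g e s" using z by (auto simp: path_image_def)
      obtain e2 s2 where e2: "e2 \<in> set es" "s2 \<in> {0..1}" "z = ?g e2 s2"
        using z unfolding im by (auto simp: path_image_def)
      have e2A: "e2 \<in> arcs G" using e2(1) Cons.prems(2) by auto
      have eq: "to_torus D (curve D e s) = to_torus D (curve D e2 s2)"
        using s(2) e2(3) to_torus_lift by metis
      have "e \<noteq> e2" using Cons.prems(5) e2(1) by auto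
      with curves_meet[OF eA e2A s(1) e2(2) eq] have s01: "s \<in> {0, 1}" "s2 \<in> {0, 1}" by auto
      \<comment> \<open>A meeting at parameter 0 would make the initial vertex a head of the walk,
        either directly or as the tail of a later arc, which is the head of the arc before
        it.\<close>
      have "s \<noteq> 0"
      proof
        assume "s = 0"
        then have te: "to_torus D (place D (tail G e)) = to_torus D (curve D e2 s2)"
          using eq to_torus_ends(1)[OF eA] by simp
        have "tail G e = tail G e2 \<or> tail G e = head G e2"
        proof (cases "s2 = 0")
          case True
          have "tail G e = tail G e2"
            by (rule place_inj[OF _ ends_in_verts(1)[OF eA] ends_in_verts(1)[OF e2A]])
              (simp add: te True to_torus_ends[OF e2A])
          then show ?thesis ..
        next
          case False
          then have "s2 = 1" using s01(2) by simp
          then have "tail G e = head G e2"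
            by (intro place_inj[OF _ ends_in_verts(1)[OF eA] ends_in_verts(2)[OF e2A]])
              (simp add: te to_torus_ends[OF e2A])
          then show ?thesis ..
        qed
        moreover have "tail G e2 \<in> head G ` set (e # es)"
          by (rule tail_in_heads[OF Cons.prems(4) e2(1)])
        moreover have "head G e2 \<in> head G ` set (e # es)" using e2(1) by simp
        ultimately show False using Cons.prems(6) by auto
      qed
      then have "s = 1" using s01(1) by simp
      then show "z \<in> {pathstart (join_paths ?g es)}" using s(2) fs by (simp add: pathfinish_def)
    qed
    ultimately have "arc (?g e +++ join_paths ?g es)" using arc_e by (intro arc_join)
    then show ?thesis by (simp add: es)
  qed
qed simp

text \<open>Following chosen successors in the finite set \<open>A\<close> must repeat an arc. The
  cycle is extracted in the digraph restricted to \<open>A\<close>, so that it stays in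
  \<open>A\<close>, and is then read as a cycle of \<open>G\<close>.\<close>

lemma cycle_within:
  assumes A: "A \<subseteq> arcs G" "A \<noteq> {}" and nxt: "\<And>e. e \<in> A \<Longrightarrow> \<exists>e'\<in>A. tail G e' = head G e"
  obtains es where "pre_digraph.cycle G es" "es \<noteq> []" "set es \<subseteq> A" "distinct (map (head G) es)"
    "successively (\<lambda>e e'. head G e = tail G e') es" "head G (last es) = tail G (hd es)"
proof -
  let ?H = "G\<lparr>arcs := A\<rparr>"
  have wfH: "wf_digraph ?H" using A ends_in_verts by unfold_locales auto
  obtain e0 where "e0 \<in> A" using A(2) by auto
  define nx where "nx e = (SOME e'. e' \<in> A \<and> tail G e' = head G e)" for e
  have nx: "nx e \<in> A \<and> tail G (nx e) = head G e" if "e \<in> A" for e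
    unfolding nx_def by (rule someI_ex) (use nxt[OF that] in auto)
  define f where "f n = (nx ^^ n) e0" for n
  have fA: "f n \<in> A" for n by (induction n) (use \<open>e0 \<in> A\<close> nx in \<open>simp_all add: f_def\<close>)
  have fn: "tail G (f (Suc n)) = head G (f n)" for n using nx[OF fA[of n]] by (simp add: f_def)
  have "finite A" using A(1) finite_arcs_G finite_subset by auto
  then have "finite (range f)" using fA by (meson finite_subset image_subsetI)
  then have "\<not> inj f" using finite_imageD infinite_UNIV_nat by blast
  then obtain i j where "f i = f j" "i \<noteq> j" by (auto simp: inj_on_def)
  then obtain i j where ij: "f i = f j" "i < j" by (metis linorder_neqE_nat)
  have cas: "pre_digraph.cas ?H (tail G (f i)) (map f [i..<i + n]) (tail G (f (i + n)))" for n i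
  proof (induction n arbitrary: i)
    case (Suc n)
    have "[i..<i + Suc n] = i # [Suc i..<Suc i + n]" by (simp add: upt_rec)
    then show ?case using Suc[of "Suc i"] fn[of i] by (simp add: pre_digraph.cas.simps)
  qed (simp add: pre_digraph.cas.simps)
  have "pre_digraph.awalk ?H (tail G (f i)) (map f [i..<j]) (tail G (f i))"
    unfolding pre_digraph.awalk_def
  proof (intro conjI)
    show "tail G (f i) \<in> verts ?H" using fA[of i] A(1) ends_in_verts(1) by auto
    show "set (map f [i..<j]) \<subseteq> arcs ?H" using fA by auto
    show "pre_digraph.cas ?H (tail G (f i)) (map f [i..<j]) (tail G (f i))"
      using cas[of i "j - i"] ij by (simp add: ij(1))
  qed
  then have "wf_digraph.closed_w ?H (map f [i..<j])"
    unfolding wf_digraph.closed_w_def[OF wfH] using ij(2) by (intro exI[of _ "tail G (f i)"]) simp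
  from wf_digraph.closed_w_imp_cycle[OF wfH this]
  obtain es where es: "pre_digraph.cycle ?H es" by (rule exE)
  then obtain u where u: "pre_digraph.awalk ?H u es u" "distinct (tl (pre_digraph.awalk_verts ?H u es))" "es \<noteq> []"
    unfolding pre_digraph.cycle_def by (elim exE conjE)
  have cas': "pre_digraph.cas G u es u" "u \<in> verts G" "set es \<subseteq> A"
    using u(1) unfolding pre_digraph.awalk_def cas_arcs_update by simp_all
  have casH: "pre_digraph.cas ?H u es u" using u(1) unfolding pre_digraph.awalk_def by simp
  have d: "distinct (map (head G) es)" using u(2) unfolding awalk_verts_cas[OF casH] by simp
  have "pre_digraph.cycle G es"
    unfolding pre_digraph.cycle_def pre_digraph.awalk_def
    by (rule exI[of _ u]) (use cas' A(1) d u(3) in \<open>auto simp: awalk_verts_cas[OF cas'(1)]\<close>)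
  then show thesis
    using that[OF _ u(3) cas'(3) d] cas_chain[OF cas'(1)] u(3) by simp
qed

lemma lattice_discrete: "finite {k. norm (latt k) \<le> r}"
proof -
  define a where "a = \<lceil>\<bar>r\<bar> / p\<rceil>"
  define b where "b = \<lceil>(\<bar>r\<bar> + of_int a * \<bar>q\<bar>) / h\<rceil>"
  have "{k. norm (latt k) \<le> r} \<subseteq> {-a..a} \<times> {-b..b}"
  proof
    fix k assume "k \<in> {k. norm (latt k) \<le> r}"
    then have n: "norm (latt k) \<le> r" by simp
    have "\<bar>of_int (fst k) * p\<bar> \<le> r" "\<bar>of_int (fst k) * q + of_int (snd k) * h\<bar> \<le> r"
      using n norm_fst_le[of "of_int (fst k) * p" "of_int (fst k) * q + of_int (snd k) * h"]
        norm_snd_le[of "of_int (fst k) * q + of_int (snd k) * h" "of_int (fst k) * p"]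
      unfolding latt_eq real_norm_def by linarith+
    then have 1: "\<bar>of_int (fst k)\<bar> * p \<le> \<bar>r\<bar>" and 2: "\<bar>of_int (fst k) * q + of_int (snd k) * h\<bar> \<le> \<bar>r\<bar>"
      using p_pos by (simp_all add: abs_mult)
    have "\<bar>of_int (fst k)\<bar> \<le> \<bar>r\<bar> / p" using 1 p_pos by (simp add: field_simps)
    then have k1: "\<bar>fst k\<bar> \<le> a" unfolding a_def by linarith
    have "\<bar>of_int (snd k) * h\<bar> \<le> \<bar>r\<bar> + \<bar>of_int (fst k) * q\<bar>" using 2 by linarith
    also have "\<bar>of_int (fst k) * q\<bar> \<le> of_int a * \<bar>q\<bar>"
      unfolding abs_mult by (intro mult_right_mono) (use k1 in \<open>simp_all flip: of_int_abs\<close>)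
    finally have "\<bar>of_int (snd k)\<bar> * h \<le> \<bar>r\<bar> + of_int a * \<bar>q\<bar>"
      using h_pos by (simp add: abs_mult)
    then have "\<bar>of_int (snd k)\<bar> \<le> (\<bar>r\<bar> + of_int a * \<bar>q\<bar>) / h" using h_pos by (simp add: field_simps)
    then have "\<bar>snd k\<bar> \<le> b" unfolding b_def by linarith
    with k1 show "k \<in> {-a..a} \<times> {-b..b}" by (simp add: mem_Times_iff abs_le_iff)
  qed
  then show ?thesis by (rule finite_subset) simp
qed

text \<open>In a minimal set every arc occurs in one cell only, and lifts whose ends agree on the
  torus agree in the plane. So a directed cycle inside the set lifts to a closed curve and not just
  to a path between two translates, and the torus map is injective on that curve.\<close>

theorem no_finite_arc_closed:
  assumes nc: "no_contractible_directed_cycles D"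
    and T0: "arc_closed T0" "finite T0" "T0 \<noteq> {}"
  shows False
proof -
  obtain T where T: "arc_closed T" "finite T" "T \<noteq> {}"
    and min: "\<forall>x\<in>T. \<forall>y\<in>T. \<forall>z v. z \<in> arc_ends x \<longrightarrow> z + latt v \<in> arc_ends y \<longrightarrow> v = 0"
    by (rule minimal_arc_closed[OF T0])
  define A where "A = fst ` T"
  have AA: "A \<subseteq> arcs G" using T(1) by (simp add: A_def arc_closed_def)
  define k where "k e = (SOME j. (e, j) \<in> T)" for e
  have k: "(e, k e) \<in> T" if e: "e \<in> A" for e
  proof -
    obtain x where "x \<in> T" "e = fst x" using e unfolding A_def by (elim imageE)
    then have "\<exists>j. (e, j) \<in> T" by (intro exI[of _ "snd x"]) simp
    then show ?thesis unfolding k_def by (rule someI_ex)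
  qed
  let ?g = "\<lambda>e. lift D e (k e)"
  have g_ends: "?g e s \<in> arc_ends (e, k e)" if "s \<in> {0, 1}" for e s
    using that by (auto simp: arc_ends_def)
  have meet: "?g e s = ?g e' s'"
    if e: "e \<in> A" "e' \<in> A" and s: "s \<in> {0, 1}" "s' \<in> {0, 1}"
      and eq: "to_torus D (curve D e s) = to_torus D (curve D e' s')" for e e' s s'
  proof -
    have "to_torus D (?g e s) = to_torus D (?g e' s')" using eq by simp
    then obtain v where v: "?g e' s' = ?g e s + latt v" unfolding to_torus_eq_iff by (rule exE)
    have "v = 0"
      by (rule min[rule_format, OF k[OF e(1)] k[OF e(2)] g_ends[OF s(1)]])
        (use g_ends[OF s(2), of e'] in \<open>simp only: v\<close>)
    then show ?thesis using v by simp
  qed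
  \<comment> \<open>Some arc leaves the head of \<open>e\<close> because the out-degree is 2, and
    its lift at that point belongs to \<open>T\<close> by closure.\<close>
  have nxt: "\<exists>e'\<in>A. tail G e' = head G e" if e: "e \<in> A" for e
  proof -
    have eA: "e \<in> arcs G" using e AA by auto
    have "{e'\<in>arcs G. tail G e' = head G e} \<noteq> {}"
      using degree(1)[OF ends_in_verts(2)[OF eA]] by (metis card.empty zero_neq_numeral)
    then obtain e' where e': "e' \<in> arcs G" "tail G e' = head G e" by auto
    have "to_torus D (curve D e' 0) = to_torus D (?g e 1)"
      using to_torus_ends(1)[OF e'(1)] to_torus_ends(2)[OF eA] e'(2) by simp
    then obtain j where j: "?g e 1 = curve D e' 0 + latt j" unfolding to_torus_eq_iff by (rule exE)
    have "(e', j) \<in> T"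
      by (rule arc_closedD[OF T(1) k[OF e], of _ "?g e 1"])
        (use e'(1) j in \<open>simp_all add: arc_ends_def lift_eq[of e' j]\<close>)
    then have "e' \<in> A" unfolding A_def by force
    then show ?thesis using e'(2) by (rule_tac bexI)
  qed
  have "A \<noteq> {}" using T(3) by (simp add: A_def)
  obtain es where cyc: "pre_digraph.cycle G es" and es: "es \<noteq> []" "set es \<subseteq> A"
    and dist: "distinct (map (head G) es)"
    and chain: "successively (\<lambda>e e'. head G e = tail G e') es"
    and loop: "head G (last es) = tail G (hd es)"
    by (rule cycle_within[OF AA \<open>A \<noteq> {}\<close> nxt])
  have conn: "?g e 1 = ?g e' 0" if e: "e \<in> set es" "e' \<in> set es" and ht: "head G e = tail G e'" for e e'
  proof (rule meet)
    show "e \<in> A" "e' \<in> A" using e es(2) by auto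
    then have "e \<in> arcs G" "e' \<in> arcs G" using AA by auto
    then show "to_torus D (curve D e 1) = to_torus D (curve D e' 0)" using to_torus_ends ht by simp
  qed simp_all
  define c where "c = join_paths ?g es"
  have chain': "successively (\<lambda>e e'. pathfinish (?g e) = pathstart (?g e')) es"
    by (rule successively_mono[OF chain]) (use conn in \<open>simp add: pathfinish_def pathstart_def\<close>)
  have im: "path_image c = (\<Union>e\<in>set es. path_image (?g e))"
    unfolding c_def by (rule path_image_join_paths[OF chain' es(1)])
  have "?g (last es) 1 = ?g (hd es) 0" by (rule conn) (use es(1) loop in simp_all)
  then have closed: "pathfinish c = pathstart c"
    unfolding c_def pathstart_join_paths[OF es(1)] pathfinish_join_paths[OF es(1)]
    by (simp add: pathfinish_def pathstart_def)
  \<comment> \<open>A closed walk does not satisfy the hypotheses of \<open>arc_join_paths\<close>,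
    because its initial vertex is also a head. So its first arc is split off and the two arcs are
    joined to a loop; a cycle with a single arc is treated directly.\<close>
  have simple: "simple_path c"
  proof (cases es)
    case Nil
    then show ?thesis using es(1) by simp
  next
    case e: (Cons e es')
    have eA: "e \<in> arcs G" using es(2) AA by (auto simp: e)
    show ?thesis
    proof (cases "es' = []")
      case True
      have "simple_path (?g e)"
        unfolding simple_path_def loop_free_def
      proof (intro conjI ballI impI)
        show "path (?g e)" unfolding path_def by (rule continuous_lift[OF eA])
        fix x y assume xy: "x \<in> {0..1}" "y \<in> {0..1}" and "?g e x = ?g e y"
        then have "to_torus D (curve D e x) = to_torus D (curve D e y)" by (simp add: lift_eq)
        from curves_meet[OF eA eA xy this] show "x = y \<or> x = 0 \<and> y = 1 \<or> x = 1 \<and> y = 0" by auto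
      qed
      then show ?thesis using True by (simp add: c_def e)
    next
      case False
      have ch: "successively (\<lambda>e e'. head G e = tail G e') es'" "head G e = tail G (hd es')"
        using chain False unfolding e by (cases es'; simp)+
      have d: "distinct (map (head G) es')" "head G e \<notin> head G ` set es'" using dist by (simp_all add: e)
      have last: "last es = last es'" using False by (simp add: e)
      have arc1: "arc (join_paths ?g [e])"
      proof (rule arc_join_paths)
        have "head G (last es') \<noteq> head G e" using d(2) False by (metis imageI last_in_set)
        then show "tail G (hd [e]) \<notin> head G ` set [e]" using loop last by (simp add: e)
      qed (use eA conn in \<open>simp_all add: e\<close>)
      have arc2: "arc (join_paths ?g es')"
        by (rule arc_join_paths) (use False es(2) AA ch d conn in \<open>auto simp: e\<close>)
      have fin: "pathfinish (?g e) = pathstart (join_paths ?g es')"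
        unfolding pathstart_join_paths[OF False] using conn[of e "hd es'"] ch(2) False
        by (simp add: e pathfinish_def pathstart_def)
      have fin2: "pathfinish (join_paths ?g es') = pathstart (?g e)"
        unfolding pathfinish_join_paths[OF False] using conn[of "last es'" e] loop last False
        by (simp add: e pathfinish_def pathstart_def)
      have im': "path_image (join_paths ?g es') = (\<Union>e\<in>set es'. path_image (?g e))"
        by (rule path_image_join_paths[OF _ False]) (use chain' e False in \<open>simp add: successively_Cons\<close>)
      have "path_image (?g e) \<inter> path_image (join_paths ?g es') \<subseteq>
          {pathstart (?g e), pathstart (join_paths ?g es')}"
      proof
        fix z assume z: "z \<in> path_image (?g e) \<inter> path_image (join_paths ?g es')"
        obtain s where s: "s \<in> {0..1}" "z = ?g e s" using z by (auto simp: path_image_def)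
        obtain e2 s2 where e2: "e2 \<in> set es'" "s2 \<in> {0..1}" "z = ?g e2 s2"
          using z unfolding im' by (auto simp: path_image_def)
        have e2A: "e2 \<in> arcs G" using e2(1) es(2) AA by (auto simp: e)
        have eq: "to_torus D (curve D e s) = to_torus D (curve D e2 s2)"
          using s(2) e2(3) to_torus_lift by metis
        have "e \<noteq> e2" using d(2) e2(1) by auto
        with curves_meet[OF eA e2A s(1) e2(2) eq] have "s = 0 \<or> s = 1" by auto
        then show "z \<in> {pathstart (?g e), pathstart (join_paths ?g es')}"
          using s(2) fin by (auto simp: pathstart_def pathfinish_def)
      qed
      then have "simple_path (?g e +++ join_paths ?g es')"
        using arc1 by (intro simple_path_join_loop[OF _ arc2 fin fin2]) simp_all
      moreover have "c = ?g e +++ join_paths ?g es'" unfolding c_def e using False by (cases es') simp_all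
      ultimately show ?thesis by simp
    qed
  qed
  have inj: "inj_on (to_torus D) (path_image c)"
  proof (rule inj_onI)
    fix z z' assume z: "z \<in> path_image c" "z' \<in> path_image c" and zz: "to_torus D z = to_torus D z'"
    obtain e s where e: "e \<in> set es" "s \<in> {0..1}" "z = ?g e s"
      using z(1) unfolding im by (auto simp: path_image_def)
    obtain e' s' where e': "e' \<in> set es" "s' \<in> {0..1}" "z' = ?g e' s'"
      using z(2) unfolding im by (auto simp: path_image_def)
    have A: "e \<in> A" "e' \<in> A" using e(1) e'(1) es(2) by auto
    then have arcs: "e \<in> arcs G" "e' \<in> arcs G" using AA by auto
    have eq: "to_torus D (curve D e s) = to_torus D (curve D e' s')" using zz e(3) e'(3) by simp
    from curves_meet[OF arcs e(2) e'(2) eq] show "z = z'"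
    proof
      assume "s \<in> {0, 1} \<and> s' \<in> {0, 1}"
      then show "z = z'" unfolding e(3) e'(3) by (intro meet[OF A _ _ eq]) simp_all
    qed (simp add: e(3) e'(3))
  qed
  \<comment> \<open>The Jordan curve facts concern the complex plane; \<phi> and \<psi> translate
    between it and the plane of the ground.\<close>
  define \<phi> where "\<phi> z = Complex (fst z) (snd z)" for z :: "real \<times> real"
  define \<psi> where "\<psi> w = (Re w, Im w)" for w
  have \<psi>\<phi>: "\<psi> (\<phi> z) = z" and \<phi>\<psi>: "\<phi> (\<psi> w) = w" for z w by (simp_all add: \<phi>_def \<psi>_def)
  have \<phi>_lin: "linear \<phi>" by (intro linearI) (simp_all add: \<phi>_def complex_eq_iff)
  have \<phi>_inj: "inj \<phi>" by (rule inj_on_inverseI[of _ \<psi>]) (simp add: \<psi>\<phi>)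
  define f where "f w = to_torus D (\<psi> w)" for w
  define L where "L = \<phi> ` range latt"
  have sur: "range \<psi> = UNIV" using \<psi>\<phi> by (metis surjI)
  have rf: "range f = range (to_torus D)"
    using sur unfolding f_def by (metis fun.set_map image_image)
  have torus: "range (to_torus D) = torus"
  proof (intro equalityI subsetI)
    fix x assume "x \<in> range (to_torus D)"
    then show "x \<in> torus" by (auto simp: torus_def to_torus_def Let_def)
  next
    fix x assume "x \<in> torus"
    then have n: "cmod (fst x) = 1" "cmod (snd x) = 1" by (auto simp: torus_def)
    define r where "r = Arg (fst x) / (2 * pi)"
    define s where "s = Arg (snd x) / (2 * pi)"
    have "fst x \<noteq> 0" "snd x \<noteq> 0" using n by auto
    then have c: "cis (2 * pi * r) = fst x" "cis (2 * pi * s) = snd x"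
      using n by (simp_all add: r_def s_def cis_Arg sgn_div_norm)
    have a: "fst (r * p, s * h + r * q) / p = r" and b: "(snd (r * p, s * h + r * q) - r * q) / h = s"
      using p_pos h_pos by simp_all
    have "to_torus D (r * p, s * h + r * q) = x"
      unfolding to_torus_def Let_def a b c by simp
    then show "x \<in> range (to_torus D)" by (metis rangeI)
  qed
  have cont: "continuous_on UNIV f"
    unfolding f_def \<psi>_def to_torus_def Let_def
    using p_pos h_pos by (intro continuous_intros) auto
  have feq: "f z = f w \<longleftrightarrow> w - z \<in> L" for z w
  proof -
    have "f z = f w \<longleftrightarrow> (\<exists>k. \<psi> w = \<psi> z + latt k)" unfolding f_def to_torus_eq_iff ..
    also have "\<dots> \<longleftrightarrow> (\<exists>k. w - z = \<phi> (latt k))"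
      by (intro ex_cong1) (auto simp: \<psi>_def \<phi>_def complex_eq_iff prod_eq_iff)
    finally show ?thesis unfolding L_def by (auto simp: image_iff)
  qed
  \<comment> \<open>This is a closed period parallelogram: compact, and meeting every orbit of the
    lattice.\<close>
  define par where "par = (\<lambda>(x, y). \<phi> (x * p, x * q + y * h)) ` ({0..1} \<times> {0..1})"
  have "compact par"
    unfolding par_def \<phi>_def case_prod_beta Complex_eq
    by (intro compact_continuous_image continuous_intros compact_Times) auto
  moreover have "f ` par = range f"
  proof (intro equalityI subsetI)
    fix x assume "x \<in> range f"
    then obtain w where w: "x = f w" by auto
    define r where "r = Re w / p"
    define s where "s = (Im w - r * q) / h"
    have "f w = f (\<phi> (frac r * p, frac r * q + frac s * h))"
    proof -
      have "\<psi> w = (frac r * p, frac r * q + frac s * h) + latt (\<lfloor>r\<rfloor>, \<lfloor>s\<rfloor>)"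
        using p_pos h_pos by (simp add: \<psi>_def latt_eq frac_def r_def s_def field_simps)
      then have "to_torus D (frac r * p, frac r * q + frac s * h) = to_torus D (\<psi> w)"
        unfolding to_torus_eq_iff by (rule exI)
      then show ?thesis by (simp add: f_def \<psi>\<phi>)
    qed
    moreover have "\<phi> (frac r * p, frac r * q + frac s * h) \<in> par"
      unfolding par_def by (rule rev_image_eqI[of "(frac r, frac s)"]) (simp_all add: less_imp_le[OF frac_lt_1])
    ultimately show "x \<in> f ` par" unfolding w by (rule image_eqI)
  qed auto
  moreover have "finite (L \<inter> cball 0 r)" for r
  proof -
    have nrm: "norm (\<phi> z) = norm z" for z by (simp add: \<phi>_def norm_prod_def complex_norm)
    have "L \<inter> cball 0 r \<subseteq> (\<lambda>k. \<phi> (latt k)) ` {k. norm (latt k) \<le> r}"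
      unfolding L_def by (auto simp: nrm)
    then show ?thesis by (rule finite_subset) (intro finite_imageI lattice_discrete)
  qed
  moreover have "simple_path (\<phi> \<circ> c)" using simple simple_path_linear_image_eq[OF \<phi>_lin \<phi>_inj] by simp
  moreover have "pathfinish (\<phi> \<circ> c) = pathstart (\<phi> \<circ> c)"
    using closed by (simp add: pathfinish_def pathstart_def)
  moreover have pi: "path_image (\<phi> \<circ> c) = \<phi> ` path_image c" by (rule path_image_compose)
  have "inj_on f (path_image (\<phi> \<circ> c))"
    unfolding pi
  proof (rule inj_onI)
    fix x y assume "x \<in> \<phi> ` path_image c" "y \<in> \<phi> ` path_image c" and xy: "f x = f y"
    then obtain z z' where z: "z \<in> path_image c" "x = \<phi> z" "z' \<in> path_image c" "y = \<phi> z'"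
      by (elim imageE)
    have "to_torus D z = to_torus D z'" using xy by (simp add: z f_def \<psi>\<phi>)
    from inj_onD[OF inj this z(1,3)] show "x = y" by (simp add: z)
  qed
  ultimately have "\<exists>U\<in>components (range f - f ` path_image (\<phi> \<circ> c)).
      U \<noteq> range f - f ` path_image (\<phi> \<circ> c) \<and> U homeomorphic (ball 0 1 :: complex set)"
    by (intro simple_loop_bounds_disc_in_quotient[OF cont feq])
  moreover have "f ` path_image (\<phi> \<circ> c) = cycle_trace D es"
  proof -
    have "f ` path_image (\<phi> \<circ> c) = to_torus D ` path_image c"
      unfolding pi by (simp add: image_image f_def \<psi>\<phi>)
    also have "\<dots> = (\<Union>e\<in>set es. to_torus D ` path_image (?g e))" unfolding im by (rule image_UN)
    also have "\<dots> = cycle_trace D es"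
      unfolding cycle_trace_def path_image_def by (simp add: image_image)
    finally show ?thesis .
  qed
  ultimately have "contractible_curve (cycle_trace D es)"
    unfolding contractible_curve_def rf torus by simp
  then show False using nc cyc unfolding no_contractible_directed_cycles_def by simp
qed

end

section \<open>Net crossings of a meridian\<close>

context toroidal_ground
begin

lemma meridian_iff: "to_torus D z \<in> meridian D x \<longleftrightarrow> (\<exists>j::int. fst z = x + of_int j * p)"
proof
  assume "to_torus D z \<in> meridian D x"
  then obtain y where "to_torus D (x, y) = to_torus D z" by (auto simp: meridian_def)
  then obtain k where k: "z = (x, y) + latt k" unfolding to_torus_eq_iff by (rule exE)
  show "\<exists>j::int. fst z = x + of_int j * p" by (rule exI[of _ "fst k"]) (simp add: k latt_eq)
next
  assume "\<exists>j::int. fst z = x + of_int j * p"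
  then obtain j :: int where j: "fst z = x + of_int j * p" by (rule exE)
  have "z = (x, snd z - of_int j * q) + latt (j, 0)" using j by (simp add: latt_eq prod_eq_iff)
  then have "to_torus D (x, snd z - of_int j * q) = to_torus D z" unfolding to_torus_eq_iff by (rule exI)
  then show "to_torus D z \<in> meridian D x" unfolding meridian_def by (metis SigmaI UNIV_I imageI singletonI)
qed

lemma general_position_level:
  assumes gp: "general_position D x" and e: "e \<in> arcs G"
  shows "finite {t\<in>{0..1}. to_torus D (curve D e t) \<in> meridian D x}"
    and "finite {t\<in>{0..1}. fst (curve D e t) = x + of_int j * p}"
    and "to_torus D (curve D e 0) \<notin> meridian D x" "to_torus D (curve D e 1) \<notin> meridian D x"
proof -
  show 1: "finite {t\<in>{0..1}. to_torus D (curve D e t) \<in> meridian D x}"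
    using gp e by (simp add: general_position_def)
  show "finite {t\<in>{0..1}. fst (curve D e t) = x + of_int j * p}"
    by (rule finite_subset[OF _ 1]) (auto simp: meridian_iff)
  show "to_torus D (curve D e 0) \<notin> meridian D x" "to_torus D (curve D e 1) \<notin> meridian D x"
    using gp ends_in_verts[OF e] to_torus_ends[OF e] by (simp_all add: general_position_def)
qed

lemma continuous_fst_curve: "e \<in> arcs G \<Longrightarrow> continuous_on {0..1} (\<lambda>t. fst (curve D e t))"
  using emb by (intro continuous_intros) (simp add: toroidal_embedding_def path_def)

section \<open>One-sided counts at a meridian\<close>

definition hits :: "real \<Rightarrow> ('b \<times> real) set" where
  "hits x = {(e, t). e \<in> arcs G \<and> t \<in> {0<..<1} \<and> to_torus D (curve D e t) \<in> meridian D x}"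

text \<open>Here \<open>right\<close> concerns the parameter and \<open>above\<close> the first
  coordinate: the arc is to the right of the meridian just after \<open>t\<close>, and in
  \<open>left_above\<close> just before \<open>t\<close>. Touchings from the right belong to both
  sets, touchings from the left to neither.\<close>

definition right_above :: "real \<Rightarrow> ('b \<times> real) set" where
  "right_above x = {(e, t) \<in> hits x. \<forall>\<^sub>F s in at_right t. fst (curve D e s) > fst (curve D e t)}"

definition left_above :: "real \<Rightarrow> ('b \<times> real) set" where
  "left_above x = {(e, t) \<in> hits x. \<forall>\<^sub>F s in at_left t. fst (curve D e s) > fst (curve D e t)}"

lemma finite_hits:
  assumes gp: "general_position D x"
  shows "finite (hits x)"
proof -
  have "hits x \<subseteq> Sigma (arcs G) (\<lambda>e. {t\<in>{0..1}. to_torus D (curve D e t) \<in> meridian D x})"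
    by (auto simp: hits_def)
  then show ?thesis
    by (rule finite_subset) (intro finite_SigmaI finite_arcs_G general_position_level(1)[OF gp])
qed

lemma hits_sides:
  assumes gp: "general_position D x" and et: "(e, t) \<in> hits x"
  shows "(\<forall>\<^sub>F s in at_right t. fst (curve D e s) < fst (curve D e t)) \<longleftrightarrow> (e, t) \<notin> right_above x"
    and "(\<forall>\<^sub>F s in at_left t. fst (curve D e s) < fst (curve D e t)) \<longleftrightarrow> (e, t) \<notin> left_above x"
proof -
  have e: "e \<in> arcs G" and t: "t \<in> {0<..<1}" and m: "to_torus D (curve D e t) \<in> meridian D x"
    using et by (simp_all add: hits_def)
  obtain j :: int where j: "fst (curve D e t) = x + of_int j * p" using m unfolding meridian_iff by (rule exE)
  have fin: "finite {s\<in>{0..1}. fst (curve D e s) = fst (curve D e t)}"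
    unfolding j by (rule general_position_level(2)[OF gp e])
  note s = eventually_sides[OF continuous_fst_curve[OF e] fin t]
  show "(\<forall>\<^sub>F s in at_right t. fst (curve D e s) < fst (curve D e t)) \<longleftrightarrow> (e, t) \<notin> right_above x"
    using s(1) et by (simp add: right_above_def)
  show "(\<forall>\<^sub>F s in at_left t. fst (curve D e s) < fst (curve D e t)) \<longleftrightarrow> (e, t) \<notin> left_above x"
    using s(2) et by (simp add: left_above_def)
qed

lemma rightward_eq:
  assumes gp: "general_position D x"
  shows "rightward_crossings D x = right_above x - left_above x"
proof (rule set_eqI, clarify)
  fix e t
  have "(e, t) \<in> rightward_crossings D x \<longleftrightarrow> (e, t) \<in> hits x \<and>
      (\<forall>\<^sub>F s in at_left t. fst (curve D e s) < fst (curve D e t)) \<and>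
      (\<forall>\<^sub>F s in at_right t. fst (curve D e s) > fst (curve D e t))"
    by (simp add: rightward_crossings_def hits_def)
  also have "\<dots> \<longleftrightarrow> (e, t) \<in> right_above x - left_above x"
    using hits_sides(2)[OF gp, of e t] by (auto simp: right_above_def)
  finally show "(e, t) \<in> rightward_crossings D x \<longleftrightarrow> (e, t) \<in> right_above x - left_above x" .
qed

lemma leftward_eq:
  assumes gp: "general_position D x"
  shows "leftward_crossings D x = left_above x - right_above x"
proof (rule set_eqI, clarify)
  fix e t
  have "(e, t) \<in> leftward_crossings D x \<longleftrightarrow> (e, t) \<in> hits x \<and>
      (\<forall>\<^sub>F s in at_left t. fst (curve D e s) > fst (curve D e t)) \<and>
      (\<forall>\<^sub>F s in at_right t. fst (curve D e s) < fst (curve D e t))"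
    by (simp add: leftward_crossings_def hits_def)
  also have "\<dots> \<longleftrightarrow> (e, t) \<in> left_above x - right_above x"
    using hits_sides(1)[OF gp, of e t] by (auto simp: left_above_def)
  finally show "(e, t) \<in> leftward_crossings D x \<longleftrightarrow> (e, t) \<in> left_above x - right_above x" .
qed

lemma finite_above:
  assumes gp: "general_position D x"
  shows "finite (right_above x)" "finite (left_above x)"
  by (rule finite_subset[OF _ finite_hits[OF gp]], auto simp: right_above_def left_above_def)+

text \<open>The one-sided sets are what a strip to the right of the meridian sees, namely the
  strands that start and that stop on its left side. This makes net crossings computable inside a
  strip, touchings included.\<close>

lemma crossings_difference:
  assumes gp: "general_position D x"
  shows "int (card (rightward_crossings D x)) - int (card (leftward_crossings D x))
    = int (card (right_above x)) - int (card (left_above x))"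
  unfolding rightward_eq[OF gp] leftward_eq[OF gp] by (rule card_Diff_diff[OF finite_above[OF gp]])

lemma sum_over_heads_eq_tails:
  fixes g :: "'a \<Rightarrow> nat"
  shows "(\<Sum>e\<in>arcs G. g (head G e)) = (\<Sum>e\<in>arcs G. g (tail G e))"
proof -
  have *: "(\<Sum>e\<in>arcs G. g (w e)) = (\<Sum>v\<in>verts G. 2 * g v)"
    if w: "\<And>e. e \<in> arcs G \<Longrightarrow> w e \<in> verts G"
      and c: "\<And>v. v \<in> verts G \<Longrightarrow> card {e\<in>arcs G. w e = v} = 2" for w
  proof -
    have "(\<Sum>e\<in>arcs G. g (w e)) = (\<Sum>v\<in>verts G. \<Sum>e\<in>{e\<in>arcs G. w e = v}. g (w e))"
      by (rule sum.group[symmetric, OF finite_arcs_G finite_verts_G]) (use w in auto)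
    also have "\<dots> = (\<Sum>v\<in>verts G. 2 * g v)"
    proof (rule sum.cong[OF refl])
      fix v assume v: "v \<in> verts G"
      have "(\<Sum>e\<in>{e\<in>arcs G. w e = v}. g (w e)) = (\<Sum>e\<in>{e\<in>arcs G. w e = v}. g v)"
        by (rule sum.cong) auto
      then show "(\<Sum>e\<in>{e\<in>arcs G. w e = v}. g (w e)) = 2 * g v" by (simp add: c[OF v])
    qed
    finally show ?thesis .
  qed
  have "(\<Sum>e\<in>arcs G. g (head G e)) = (\<Sum>v\<in>verts G. 2 * g v)"
    by (rule *) (simp_all add: ends_in_verts degree)
  moreover have "(\<Sum>e\<in>arcs G. g (tail G e)) = (\<Sum>v\<in>verts G. 2 * g v)"
    by (rule *) (simp_all add: ends_in_verts degree)
  ultimately show ?thesis by simp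
qed

end

section \<open>Strands of a vertical strip\<close>

context toroidal_ground
begin

text \<open>Only up to a bounded error is this the height of the points of the strand.\<close>

definition hgt :: "'b strand \<Rightarrow> real" where "hgt P = of_int (snd (cell P)) * h"

text \<open>Only the vertical cell coordinate is replaced, because horizontal shifts do not preserve
  the strip.\<close>

definition rebase :: "int \<Rightarrow> 'b strand \<Rightarrow> 'b strand" where
  "rebase j P = P\<lparr>cell := (fst (cell P), j)\<rparr>"

lemma rebase_simps [simp]:
  "on_arc (rebase j P) = on_arc P" "cell (rebase j P) = (fst (cell P), j)"
  "start (rebase j P) = start P" "stop (rebase j P) = stop P"
  by (simp_all add: rebase_def)

lemma rebase_rebase [simp]: "rebase i (rebase j P) = rebase i P"
  by (simp add: rebase_def)

lemma rebase_id: "snd (cell P) = j \<Longrightarrow> rebase j P = P"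
  by (cases P) (auto simp: rebase_def)

lemma point_eq: "point D P t = curve D (on_arc P) t + latt (cell P)"
  by (simp add: point_def lift_eq)

lemma point_rebase: "point D P t = point D (rebase 0 P) t + (0, hgt P)"
  by (simp add: point_eq latt_eq hgt_def)

lemma fst_point_rebase [simp]: "fst (point D (rebase j P) t) = fst (point D P t)"
  by (simp add: point_eq latt_eq)

lemma rebase_in_strands [simp]: "rebase j P \<in> strands D a b \<longleftrightarrow> P \<in> strands D a b"
  by (simp add: strands_def)

lemma strands_iff:
  "P \<in> strands D a b \<longleftrightarrow> on_arc P \<in> arcs G \<and> (start P, stop P) \<in> ivals (\<lambda>t. fst (point D P t)) a b"
  by (auto simp: strands_def ivals_def)

lemma strand_eqI:
  assumes "P \<in> strands D a b" "Q \<in> strands D a b" "on_arc P = on_arc Q" "cell P = cell Q"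
    and "start P = start Q \<or> stop P = stop Q"
  shows "P = Q"
proof -
  have pt: "point D P = point D Q" using assms(3,4) by (simp add: point_def)
  have iv: "(start P, stop P) \<in> ivals (\<lambda>t. fst (point D Q t)) a b"
    "(start Q, stop Q) \<in> ivals (\<lambda>t. fst (point D Q t)) a b"
    using assms(1,2) unfolding strands_iff pt by simp_all
  from ivals_unique[OF iv assms(5)] show ?thesis using assms(3,4) by simp
qed

section \<open>Classes of strands under the vertical period\<close>

definition base_strands :: "real \<Rightarrow> real \<Rightarrow> 'b strand set" where
  "base_strands a b = {P\<in>strands D a b. snd (cell P) = 0}"

lemma rebase_in_base: "P \<in> strands D a b \<Longrightarrow> rebase 0 P \<in> base_strands a b"
  by (simp add: base_strands_def)

lemma continuous_point: "on_arc P \<in> arcs G \<Longrightarrow> continuous_on {0..1} (point D P)"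
  unfolding point_def by (rule continuous_lift)

lemma continuous_fst_point: "on_arc P \<in> arcs G \<Longrightarrow> continuous_on {0..1} (\<lambda>t. fst (point D P t))"
  by (intro continuous_intros continuous_point)

lemma fst_point_level:
  assumes "fst (point D P t) = x"
  shows "to_torus D (curve D (on_arc P) t) \<in> meridian D x"
  unfolding meridian_iff
  by (rule exI[of _ "- fst (cell P)"]) (use assms in \<open>simp add: point_eq latt_eq\<close>)

lemma finite_levels:
  assumes "general_position D a" "general_position D b" "on_arc P \<in> arcs G"
  shows "finite {t\<in>{0..1}. fst (point D P t) \<in> {a, b}}"
proof -
  have "{t\<in>{0..1}. fst (point D P t) \<in> {a, b}} \<subseteq>
      {t\<in>{0..1}. to_torus D (curve D (on_arc P) t) \<in> meridian D a} \<union>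
      {t\<in>{0..1}. to_torus D (curve D (on_arc P) t) \<in> meridian D b}"
    using fst_point_level by auto
  then show ?thesis
    by (rule finite_subset) (intro finite_UnI general_position_level(1)[OF assms(1,3)]
        general_position_level(1)[OF assms(2,3)])
qed

text \<open>A strand has a point inside the strip and the chosen curves are bounded, so finitely
  many horizontal cells occur. Its ends are 0, 1 or among the finitely many parameters at which a
  side is met.\<close>

lemma finite_base_strands:
  assumes gp: "general_position D a" "general_position D b"
  shows "finite (base_strands a b)"
proof -
  have "bounded (\<Union>e\<in>arcs G. (\<lambda>t. fst (curve D e t)) ` {0..1})"
    by (intro bounded_UN finite_arcs_G ballI compact_imp_bounded compact_continuous_image
        continuous_fst_curve) simp_all
  then obtain B where B0: "\<forall>y\<in>(\<Union>e\<in>arcs G. (\<lambda>t. fst (curve D e t)) ` {0..1}). \<bar>y\<bar> \<le> B"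
    unfolding bounded_real by (rule exE)
  have B: "\<bar>fst (curve D e t)\<bar> \<le> B" if "e \<in> arcs G" "t \<in> {0..1}" for e t
    using B0 that by simp
  define N where "N = \<lceil>(B + \<bar>a\<bar> + \<bar>b\<bar>) / p\<rceil>"
  define mk :: "'b \<times> int \<times> real \<times> real \<Rightarrow> 'b strand" where "mk = (\<lambda>(e, k, s, t). \<lparr>on_arc = e, cell = (k, 0::int), start = s, stop = t\<rparr>)"
  define H where "H e k = {0, 1} \<union> {t\<in>{0..1}. fst (point D (mk (e, k, 0, 0)) t) \<in> {a, b}}" for e k
  have "base_strands a b \<subseteq> mk ` (Sigma (arcs G) (\<lambda>e. Sigma {-N..N} (\<lambda>k. H e k \<times> H e k)))"
  proof
    fix P assume P: "P \<in> base_strands a b"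
    let ?e = "on_arc P" and ?k = "fst (cell P)"
    have Pmk: "P = mk (?e, ?k, start P, stop P)"
      using P by (simp add: mk_def base_strands_def prod_eq_iff)
    have e: "?e \<in> arcs G" and iv: "(start P, stop P) \<in> ivals (\<lambda>t. fst (point D P t)) a b"
      using P by (simp_all add: base_strands_def strands_iff)
    have st: "0 \<le> start P" "start P < stop P" "stop P \<le> 1" using iv by (simp_all add: ivals_def)
    have pt: "point D (mk (?e, ?k, 0, 0)) t = point D P t" for t
      using P by (simp add: point_eq mk_def base_strands_def latt_eq)
    have H: "start P \<in> H ?e ?k" "stop P \<in> H ?e ?k" using iv st by (auto simp: H_def pt ivals_def)
    define u where "u = (start P + stop P) / 2"
    have u: "u \<in> {start P<..<stop P}" "u \<in> {0..1}" using st by (simp_all add: u_def)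
    have "a < fst (point D P u)" "fst (point D P u) < b" using iv u(1) by (simp_all add: ivals_def)
    then have "\<bar>of_int ?k * p\<bar> \<le> B + \<bar>a\<bar> + \<bar>b\<bar>"
      using B[OF e u(2)] unfolding point_eq latt_eq fst_add fst_conv by linarith
    then have "\<bar>of_int ?k\<bar> \<le> (B + \<bar>a\<bar> + \<bar>b\<bar>) / p" using p_pos by (simp add: abs_mult field_simps)
    then have "\<bar>?k\<bar> \<le> N" unfolding N_def by linarith
    then show "P \<in> mk ` (Sigma (arcs G) (\<lambda>e. Sigma {-N..N} (\<lambda>k. H e k \<times> H e k)))"
      using e H by (subst Pmk, intro imageI) auto
  qed
  moreover have "finite (H e k)" if "e \<in> arcs G" for e k
    unfolding H_def using finite_levels[OF gp, of "mk (e, k, 0, 0)"] that by (simp add: mk_def)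
  then have "finite (mk ` (Sigma (arcs G) (\<lambda>e. Sigma {-N..N} (\<lambda>k. H e k \<times> H e k))))"
    by (intro finite_imageI finite_SigmaI finite_arcs_G) simp_all
  ultimately show ?thesis by (rule finite_subset)
qed

text \<open>A vertical translation changes the heights on a strand and its \<open>hgt\<close> by the
  same amount, so a bound for the finitely many representatives serves all strands.\<close>

lemma base_heights_bounded:
  assumes gp: "general_position D a" "general_position D b"
  obtains M where "0 \<le> M"
    "\<And>P t. \<lbrakk>P \<in> strands D a b; t \<in> {0..1}\<rbrakk> \<Longrightarrow> \<bar>snd (point D P t) - hgt P\<bar> \<le> M"
proof -
  have "bounded (\<Union>P\<in>base_strands a b. point D P ` {0..1})"
    by (intro bounded_UN finite_base_strands[OF gp] ballI compact_imp_bounded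
        compact_continuous_image continuous_point) (simp_all add: base_strands_def strands_iff)
  then obtain B where B: "\<forall>y\<in>(\<Union>P\<in>base_strands a b. point D P ` {0..1}). norm y \<le> B"
    unfolding bounded_iff by (rule exE)
  show thesis
  proof (rule that[of "max 0 B"])
    fix P t assume P: "P \<in> strands D a b" and t: "t \<in> {0..1::real}"
    have "norm (point D (rebase 0 P) t) \<le> B"
      using B UN_I[OF rebase_in_base[OF P] imageI[OF t]] by (rule bspec)
    moreover have "\<bar>snd (point D (rebase 0 P) t)\<bar> \<le> norm (point D (rebase 0 P) t)"
      using norm_snd_le[of "snd (point D (rebase 0 P) t)" "fst (point D (rebase 0 P) t)"]
      unfolding prod.collapse real_norm_def .
    ultimately show "\<bar>snd (point D P t) - hgt P\<bar> \<le> max 0 B"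
      unfolding point_rebase[of P t] by simp
  qed simp
qed

lemma card_translates:
  assumes A: "A \<subseteq> {P. snd (cell P) = 0}" "finite A"
  shows "finite {P. rebase 0 P \<in> A \<and> x \<le> hgt P \<and> hgt P \<le> y}"
    and "card {P. rebase 0 P \<in> A \<and> x \<le> hgt P \<and> hgt P \<le> y} =
      card A * card {j::int. x \<le> of_int j * h \<and> of_int j * h \<le> y}"
proof -
  let ?J = "{j::int. x \<le> of_int j * h \<and> of_int j * h \<le> y}"
  have bij: "bij_betw (\<lambda>(P, j). rebase j P) (A \<times> ?J) {P. rebase 0 P \<in> A \<and> x \<le> hgt P \<and> hgt P \<le> y}"
  proof (rule bij_betw_byWitness[where f' = "\<lambda>P. (rebase 0 P, snd (cell P))"])
    show "\<forall>a\<in>A \<times> ?J. (\<lambda>P. (rebase 0 P, snd (cell P))) ((\<lambda>(P, j). rebase j P) a) = a"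
      using A(1) by (auto simp: rebase_id)
    show "\<forall>P\<in>{P. rebase 0 P \<in> A \<and> x \<le> hgt P \<and> hgt P \<le> y}.
        (\<lambda>(P, j). rebase j P) (rebase 0 P, snd (cell P)) = P"
      by (auto simp: rebase_id)
    show "(\<lambda>(P, j). rebase j P) ` (A \<times> ?J) \<subseteq> {P. rebase 0 P \<in> A \<and> x \<le> hgt P \<and> hgt P \<le> y}"
    proof
      fix P assume "P \<in> (\<lambda>(P, j). rebase j P) ` (A \<times> ?J)"
      then obtain Q j where "Q \<in> A" "j \<in> ?J" "P = rebase j Q" by auto
      moreover have "rebase 0 Q = Q" using A(1) \<open>Q \<in> A\<close> by (intro rebase_id) auto
      ultimately show "P \<in> {P. rebase 0 P \<in> A \<and> x \<le> hgt P \<and> hgt P \<le> y}" by (simp add: hgt_def)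
    qed
    show "(\<lambda>P. (rebase 0 P, snd (cell P))) ` {P. rebase 0 P \<in> A \<and> x \<le> hgt P \<and> hgt P \<le> y} \<subseteq> A \<times> ?J"
      by (auto simp: hgt_def)
  qed
  have "finite (A \<times> ?J)" using A(2) card_multiples_in(1)[OF h_pos] by simp
  then show "finite {P. rebase 0 P \<in> A \<and> x \<le> hgt P \<and> hgt P \<le> y}"
    using bij_betw_finite[OF bij] by simp
  show "card {P. rebase 0 P \<in> A \<and> x \<le> hgt P \<and> hgt P \<le> y} = card A * card ?J"
    using bij_betw_same_card[OF bij] by (simp add: card_cartesian_product)
qed

section \<open>Strands that begin or end on a side\<close>

definition starts_on :: "real \<Rightarrow> real \<Rightarrow> real \<Rightarrow> 'b strand set" where
  "starts_on a b x = {P\<in>base_strands a b. fst (point D P (start P)) = x}"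

definition stops_on :: "real \<Rightarrow> real \<Rightarrow> real \<Rightarrow> 'b strand set" where
  "stops_on a b x = {P\<in>base_strands a b. fst (point D P (stop P)) = x}"

lemma strandD:
  assumes "P \<in> strands D a b"
  shows "on_arc P \<in> arcs G" "0 \<le> start P" "start P < stop P" "stop P \<le> 1"
    "start P \<in> {0..1}" "stop P \<in> {0..1}"
    "start P = 0 \<or> fst (point D P (start P)) \<in> {a, b}" "stop P = 1 \<or> fst (point D P (stop P)) \<in> {a, b}"
  using assms by (auto simp: strands_def)

lemma point_end_not_on_meridian:
  assumes "general_position D x" "on_arc P \<in> arcs G"
  shows "fst (point D P 0) \<noteq> x" "fst (point D P 1) \<noteq> x"
  using general_position_level(3,4)[OF assms] fst_point_level[of P _ x] by auto

lemma ex_strand_start_at: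
  assumes gp: "general_position D a" "general_position D b" and e: "e \<in> arcs G"
    and t: "0 \<le> t" "t < 1" "t = 0 \<or> fst (lift D e k t) \<in> {a, b}"
    and ev: "\<forall>\<^sub>F s in at_right t. a < fst (lift D e k s) \<and> fst (lift D e k s) < b"
  shows "\<exists>P\<in>strands D a b. on_arc P = e \<and> cell P = k \<and> start P = t"
proof -
  define P where "P u = \<lparr>on_arc = e, cell = k, start = t, stop = u\<rparr>" for u
  have pt: "point D (P u) = lift D e k" for u by (simp add: point_def P_def)
  have e0: "on_arc (P 0) \<in> arcs G" using e by (simp add: P_def)
  obtain u where "(t, u) \<in> ivals (\<lambda>s. fst (lift D e k s)) a b"
    using ivals_start[OF continuous_fst_point[OF e0] finite_levels[OF gp e0], unfolded pt, OF t ev] by (rule exE)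
  then have "P u \<in> strands D a b" unfolding strands_iff pt using e by (simp add: P_def)
  then show ?thesis by (rule rev_bexI) (simp add: P_def)
qed

lemma ex_strand_stop_at:
  assumes gp: "general_position D a" "general_position D b" and e: "e \<in> arcs G"
    and t: "0 < t" "t \<le> 1" "t = 1 \<or> fst (lift D e k t) \<in> {a, b}"
    and ev: "\<forall>\<^sub>F s in at_left t. a < fst (lift D e k s) \<and> fst (lift D e k s) < b"
  shows "\<exists>P\<in>strands D a b. on_arc P = e \<and> cell P = k \<and> stop P = t"
proof -
  define P where "P u = \<lparr>on_arc = e, cell = k, start = u, stop = t\<rparr>" for u
  have pt: "point D (P u) = lift D e k" for u by (simp add: point_def P_def)
  have e0: "on_arc (P 0) \<in> arcs G" using e by (simp add: P_def)
  obtain u where "(u, t) \<in> ivals (\<lambda>s. fst (lift D e k s)) a b"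
    using ivals_stop[OF continuous_fst_point[OF e0] finite_levels[OF gp e0], unfolded pt, OF t ev] by (rule exE)
  then have "P u \<in> strands D a b" unfolding strands_iff pt using e by (simp add: P_def)
  then show ?thesis by (rule rev_bexI) (simp add: P_def)
qed

lemma continuous_fst_lift: "e \<in> arcs G \<Longrightarrow> continuous_on {0..1} (\<lambda>t. fst (lift D e k t))"
  by (intro continuous_intros continuous_lift)

lemma ex_strand_starting:
  assumes gp: "general_position D a" "general_position D b" and e: "e \<in> arcs G"
    and z: "fst (lift D e k 0) \<in> {a<..<b}"
  shows "\<exists>P\<in>strands D a b. on_arc P = e \<and> cell P = k \<and> start P = 0"
  by (rule ex_strand_start_at[OF gp e])
    (use eventually_right_continuous[OF continuous_fst_lift[OF e] _ _ open_greaterThanLessThan z] in simp_all)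

lemma ex_strand_stopping:
  assumes gp: "general_position D a" "general_position D b" and e: "e \<in> arcs G"
    and z: "fst (lift D e k 1) \<in> {a<..<b}"
  shows "\<exists>P\<in>strands D a b. on_arc P = e \<and> cell P = k \<and> stop P = 1"
  by (rule ex_strand_stop_at[OF gp e])
    (use eventually_left_continuous[OF continuous_fst_lift[OF e] _ _ open_greaterThanLessThan z] in simp_all)

text \<open>For a representative ending on the side \<open>x\<close>, the horizontal cell is
  determined by the arc and the parameter, and the vertical cell is 0; so representatives correspond
  to points of the torus. The expression \<open>fst (curve D e s) - fst (curve D e t) + x\<close> is
  the first coordinate along the lift whose point at \<open>t\<close> lies on the side.\<close>

lemma card_side_strands:
  assumes gp: "general_position D a" "general_position D b" and x: "x \<in> {a, b}"
  shows "card (starts_on a b x) =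
      card {(e, t)\<in>hits x. \<forall>\<^sub>F s in at_right t. a < fst (curve D e s) - fst (curve D e t) + x \<and>
        fst (curve D e s) - fst (curve D e t) + x < b}"
    and "card (stops_on a b x) =
      card {(e, t)\<in>hits x. \<forall>\<^sub>F s in at_left t. a < fst (curve D e s) - fst (curve D e t) + x \<and>
        fst (curve D e s) - fst (curve D e t) + x < b}"
proof -
  have gpx: "general_position D x" using gp x by auto
  \<comment> \<open>Both claims are instances: \<open>E\<close> selects the start or the stop, and
    \<open>F\<close> is the one-sided filter that approaches this parameter from within the
    strand.\<close>
  have *: "card {P\<in>base_strands a b. fst (point D P (E P)) = x} =
      card {(e, t)\<in>hits x. \<forall>\<^sub>F s in F t. a < fst (curve D e s) - fst (curve D e t) + x \<and>
        fst (curve D e s) - fst (curve D e t) + x < b}" (is "_ = card ?X")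
    if E: "\<And>P. P \<in> strands D a b \<Longrightarrow> E P \<in> {0..1}"
      and ev: "\<And>P. P \<in> strands D a b \<Longrightarrow> \<forall>\<^sub>F s in F (E P). a < fst (point D P s) \<and> fst (point D P s) < b"
      and inj: "\<And>P Q. \<lbrakk>P \<in> strands D a b; Q \<in> strands D a b; on_arc P = on_arc Q; cell P = cell Q; E P = E Q\<rbrakk> \<Longrightarrow> P = Q"
      and ex: "\<And>e k t. \<lbrakk>e \<in> arcs G; t \<in> {0<..<1}; fst (lift D e k t) \<in> {a, b};
        \<forall>\<^sub>F s in F t. a < fst (lift D e k s) \<and> fst (lift D e k s) < b\<rbrakk> \<Longrightarrow>
        \<exists>P\<in>strands D a b. on_arc P = e \<and> cell P = k \<and> E P = t"
    for E and F :: "real \<Rightarrow> real filter"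
  proof (rule bij_betw_same_card[of "\<lambda>P. (on_arc P, E P)"], unfold bij_betw_def,
      intro conjI inj_onI equalityI subsetI)
    fix P Q assume PQ: "P \<in> {P\<in>base_strands a b. fst (point D P (E P)) = x}"
      "Q \<in> {P\<in>base_strands a b. fst (point D P (E P)) = x}" and eq: "(on_arc P, E P) = (on_arc Q, E Q)"
    have "fst (latt (cell P)) = fst (latt (cell Q))" using PQ eq by (simp add: point_eq)
    then have "cell P = cell Q" using p_pos PQ by (simp add: latt_eq prod_eq_iff base_strands_def)
    then show "P = Q" using PQ eq by (intro inj) (simp_all add: base_strands_def)
  next
    fix z assume "z \<in> (\<lambda>P. (on_arc P, E P)) ` {P\<in>base_strands a b. fst (point D P (E P)) = x}"
    then obtain P where P: "P \<in> strands D a b" "z = (on_arc P, E P)" and fx: "fst (point D P (E P)) = x"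
      by (auto simp: base_strands_def)
    note e = strandD(1)[OF P(1)]
    have m: "to_torus D (curve D (on_arc P) (E P)) \<in> meridian D x" by (rule fst_point_level[OF fx])
    then have "E P \<noteq> 0" "E P \<noteq> 1" using general_position_level(3,4)[OF gpx e] by auto
    then have "(on_arc P, E P) \<in> hits x" using e m E[OF P(1)] by (simp add: hits_def less_le)
    moreover have "fst (point D P s) = fst (curve D (on_arc P) s) - fst (curve D (on_arc P) (E P)) + x" for s
      using fx by (simp add: point_eq)
    ultimately show "z \<in> ?X" using ev[OF P(1)] by (simp add: P(2))
  next
    fix z assume "z \<in> ?X"
    then obtain e t where z: "z = (e, t)" "(e, t) \<in> hits x"
      and ev: "\<forall>\<^sub>F s in F t. a < fst (curve D e s) - fst (curve D e t) + x \<and>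
        fst (curve D e s) - fst (curve D e t) + x < b" by auto
    have e: "e \<in> arcs G" and t: "t \<in> {0<..<1}" and m: "to_torus D (curve D e t) \<in> meridian D x"
      using z(2) by (simp_all add: hits_def)
    obtain j :: int where j: "fst (curve D e t) = x + of_int j * p" using m unfolding meridian_iff by (rule exE)
    have pt: "fst (lift D e (- j, 0) s) = fst (curve D e s) - fst (curve D e t) + x" for s
      by (simp add: lift_eq latt_eq j)
    have "\<exists>P\<in>strands D a b. on_arc P = e \<and> cell P = (- j, 0) \<and> E P = t"
      by (rule ex[OF e t]) (use x ev in \<open>simp_all add: pt\<close>)
    then obtain P where P: "P \<in> strands D a b" "on_arc P = e \<and> cell P = (- j, 0) \<and> E P = t" by (rule bexE)
    then have "fst (point D P (E P)) = x" using pt[of t] by (simp add: point_def)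
    then show "z \<in> (\<lambda>P. (on_arc P, E P)) ` {P\<in>base_strands a b. fst (point D P (E P)) = x}"
      using P by (intro rev_image_eqI[of P]) (simp_all add: base_strands_def z(1))
  qed
  have iv: "(start P, stop P) \<in> ivals (\<lambda>t. fst (point D P t)) a b" if "P \<in> strands D a b" for P
    using that by (simp add: strands_iff)
  show "card (starts_on a b x) =
      card {(e, t)\<in>hits x. \<forall>\<^sub>F s in at_right t. a < fst (curve D e s) - fst (curve D e t) + x \<and>
        fst (curve D e s) - fst (curve D e t) + x < b}"
    unfolding starts_on_def
  proof (rule *[OF strandD(5) ivals_eventually(1)[OF iv]])
    fix e k t assume "e \<in> arcs G" "t \<in> {0<..<1::real}" "fst (lift D e k t) \<in> {a, b}"
      "\<forall>\<^sub>F s in at_right t. a < fst (lift D e k s) \<and> fst (lift D e k s) < b"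
    then show "\<exists>P\<in>strands D a b. on_arc P = e \<and> cell P = k \<and> start P = t"
      by (intro ex_strand_start_at[OF gp]) simp_all
  qed (use strand_eqI[of _ a b] in simp_all)
  show "card (stops_on a b x) =
      card {(e, t)\<in>hits x. \<forall>\<^sub>F s in at_left t. a < fst (curve D e s) - fst (curve D e t) + x \<and>
        fst (curve D e s) - fst (curve D e t) + x < b}"
    unfolding stops_on_def
  proof (rule *[OF strandD(6) ivals_eventually(2)[OF iv]])
    fix e k t assume "e \<in> arcs G" "t \<in> {0<..<1::real}" "fst (lift D e k t) \<in> {a, b}"
      "\<forall>\<^sub>F s in at_left t. a < fst (lift D e k s) \<and> fst (lift D e k s) < b"
    then show "\<exists>P\<in>strands D a b. on_arc P = e \<and> cell P = k \<and> stop P = t"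
      by (intro ex_strand_stop_at[OF gp]) simp_all
  qed (use strand_eqI[of _ a b] in simp_all)
qed

lemma eventually_near:
  assumes "(e, t) \<in> hits x" "d > 0"
  shows "\<forall>\<^sub>F s in at_right t. \<bar>fst (curve D e s) - fst (curve D e t)\<bar> < d"
    and "\<forall>\<^sub>F s in at_left t. \<bar>fst (curve D e s) - fst (curve D e t)\<bar> < d"
proof -
  have e: "e \<in> arcs G" and t: "0 < t" "t < 1" using assms(1) by (simp_all add: hits_def)
  have S: "open (ball (fst (curve D e t)) d)" "fst (curve D e t) \<in> ball (fst (curve D e t)) d"
    using assms(2) by simp_all
  show "\<forall>\<^sub>F s in at_right t. \<bar>fst (curve D e s) - fst (curve D e t)\<bar> < d"
    using eventually_right_continuous[OF continuous_fst_curve[OF e] _ _ S] t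
    by (simp add: dist_real_def abs_minus_commute)
  show "\<forall>\<^sub>F s in at_left t. \<bar>fst (curve D e s) - fst (curve D e t)\<bar> < d"
    using eventually_left_continuous[OF continuous_fst_curve[OF e] _ _ S] t
    by (simp add: dist_real_def abs_minus_commute)
qed

text \<open>Close to one side the other side is out of reach, so only the direction of the arc
  matters. On the left side a strand starts where the arc next runs to the right, on the right side
  where it next runs to the left; hence the complements in \<open>hits b\<close>.\<close>

lemma side_counts:
  assumes gp: "general_position D a" "general_position D b" and ab: "a < b"
  shows "card (starts_on a b a) = card (right_above a)" "card (stops_on a b a) = card (left_above a)"
    and "card (starts_on a b b) = card (hits b - right_above b)" "card (stops_on a b b) = card (hits b - left_above b)"
proof -
  have d: "b - a > 0" using ab by simp
  have gen: "(\<forall>\<^sub>F s in F. Q s) \<longleftrightarrow> (\<forall>\<^sub>F s in F. R s)"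
    if "\<forall>\<^sub>F s in F. S s" "\<And>s. S s \<Longrightarrow> Q s \<longleftrightarrow> R s" for F and Q R S :: "real \<Rightarrow> bool"
    using eventually_subst[OF eventually_mono[OF that(1), of "\<lambda>s. Q s = R s"]] that(2) by simp
  have ra: "(\<forall>\<^sub>F s in at_right t. a < fst (curve D e s) - fst (curve D e t) + a \<and>
      fst (curve D e s) - fst (curve D e t) + a < b) \<longleftrightarrow>
      (\<forall>\<^sub>F s in at_right t. fst (curve D e s) > fst (curve D e t))" if "(e, t) \<in> hits a" for e t
    by (rule gen[OF eventually_near(1)[OF that d]]) linarith
  have la: "(\<forall>\<^sub>F s in at_left t. a < fst (curve D e s) - fst (curve D e t) + a \<and>
      fst (curve D e s) - fst (curve D e t) + a < b) \<longleftrightarrow>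
      (\<forall>\<^sub>F s in at_left t. fst (curve D e s) > fst (curve D e t))" if "(e, t) \<in> hits a" for e t
    by (rule gen[OF eventually_near(2)[OF that d]]) linarith
  have rb: "(\<forall>\<^sub>F s in at_right t. a < fst (curve D e s) - fst (curve D e t) + b \<and>
      fst (curve D e s) - fst (curve D e t) + b < b) \<longleftrightarrow> (e, t) \<notin> right_above b" if et: "(e, t) \<in> hits b" for e t
    unfolding hits_sides(1)[OF gp(2) et, symmetric]
    by (rule gen[OF eventually_near(1)[OF et d]]) linarith
  have lb: "(\<forall>\<^sub>F s in at_left t. a < fst (curve D e s) - fst (curve D e t) + b \<and>
      fst (curve D e s) - fst (curve D e t) + b < b) \<longleftrightarrow> (e, t) \<notin> left_above b" if et: "(e, t) \<in> hits b" for e t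
    unfolding hits_sides(2)[OF gp(2) et, symmetric]
    by (rule gen[OF eventually_near(2)[OF et d]]) linarith
  show "card (starts_on a b a) = card (right_above a)"
    unfolding card_side_strands(1)[OF gp, of a, simplified] right_above_def
    by (rule arg_cong[of _ _ card]) (use ra in auto)
  show "card (stops_on a b a) = card (left_above a)"
    unfolding card_side_strands(2)[OF gp, of a, simplified] left_above_def
    by (rule arg_cong[of _ _ card]) (use la in auto)
  show "card (starts_on a b b) = card (hits b - right_above b)"
    unfolding card_side_strands(1)[OF gp insertI2[OF singletonI]]
    by (rule arg_cong[of _ _ card]) (use rb in blast)
  show "card (stops_on a b b) = card (hits b - left_above b)"
    unfolding card_side_strands(2)[OF gp insertI2[OF singletonI]]
    by (rule arg_cong[of _ _ card]) (use lb in blast)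
qed

lemma strand_ends_inside:
  assumes P: "P \<in> strands D a b"
  shows "fst (point D P (start P)) \<in> {a..b}" "fst (point D P (stop P)) \<in> {a..b}"
proof -
  let ?f = "\<lambda>t. fst (point D P t)"
  have cl: "closure {start P<..<stop P} = {start P..stop P}" using strandD(3)[OF P] by simp
  have "continuous_on {start P..stop P} ?f"
    by (rule continuous_on_subset[OF continuous_fst_point[OF strandD(1)[OF P]]]) (use strandD(2,4)[OF P] in simp)
  then have "?f ` closure {start P<..<stop P} \<subseteq> {a..b}"
    unfolding cl[symmetric]
    by (rule image_closure_subset) (use P in \<open>auto simp: strands_def less_imp_le\<close>)
  then show "?f (start P) \<in> {a..b}" "?f (stop P) \<in> {a..b}"
    unfolding cl using strandD(3)[OF P] by (auto simp: image_subset_iff)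
qed

section \<open>Balance of strands in a strip\<close>

definition lifts_within :: "real \<Rightarrow> real \<Rightarrow> real \<Rightarrow> int set" where
  "lifts_within a b x = {k. x + of_int k * p \<in> {a<..<b}}"

lemma finite_lifts_within: "finite (lifts_within a b x)"
  by (rule finite_subset[OF _ card_multiples_in(1)[OF p_pos, of "a - x" "b - x"]])
    (auto simp: lifts_within_def)

lemma card_lifts_within_shift: "card (lifts_within a b (x + of_int j * p)) = card (lifts_within a b x)"
proof (rule bij_betw_same_card[of "\<lambda>k. k + j"], rule bij_betw_byWitness[where f' = "\<lambda>k. k - j"])
qed (auto simp: lifts_within_def algebra_simps)

text \<open>No vertex lies on a side, so a strand that begins or ends at a vertex does so strictly
  inside the strip. Its representative is given by the arc and a horizontal shift that brings this
  vertex into the strip.\<close>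

lemma card_strands_from_vertices:
  assumes gp: "general_position D a" "general_position D b"
  shows "card {P\<in>base_strands a b. start P = 0} = (\<Sum>e\<in>arcs G. card (lifts_within a b (fst (curve D e 0))))"
    and "card {P\<in>base_strands a b. stop P = 1} = (\<Sum>e\<in>arcs G. card (lifts_within a b (fst (curve D e 1))))"
proof -
  have pt: "fst (point D P t) = fst (curve D (on_arc P) t) + of_int (fst (cell P)) * p" for P and t :: real
    by (simp add: point_eq latt_eq)
  have inside: "fst (point D P t) \<in> {a<..<b}"
    if "P \<in> strands D a b" "t \<in> {0, 1}" "fst (point D P t) \<in> {a..b}" for P and t :: real
    using that point_end_not_on_meridian[OF gp(1) strandD(1)[OF that(1)]]
      point_end_not_on_meridian[OF gp(2) strandD(1)[OF that(1)]] by (auto simp: less_le)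
  have *: "card {P\<in>base_strands a b. V P} = (\<Sum>e\<in>arcs G. card (lifts_within a b (fst (curve D e t))))"
    if t: "t \<in> {0, 1}" and V: "\<And>P. P \<in> strands D a b \<Longrightarrow> V P \<Longrightarrow> fst (point D P t) \<in> {a..b}"
      and inj: "\<And>P Q. \<lbrakk>P \<in> strands D a b; Q \<in> strands D a b; V P; V Q; on_arc P = on_arc Q; cell P = cell Q\<rbrakk> \<Longrightarrow> P = Q"
      and ex: "\<And>e k. \<lbrakk>e \<in> arcs G; fst (lift D e k t) \<in> {a<..<b}\<rbrakk> \<Longrightarrow>
        \<exists>P\<in>strands D a b. on_arc P = e \<and> cell P = k \<and> V P" for V and t :: real
  proof -
    have "bij_betw (\<lambda>P. (on_arc P, fst (cell P))) {P\<in>base_strands a b. V P}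
        (Sigma (arcs G) (\<lambda>e. lifts_within a b (fst (curve D e t))))"
      unfolding bij_betw_def
    proof (intro conjI inj_onI equalityI subsetI)
      fix P Q assume "P \<in> {P\<in>base_strands a b. V P}" "Q \<in> {P\<in>base_strands a b. V P}"
        "(on_arc P, fst (cell P)) = (on_arc Q, fst (cell Q))"
      then show "P = Q" by (intro inj) (simp_all add: base_strands_def prod_eq_iff)
    next
      fix z assume "z \<in> (\<lambda>P. (on_arc P, fst (cell P))) ` {P\<in>base_strands a b. V P}"
      then obtain P where P: "P \<in> strands D a b" "V P" "z = (on_arc P, fst (cell P))"
        by (auto simp: base_strands_def)
      have "fst (point D P t) \<in> {a<..<b}" by (rule inside[OF P(1) t V[OF P(1,2)]])
      then show "z \<in> Sigma (arcs G) (\<lambda>e. lifts_within a b (fst (curve D e t)))"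
        using strandD(1)[OF P(1)] unfolding pt by (simp add: P(3) lifts_within_def)
    next
      fix z assume "z \<in> Sigma (arcs G) (\<lambda>e. lifts_within a b (fst (curve D e t)))"
      then obtain e k where z: "z = (e, k)" "e \<in> arcs G" "fst (lift D e (k, 0) t) \<in> {a<..<b}"
        by (auto simp: lifts_within_def lift_eq latt_eq)
      obtain P where "P \<in> strands D a b" "on_arc P = e \<and> cell P = (k, 0) \<and> V P"
        using ex[OF z(2,3)] by (rule bexE)
      then show "z \<in> (\<lambda>P. (on_arc P, fst (cell P))) ` {P\<in>base_strands a b. V P}"
        by (intro rev_image_eqI[of P]) (simp_all add: base_strands_def z(1))
    qed
    from bij_betw_same_card[OF this] show ?thesis by (simp add: finite_arcs_G finite_lifts_within)
  qed
  show "card {P\<in>base_strands a b. start P = 0} = (\<Sum>e\<in>arcs G. card (lifts_within a b (fst (curve D e 0))))"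
  proof (rule *)
    fix P assume "P \<in> strands D a b" "start P = 0"
    then show "fst (point D P 0) \<in> {a..b}" using strand_ends_inside(1)[of P a b] by simp
  qed (use strand_eqI[of _ a b] ex_strand_starting[OF gp] in simp_all)
  show "card {P\<in>base_strands a b. stop P = 1} = (\<Sum>e\<in>arcs G. card (lifts_within a b (fst (curve D e 1))))"
  proof (rule *)
    fix P assume "P \<in> strands D a b" "stop P = 1"
    then show "fst (point D P 1) \<in> {a..b}" using strand_ends_inside(2)[of P a b] by simp
  qed (use strand_eqI[of _ a b] ex_strand_stopping[OF gp] in simp_all)
qed

text \<open>The representatives are counted once by their starts and once by their stops. The parts
  at vertices agree because the number of horizontal lifts inside the strip depends only on the
  vertex, and every vertex is a tail twice and a head twice.\<close>

lemma strip_flow: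
  assumes gp: "general_position D a" "general_position D b" and ab: "a < b"
  shows "card (starts_on a b a) + card (starts_on a b b) = card (stops_on a b a) + card (stops_on a b b)"
proof -
  define \<phi> where "\<phi> v = card (lifts_within a b (fst (place D v)))" for v
  have \<phi>: "card (lifts_within a b (fst z)) = \<phi> v" if eq: "to_torus D z = to_torus D (place D v)" for z v
  proof -
    obtain k where "z = place D v + latt k" using eq[symmetric] unfolding to_torus_eq_iff by (rule exE)
    then show ?thesis by (simp add: \<phi>_def latt_eq card_lifts_within_shift)
  qed
  have "card {P\<in>base_strands a b. start P = 0} = (\<Sum>e\<in>arcs G. \<phi> (tail G e))"
    unfolding card_strands_from_vertices(1)[OF gp] by (rule sum.cong[OF refl]) (rule \<phi>, rule to_torus_ends)
  also have "\<dots> = (\<Sum>e\<in>arcs G. \<phi> (head G e))" by (rule sum_over_heads_eq_tails[symmetric])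
  also have "\<dots> = card {P\<in>base_strands a b. stop P = 1}"
    unfolding card_strands_from_vertices(2)[OF gp]
    by (rule sum.cong[OF refl], rule sym) (rule \<phi>, rule to_torus_ends)
  finally have eq: "card {P\<in>base_strands a b. start P = 0} = card {P\<in>base_strands a b. stop P = 1}" .
  have off: "fst (point D P 0) \<notin> {a, b}" "fst (point D P 1) \<notin> {a, b}" if "P \<in> base_strands a b" for P
    using point_end_not_on_meridian[OF gp(1), of P] point_end_not_on_meridian[OF gp(2), of P] that
    by (simp_all add: base_strands_def strands_def)
  have st: "start P = 0 \<longleftrightarrow> fst (point D P (start P)) \<notin> {a, b}"
    and sp: "stop P = 1 \<longleftrightarrow> fst (point D P (stop P)) \<notin> {a, b}" if P: "P \<in> base_strands a b" for P
  proof -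
    have Ps: "P \<in> strands D a b" using P by (simp add: base_strands_def)
    show "start P = 0 \<longleftrightarrow> fst (point D P (start P)) \<notin> {a, b}"
      using strandD(7)[OF Ps] off(1)[OF P] by (cases "start P = 0") simp_all
    show "stop P = 1 \<longleftrightarrow> fst (point D P (stop P)) \<notin> {a, b}"
      using strandD(8)[OF Ps] off(2)[OF P] by (cases "stop P = 1") simp_all
  qed
  have split3: "card (base_strands a b) = card A + card B + card C"
    if "base_strands a b = A \<union> B \<union> C" "A \<inter> B = {}" "(A \<union> B) \<inter> C = {}" for A B C
    using that finite_base_strands[OF gp] by (simp add: card_Un_disjoint)
  have "card (base_strands a b) = card (starts_on a b a) + card (starts_on a b b) + card {P\<in>base_strands a b. start P = 0}"
    by (rule split3) (use st ab in \<open>auto simp: starts_on_def\<close>)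
  moreover have "card (base_strands a b) = card (stops_on a b a) + card (stops_on a b b) + card {P\<in>base_strands a b. stop P = 1}"
    by (rule split3) (use sp ab in \<open>auto simp: stops_on_def\<close>)
  ultimately show ?thesis using eq by simp
qed

definition net_crossings :: "real \<Rightarrow> int" where
  "net_crossings x = int (card (rightward_crossings D x)) - int (card (leftward_crossings D x))"

text \<open>The sign changes at the right side, where entering the strip means going
  leftward.\<close>

lemma side_excess:
  assumes gp: "general_position D a" "general_position D b" and ab: "a < b"
  shows "int (card (starts_on a b a)) - int (card (stops_on a b a)) = net_crossings a"
    and "int (card (starts_on a b b)) - int (card (stops_on a b b)) = - net_crossings b"
proof -
  note cd = crossings_difference[OF gp(1)] crossings_difference[OF gp(2)]
  show "int (card (starts_on a b a)) - int (card (stops_on a b a)) = net_crossings a"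
    unfolding side_counts[OF gp ab] net_crossings_def cd ..
  have sub: "right_above b \<subseteq> hits b" "left_above b \<subseteq> hits b"
    by (auto simp: right_above_def left_above_def)
  have "card (hits b) = card (hits b - right_above b) + card (right_above b)"
    using card_Diff_subset[OF finite_above(1)[OF gp(2)] sub(1)] card_mono[OF finite_hits[OF gp(2)] sub(1)] by simp
  moreover have "card (hits b) = card (hits b - left_above b) + card (left_above b)"
    using card_Diff_subset[OF finite_above(2)[OF gp(2)] sub(2)] card_mono[OF finite_hits[OF gp(2)] sub(2)] by simp
  ultimately show "int (card (starts_on a b b)) - int (card (stops_on a b b)) = - net_crossings b"
    unfolding side_counts[OF gp ab] net_crossings_def cd by linarith
qed

lemma net_crossings_invariant:
  assumes "general_position D x" "general_position D y"
  shows "net_crossings x = net_crossings y"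
proof -
  have *: "net_crossings x = net_crossings y"
    if gp: "general_position D x" "general_position D y" and xy: "x < y" for x y
    using strip_flow[OF gp xy] side_excess[OF gp xy] by linarith
  show ?thesis
  proof (cases x y rule: linorder_cases)
    case less
    then show ?thesis by (rule *[OF assms])
  next
    case greater
    then show ?thesis by (rule *[OF assms(2,1), symmetric])
  qed simp
qed

lemma patch_iff:
  "P \<in> patch_strands D a b d l \<longleftrightarrow> P \<in> strands D a b \<and> (\<exists>t\<in>{start P..stop P}. snd (point D P t) \<in> {d - l..d})"
  by (simp add: patch_strands_def)

section \<open>Strands at an interaction\<close>

text \<open>The value 0 at points that are not lifts of vertices lets balance be stated for every
  point \<open>z\<close>, as the trail decomposition demands.\<close>

definition vertex_degree :: "real \<times> real \<Rightarrow> nat" where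
  "vertex_degree z = (if \<exists>v\<in>verts G. to_torus D (place D v) = to_torus D z then 2 else 0)"

lemma card_incident_arcs:
  "card {e\<in>arcs G. to_torus D (curve D e 0) = to_torus D z} = vertex_degree z"
  "card {e\<in>arcs G. to_torus D (curve D e 1) = to_torus D z} = vertex_degree z"
proof -
  have *: "card {e\<in>arcs G. to_torus D (place D (w e)) = to_torus D z} = vertex_degree z"
    if w: "\<And>e. e \<in> arcs G \<Longrightarrow> w e \<in> verts G"
      and c: "\<And>v. v \<in> verts G \<Longrightarrow> card {e\<in>arcs G. w e = v} = 2" for w
  proof (cases "\<exists>v\<in>verts G. to_torus D (place D v) = to_torus D z")
    case True
    then obtain v where v: "v \<in> verts G" "to_torus D (place D v) = to_torus D z" by (rule bexE)
    have "to_torus D (place D (w e)) = to_torus D z \<longleftrightarrow> w e = v" if "e \<in> arcs G" for e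
      using place_inj[OF _ w[OF that] v(1)] v(2) by metis
    then have "{e\<in>arcs G. to_torus D (place D (w e)) = to_torus D z} = {e\<in>arcs G. w e = v}" by auto
    then show ?thesis using True c[OF v(1)] by (simp add: vertex_degree_def)
  next
    case False
    then have "{e\<in>arcs G. to_torus D (place D (w e)) = to_torus D z} = {}" using w by blast
    then show ?thesis using False by (simp only: vertex_degree_def card.empty if_False)
  qed
  have t: "{e\<in>arcs G. to_torus D (curve D e 0) = to_torus D z} =
      {e\<in>arcs G. to_torus D (place D (tail G e)) = to_torus D z}"
    by (rule Collect_cong) (metis to_torus_ends(1))
  have hd: "{e\<in>arcs G. to_torus D (curve D e 1) = to_torus D z} =
      {e\<in>arcs G. to_torus D (place D (head G e)) = to_torus D z}"
    by (rule Collect_cong) (metis to_torus_ends(2))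
  show "card {e\<in>arcs G. to_torus D (curve D e 0) = to_torus D z} = vertex_degree z"
    unfolding t by (rule *) (simp_all add: ends_in_verts degree)
  show "card {e\<in>arcs G. to_torus D (curve D e 1) = to_torus D z} = vertex_degree z"
    unfolding hd by (rule *) (simp_all add: ends_in_verts degree)
qed

text \<open>A lifted arc is determined by the arc and one of its ends, so the strands that begin, or
  end, at \<open>z\<close> correspond to the arcs that begin, or end, at its image on the
  torus.\<close>

lemma card_strands_at:
  assumes gp: "general_position D a" "general_position D b" and z: "fst z \<in> {a<..<b}"
  shows "card {P\<in>strands D a b. start P = 0 \<and> point D P 0 = z} = vertex_degree z"
    and "card {P\<in>strands D a b. stop P = 1 \<and> point D P 1 = z} = vertex_degree z"
proof -
  have cell: "cell P = cell Q" if "on_arc P = on_arc Q" "point D P t = point D Q t" for P Q and t :: real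
  proof -
    have "latt (cell P - cell Q) = 0" using that unfolding latt_diff point_eq by simp
    then show ?thesis unfolding latt_eq_0_iff by simp
  qed
  show "card {P\<in>strands D a b. start P = 0 \<and> point D P 0 = z} = vertex_degree z"
    unfolding card_incident_arcs(1)[symmetric]
  proof (rule bij_betw_same_card[of on_arc], unfold bij_betw_def, intro conjI inj_onI equalityI subsetI)
    fix P Q assume P: "P \<in> {P\<in>strands D a b. start P = 0 \<and> point D P 0 = z}"
      and Q: "Q \<in> {P\<in>strands D a b. start P = 0 \<and> point D P 0 = z}" and e: "on_arc P = on_arc Q"
    show "P = Q"
      by (rule strand_eqI[of _ a b]) (use P Q e cell[OF e, of 0] in simp_all)
  next
    fix e assume "e \<in> on_arc ` {P\<in>strands D a b. start P = 0 \<and> point D P 0 = z}"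
    then obtain P where P: "P \<in> strands D a b" "point D P 0 = z" "e = on_arc P" by auto
    then show "e \<in> {e\<in>arcs G. to_torus D (curve D e 0) = to_torus D z}"
      using strandD(1)[OF P(1)] to_torus_lift[of "on_arc P" "cell P" 0] by (simp add: point_def)
  next
    fix e assume "e \<in> {e\<in>arcs G. to_torus D (curve D e 0) = to_torus D z}"
    then have e: "e \<in> arcs G" "to_torus D (curve D e 0) = to_torus D z" by simp_all
    from e(2) obtain k where k: "z = curve D e 0 + latt k" unfolding to_torus_eq_iff by (rule exE)
    then have k': "lift D e k 0 = z" by (simp add: lift_eq)
    obtain P where "P \<in> strands D a b" "on_arc P = e \<and> cell P = k \<and> start P = 0"
      using ex_strand_starting[OF gp e(1), of k, unfolded k', OF z] by (rule bexE)
    then show "e \<in> on_arc ` {P\<in>strands D a b. start P = 0 \<and> point D P 0 = z}"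
      using k' by (intro rev_image_eqI[of P]) (simp_all add: point_def)
  qed
  show "card {P\<in>strands D a b. stop P = 1 \<and> point D P 1 = z} = vertex_degree z"
    unfolding card_incident_arcs(2)[symmetric]
  proof (rule bij_betw_same_card[of on_arc], unfold bij_betw_def, intro conjI inj_onI equalityI subsetI)
    fix P Q assume P: "P \<in> {P\<in>strands D a b. stop P = 1 \<and> point D P 1 = z}"
      and Q: "Q \<in> {P\<in>strands D a b. stop P = 1 \<and> point D P 1 = z}" and e: "on_arc P = on_arc Q"
    show "P = Q"
      by (rule strand_eqI[of _ a b]) (use P Q e cell[OF e, of 1] in simp_all)
  next
    fix e assume "e \<in> on_arc ` {P\<in>strands D a b. stop P = 1 \<and> point D P 1 = z}"
    then obtain P where P: "P \<in> strands D a b" "point D P 1 = z" "e = on_arc P" by auto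
    then show "e \<in> {e\<in>arcs G. to_torus D (curve D e 1) = to_torus D z}"
      using strandD(1)[OF P(1)] to_torus_lift[of "on_arc P" "cell P" 1] by (simp add: point_def)
  next
    fix e assume "e \<in> {e\<in>arcs G. to_torus D (curve D e 1) = to_torus D z}"
    then have e: "e \<in> arcs G" "to_torus D (curve D e 1) = to_torus D z" by simp_all
    from e(2) obtain k where k: "z = curve D e 1 + latt k" unfolding to_torus_eq_iff by (rule exE)
    then have k': "lift D e k 1 = z" by (simp add: lift_eq)
    obtain P where "P \<in> strands D a b" "on_arc P = e \<and> cell P = k \<and> stop P = 1"
      using ex_strand_stopping[OF gp e(1), of k, unfolded k', OF z] by (rule bexE)
    then show "e \<in> on_arc ` {P\<in>strands D a b. stop P = 1 \<and> point D P 1 = z}"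
      using k' by (intro rev_image_eqI[of P]) (simp_all add: point_def)
  qed
qed

end

section \<open>Counting the strands of a patch\<close>

locale strip = toroidal_ground D for D :: "('a, 'b) ground" +
  fixes a b M :: real
  assumes gpa: "general_position D a" and gpb: "general_position D b" and ab: "a < b"
    and M0: "0 \<le> M"
    and M: "\<And>P t. \<lbrakk>P \<in> strands D a b; t \<in> {0..1}\<rbrakk> \<Longrightarrow> \<bar>snd (point D P t) - hgt P\<bar> \<le> M"
begin

text \<open>Together with \<open>in_patch\<close> this encloses the patch between two bands of
  values of \<open>hgt\<close>, of lengths \<open>l - 2 * M\<close> and \<open>l + 2 * M\<close>.
  Bands can be counted class by class, which the patch itself does not permit.\<close>

lemma patch_hgt:
  assumes "P \<in> patch_strands D a b d l"
  shows "d - l - M \<le> hgt P" "hgt P \<le> d + M"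
proof -
  obtain t where P: "P \<in> strands D a b" and t: "t \<in> {start P..stop P}" "snd (point D P t) \<in> {d - l..d}"
    using assms unfolding patch_iff by blast
  have "t \<in> {0..1}" using t(1) strandD(2,4)[OF P] by simp
  from M[OF P this] show "d - l - M \<le> hgt P" "hgt P \<le> d + M" using t(2) by (simp_all add: abs_le_iff)
qed

lemma in_patch:
  assumes P: "P \<in> strands D a b" and "d - l + M \<le> hgt P" "hgt P \<le> d - M"
  shows "P \<in> patch_strands D a b d l"
  unfolding patch_iff
proof (intro conjI bexI[of _ "start P"])
  show "snd (point D P (start P)) \<in> {d - l..d}"
    using M[OF P strandD(5)[OF P]] assms(2,3) by (simp add: abs_le_iff)
qed (use strandD[OF P] P in simp_all)

lemma finite_base: "finite (base_strands a b)"
  by (rule finite_base_strands[OF gpa gpb])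

lemma card_hgt_between:
  assumes "A \<subseteq> base_strands a b"
  shows "finite {P. rebase 0 P \<in> A \<and> x \<le> hgt P \<and> hgt P \<le> y}"
    and "real (card {P. rebase 0 P \<in> A \<and> x \<le> hgt P \<and> hgt P \<le> y}) \<le> card A * max 0 ((y - x) / h + 1)"
    and "card A * ((y - x) / h - 1) \<le> real (card {P. rebase 0 P \<in> A \<and> x \<le> hgt P \<and> hgt P \<le> y})"
proof -
  have A: "A \<subseteq> {P. snd (cell P) = 0}" "finite A"
    using assms finite_subset[OF assms finite_base] by (auto simp: base_strands_def)
  show "finite {P. rebase 0 P \<in> A \<and> x \<le> hgt P \<and> hgt P \<le> y}" by (rule card_translates(1)[OF A])
  show "real (card {P. rebase 0 P \<in> A \<and> x \<le> hgt P \<and> hgt P \<le> y}) \<le> card A * max 0 ((y - x) / h + 1)"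
    unfolding card_translates(2)[OF A] of_nat_mult
    by (rule mult_left_mono[OF card_multiples_in(2)[OF h_pos]]) simp
  show "card A * ((y - x) / h - 1) \<le> real (card {P. rebase 0 P \<in> A \<and> x \<le> hgt P \<and> hgt P \<le> y})"
    unfolding card_translates(2)[OF A] of_nat_mult
    by (rule mult_left_mono[OF card_multiples_in(3)[OF h_pos]]) simp
qed

lemma finite_patch: "finite (patch_strands D a b d l)"
proof (rule finite_subset[OF _ card_hgt_between(1)[OF subset_refl, of "d - l - M" "d + M"]], rule subsetI)
  fix P assume P: "P \<in> patch_strands D a b d l"
  then have "P \<in> strands D a b" by (simp add: patch_iff)
  then show "P \<in> {P. rebase 0 P \<in> base_strands a b \<and> d - l - M \<le> hgt P \<and> hgt P \<le> d + M}"
    using patch_hgt[OF P] rebase_in_base by simp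
qed

definition entries :: "real \<Rightarrow> real \<Rightarrow> real \<Rightarrow> 'b strand set" where
  "entries x d l = {P\<in>patch_strands D a b d l. fst (point D P (start P)) = x}"

definition exits :: "real \<Rightarrow> real \<Rightarrow> real \<Rightarrow> 'b strand set" where
  "exits x d l = {P\<in>patch_strands D a b d l. fst (point D P (stop P)) = x}"

lemma starts_on_iff: "rebase 0 P \<in> starts_on a b x \<longleftrightarrow> P \<in> strands D a b \<and> fst (point D P (start P)) = x"
  and stops_on_iff: "rebase 0 P \<in> stops_on a b x \<longleftrightarrow> P \<in> strands D a b \<and> fst (point D P (stop P)) = x"
  by (auto simp: starts_on_def stops_on_def base_strands_def)

lemma sub_base: "starts_on a b x \<subseteq> base_strands a b" "stops_on a b x \<subseteq> base_strands a b"
  by (auto simp: starts_on_def stops_on_def)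

lemma finite_entries: "finite (entries x d l)" "finite (exits x d l)"
  unfolding entries_def exits_def by (rule finite_subset[OF _ finite_patch], auto)+

lemma card_patch_class:
  assumes A: "A \<subseteq> base_strands a b"
  shows "card A * ((l - 2 * M) / h - 1) \<le> real (card {P\<in>patch_strands D a b d l. rebase 0 P \<in> A})"
    and "real (card {P\<in>patch_strands D a b d l. rebase 0 P \<in> A}) \<le> card A * max 0 ((l + 2 * M) / h + 1)"
proof -
  let ?A = "\<lambda>u v. {P. rebase 0 P \<in> A \<and> u \<le> hgt P \<and> hgt P \<le> v}"
  let ?B = "{P\<in>patch_strands D a b d l. rebase 0 P \<in> A}"
  have "P \<in> strands D a b" if "rebase 0 P \<in> A" for P
    using subsetD[OF A that] by (simp add: base_strands_def)
  then have "?A (d - l + M) (d - M) \<subseteq> ?B" using in_patch by auto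
  then have le: "card (?A (d - l + M) (d - M)) \<le> card ?B" by (rule card_mono[rotated]) (simp add: finite_patch)
  have e: "(d - M - (d - l + M)) / h = (l - 2 * M) / h" by simp
  show "card A * ((l - 2 * M) / h - 1) \<le> real (card ?B)"
    by (rule order_trans[OF card_hgt_between(3)[OF A, of "d - M" "d - l + M", unfolded e] of_nat_mono[OF le]])
  have "?B \<subseteq> ?A (d - l - M) (d + M)" using patch_hgt by auto
  then have le: "card ?B \<le> card (?A (d - l - M) (d + M))" by (rule card_mono[OF card_hgt_between(1)[OF A]])
  have e: "(d + M - (d - l - M)) / h = (l + 2 * M) / h" by simp
  show "real (card ?B) \<le> card A * max 0 ((l + 2 * M) / h + 1)"
    by (rule order_trans[OF of_nat_mono[OF le] card_hgt_between(2)[OF A, of "d - l - M" "d + M", unfolded e]])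
qed

lemma entries_eq: "entries x d l = {P\<in>patch_strands D a b d l. rebase 0 P \<in> starts_on a b x}"
  and exits_eq: "exits x d l = {P\<in>patch_strands D a b d l. rebase 0 P \<in> stops_on a b x}"
  by (auto simp: entries_def exits_def starts_on_iff stops_on_iff patch_iff)

lemmas card_entries = card_patch_class[OF sub_base(1), folded entries_eq]
lemmas card_exits = card_patch_class[OF sub_base(2), folded exits_eq]

text \<open>A thread that leaves through a side comes back through the same side, and a continuation
  at an interaction involves no side, since vertices are off both meridians.\<close>

lemma continues_side:
  assumes c: "continues D a b P Q" and P: "P \<in> strands D a b" and Q: "Q \<in> strands D a b"
  shows "fst (point D P (stop P)) = a \<longleftrightarrow> fst (point D Q (start Q)) = a"
proof -
  let ?z = "point D P (stop P)" and ?w = "point D Q (start Q)"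
  consider "stop P = 1" "start Q = 0" | "fst ?z = a" "fst ?w = a" | "fst ?z = b" "fst ?w = b"
    using c unfolding continues_def Let_def by argo
  then show ?thesis
  proof cases
    case 1
    then show ?thesis
      using point_end_not_on_meridian[OF gpa strandD(1)[OF P]] point_end_not_on_meridian[OF gpa strandD(1)[OF Q]] by simp
  qed (use ab in simp_all)
qed

text \<open>Along one route, entries and exits at the side \<open>a\<close> are paired by
  \<open>continues_side\<close> except at its two ends, so their numbers differ by at most one.
  Every strand is used by two threads, hence the factors 2.\<close>

lemma entries_exits_difference:
  assumes w: "works_patch D a b d l ws"
  shows "2 * card (entries a d l) \<le> length ws + 2 * card (exits a d l)"
    and "2 * card (exits a d l) \<le> length ws + 2 * card (entries a d l)"
proof -
  let ?S = "patch_strands D a b d l"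
  define A where "A P \<longleftrightarrow> P \<in> entries a d l" for P
  define B where "B P \<longleftrightarrow> P \<in> exits a d l" for P
  have cnt: "(\<Sum>w\<leftarrow>ws. length (filter (\<lambda>P. P \<in> X) w)) = 2 * card X" if X: "X \<subseteq> ?S" for X
  proof -
    have fin: "finite X" by (rule finite_subset[OF X finite_patch])
    have "(\<Sum>w\<leftarrow>ws. length (filter (\<lambda>P. P \<in> X) w)) = (\<Sum>w\<leftarrow>ws. \<Sum>P\<in>X. count_list w P)"
      unfolding sum_count_list_filter[OF fin] ..
    also have "\<dots> = (\<Sum>P\<in>X. \<Sum>w\<leftarrow>ws. count_list w P)" by (induction ws) (simp_all add: sum.distrib)
    also have "\<dots> = (\<Sum>P\<in>X. 2)" by (rule sum.cong) (use w X in \<open>auto simp: works_patch_def\<close>)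
    finally show ?thesis by simp
  qed
  have AB: "length (filter A v) \<le> 1 + length (filter B v) \<and> length (filter B v) \<le> 1 + length (filter A v)"
    if v: "v \<in> set ws" for v
  proof (cases v)
    case (Cons x u)
    have sub: "set v \<subseteq> ?S" and suc: "successively (continues D a b) v"
      using w v by (simp_all add: works_patch_def)
    have suc': "successively (\<lambda>P Q. P \<in> ?S \<and> Q \<in> ?S \<and> continues D a b P Q) (x # u)"
      using successively_mono[OF suc, of "\<lambda>P Q. P \<in> ?S \<and> Q \<in> ?S \<and> continues D a b P Q"] sub
      unfolding Cons by blast
    have side: "A Q \<longleftrightarrow> B P" if "P \<in> ?S \<and> Q \<in> ?S \<and> continues D a b P Q" for P Q
      using continues_side[of P Q] that by (simp add: A_def B_def entries_def exits_def patch_iff)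
    have 1: "length (filter A u) \<le> length (filter B (x # u))"
      by (rule successively_filter_le[OF suc']) (use side in blast)
    have 2: "length (filter B (x # u)) \<le> length (filter A u) + 1"
      by (rule successively_filter_ge[OF suc']) (use side in blast)
    have "length (filter A (x # u)) \<le> 1 + length (filter A u)" "length (filter A u) \<le> length (filter A (x # u))"
      by simp_all
    with 1 2 show ?thesis unfolding Cons by linarith
  qed simp
  have "(\<Sum>w\<leftarrow>ws. length (filter A w)) \<le> (\<Sum>w\<leftarrow>ws. 1 + length (filter B w))"
    by (rule sum_list_mono) (use AB in blast)
  also have "\<dots> = length ws + (\<Sum>w\<leftarrow>ws. length (filter B w))" by (induction ws) simp_all
  finally have 1: "(\<Sum>w\<leftarrow>ws. length (filter A w)) \<le> length ws + (\<Sum>w\<leftarrow>ws. length (filter B w))" .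
  have "(\<Sum>w\<leftarrow>ws. length (filter B w)) \<le> (\<Sum>w\<leftarrow>ws. 1 + length (filter A w))"
    by (rule sum_list_mono) (use AB in blast)
  also have "\<dots> = length ws + (\<Sum>w\<leftarrow>ws. length (filter A w))" by (induction ws) simp_all
  finally have 2: "(\<Sum>w\<leftarrow>ws. length (filter B w)) \<le> length ws + (\<Sum>w\<leftarrow>ws. length (filter A w))" .
  have sub: "entries a d l \<subseteq> ?S" "exits a d l \<subseteq> ?S" by (auto simp: entries_def exits_def)
  show "2 * card (entries a d l) \<le> length ws + 2 * card (exits a d l)"
    "2 * card (exits a d l) \<le> length ws + 2 * card (entries a d l)"
    using 1 2 unfolding A_def B_def cnt[OF sub(1)] cnt[OF sub(2)] .
qed

text \<open>The numbers of entries and exits grow linearly in \<open>l\<close>, at rates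
  proportional to their numbers of classes, while their difference stays bounded by the number of
  threads.\<close>

lemma conserving_balanced:
  assumes "\<And>l. l \<ge> 0 \<Longrightarrow> \<exists>ws. length ws = n \<and> works_patch D a b d l ws"
  shows "card (starts_on a b a) = card (stops_on a b a)"
proof (rule antisym)
  have le: "2 * card (entries a d l) \<le> n + 2 * card (exits a d l)"
    "2 * card (exits a d l) \<le> n + 2 * card (entries a d l)" if "l \<ge> 0" for l
  proof -
    obtain ws where ws: "length ws = n" "works_patch D a b d l ws" using assms[OF \<open>l \<ge> 0\<close>] by blast
    show "2 * card (entries a d l) \<le> n + 2 * card (exits a d l)"
      "2 * card (exits a d l) \<le> n + 2 * card (entries a d l)"
      using entries_exits_difference[OF ws(2)] unfolding ws(1) .
  qed
  show "card (starts_on a b a) \<le> card (stops_on a b a)"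
  proof (rule growth_le[OF h_pos M0, of _ n])
    fix l :: real assume l: "l \<ge> 0"
    have "card (entries a d l) \<le> n + card (exits a d l)" using le(1)[OF l] by simp
    then have "real (card (entries a d l)) \<le> real n + real (card (exits a d l))" by linarith
    then show "real (card (starts_on a b a)) * ((l - 2 * M) / h - 1) \<le>
        real n + real (card (stops_on a b a)) * max 0 ((l + 2 * M) / h + 1)"
      using card_entries(1)[of a l d] card_exits(2)[of a d l] by linarith
  qed
  show "card (stops_on a b a) \<le> card (starts_on a b a)"
  proof (rule growth_le[OF h_pos M0, of _ n])
    fix l :: real assume l: "l \<ge> 0"
    have "card (exits a d l) \<le> n + card (entries a d l)" using le(2)[OF l] by simp
    then have "real (card (exits a d l)) \<le> real n + real (card (entries a d l))" by linarith
    then show "real (card (stops_on a b a)) * ((l - 2 * M) / h - 1) \<le>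
        real n + real (card (starts_on a b a)) * max 0 ((l + 2 * M) / h + 1)"
      using card_exits(1)[of a l d] card_entries(2)[of a d l] by linarith
  qed
qed

end

section \<open>Routing the threads of a patch\<close>

context strip
begin

abbreviation "rect d l \<equiv> {a<..<b} \<times> {d - l..d}"

text \<open>\<open>None\<close> marks an end at which the patch is cut: on a side, or at an
  interaction above or below the rectangle. Trails then begin and end exactly where routes are
  allowed to.\<close>

definition source :: "real \<Rightarrow> real \<Rightarrow> 'b strand \<Rightarrow> (real \<times> real) option" where
  "source d l P = (if start P = 0 \<and> point D P 0 \<in> rect d l then Some (point D P 0) else None)"

definition target :: "real \<Rightarrow> real \<Rightarrow> 'b strand \<Rightarrow> (real \<times> real) option" where
  "target d l P = (if stop P = 1 \<and> point D P 1 \<in> rect d l then Some (point D P 1) else None)"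

lemma source_Some: "source d l P = Some z \<longleftrightarrow> start P = 0 \<and> point D P 0 = z \<and> z \<in> rect d l"
  by (auto simp: source_def)

lemma target_Some: "target d l P = Some z \<longleftrightarrow> stop P = 1 \<and> point D P 1 = z \<and> z \<in> rect d l"
  by (auto simp: target_def)

lemma in_patch_endpoint:
  assumes "P \<in> strands D a b" "point D P t \<in> rect d l" "t \<in> {start P..stop P}"
  shows "P \<in> patch_strands D a b d l"
  unfolding patch_iff
  by (intro conjI bexI[of _ t]) (use assms in \<open>auto simp: mem_Times_iff\<close>)

text \<open>Every strand of the strip that begins or ends at a point of the rectangle belongs to the
  patch, so the degrees of the ground apply there. For any other point both sets are empty.\<close>

lemma patch_balanced:
  "card {P\<in>patch_strands D a b d l. target d l P = Some z} =
   card {P\<in>patch_strands D a b d l. source d l P = Some z}"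
proof (cases "z \<in> rect d l")
  case True
  have p0: "P \<in> patch_strands D a b d l" if "P \<in> strands D a b" "start P = 0" "point D P 0 = z" for P
    by (rule in_patch_endpoint[of _ 0]) (use that True strandD(3)[OF that(1)] in simp_all)
  have p1: "P \<in> patch_strands D a b d l" if "P \<in> strands D a b" "stop P = 1" "point D P 1 = z" for P
    by (rule in_patch_endpoint[of _ 1]) (use that True strandD(3)[OF that(1)] in simp_all)
  have sub: "P \<in> strands D a b" if "P \<in> patch_strands D a b d l" for P using that by (simp add: patch_iff)
  have s: "{P\<in>patch_strands D a b d l. source d l P = Some z} = {P\<in>strands D a b. start P = 0 \<and> point D P 0 = z}"
    unfolding source_Some using p0 sub True by blast
  have t: "{P\<in>patch_strands D a b d l. target d l P = Some z} = {P\<in>strands D a b. stop P = 1 \<and> point D P 1 = z}"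
    unfolding target_Some using p1 sub True by blast
  have z: "fst z \<in> {a<..<b}" using True by (simp add: mem_Times_iff)
  show ?thesis unfolding s t card_strands_at[OF gpa gpb z] ..
next
  case False
  then show ?thesis by (simp add: source_Some target_Some)
qed

text \<open>A strand with both ends at interactions is an entire lifted arc, and every lifted arc
  sharing such an end contributes a strand of the patch at that end. So \<open>T\<close> would give
  a nonempty finite closed set of lifted arcs.\<close>

lemma patch_open_ended:
  assumes nc: "no_contractible_directed_cycles D"
    and T: "T \<subseteq> patch_strands D a b d l" "T \<noteq> {}"
    and some: "\<forall>P\<in>T. source d l P \<noteq> None \<and> target d l P \<noteq> None"
    and closed: "\<forall>P\<in>T. \<forall>Q\<in>patch_strands D a b d l.
      {source d l P, target d l P} \<inter> {source d l Q, target d l Q} \<noteq> {} \<longrightarrow> Q \<in> T"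
  shows False
proof (rule no_finite_arc_closed[OF nc])
  let ?T = "(\<lambda>P. (on_arc P, cell P)) ` T"
  show "finite ?T" using T(1) finite_patch finite_subset by blast
  show "?T \<noteq> {}" using T(2) by simp
  show "arc_closed ?T"
    unfolding arc_closed_def
  proof (intro conjI ballI allI impI)
    show "fst ` ?T \<subseteq> arcs G"
    proof
      fix e assume "e \<in> fst ` ?T"
      then obtain P where P: "P \<in> T" "e = on_arc P" by auto
      then have "P \<in> strands D a b" using T(1) by (auto simp: patch_iff)
      from strandD(1)[OF this] show "e \<in> arcs G" using P(2) by simp
    qed
    fix x y assume "x \<in> ?T" and y: "fst y \<in> arcs G" "arc_ends x \<inter> arc_ends y \<noteq> {}"
    then obtain P where P: "P \<in> T" "x = (on_arc P, cell P)" by (elim imageE)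
    obtain u v where uv: "source d l P = Some u" "target d l P = Some v" using some P(1) by blast
    have "arc_ends x = {u, v}"
      using uv unfolding source_Some target_Some by (simp add: arc_ends_def P(2) point_def)
    moreover obtain z where z: "z \<in> arc_ends x" "z \<in> arc_ends y" using y(2) by (meson disjoint_iff)
    ultimately have zP: "Some z \<in> {source d l P, target d l P}" using uv by auto
    have zr: "z \<in> rect d l" using zP by (auto simp: source_Some target_Some dest!: sym[of "Some z"])
    then have zf: "fst z \<in> {a<..<b}" by (simp add: mem_Times_iff)
    have "\<exists>Q\<in>strands D a b. on_arc Q = fst y \<and> cell Q = snd y \<and>
        (source d l Q = Some z \<or> target d l Q = Some z)"
    proof -
      have "z = lift D (fst y) (snd y) 0 \<or> z = lift D (fst y) (snd y) 1"
        using z(2) by (simp add: arc_ends_def)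
      then show ?thesis
      proof
        assume e: "z = lift D (fst y) (snd y) 0"
        obtain Q where Q: "Q \<in> strands D a b" "on_arc Q = fst y \<and> cell Q = snd y \<and> start Q = 0"
          using ex_strand_starting[OF gpa gpb y(1) zf[unfolded e]] by (rule bexE)
        then have "source d l Q = Some z" unfolding source_Some using zr e by (simp add: point_def)
        then show ?thesis using Q by blast
      next
        assume e: "z = lift D (fst y) (snd y) 1"
        obtain Q where Q: "Q \<in> strands D a b" "on_arc Q = fst y \<and> cell Q = snd y \<and> stop Q = 1"
          using ex_strand_stopping[OF gpa gpb y(1) zf[unfolded e]] by (rule bexE)
        then have "target d l Q = Some z" unfolding target_Some using zr e by (simp add: point_def)
        then show ?thesis using Q by blast
      qed
    qed
    then obtain Q where Q: "Q \<in> strands D a b" "on_arc Q = fst y" "cell Q = snd y"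
      and zQ: "source d l Q = Some z \<or> target d l Q = Some z" by blast
    have "Q \<in> patch_strands D a b d l"
      using zQ
    proof
      assume "source d l Q = Some z"
      then show ?thesis
        unfolding source_Some using in_patch_endpoint[OF Q(1), of 0 d l] strandD(3)[OF Q(1)] by simp
    next
      assume "target d l Q = Some z"
      then show ?thesis
        unfolding target_Some using in_patch_endpoint[OF Q(1), of 1 d l] strandD(3)[OF Q(1)] by simp
    qed
    moreover have "{source d l P, target d l P} \<inter> {source d l Q, target d l Q} \<noteq> {}"
      using zP zQ by auto
    ultimately have "Q \<in> T" using closed P(1) by blast
    then have "(on_arc Q, cell Q) \<in> ?T" by (rule imageI)
    then show "y \<in> ?T" using Q(2,3) by simp
  qed
qed

text \<open>
  Entries and exits at a side have the same density, so starting the entries this far below the top of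
  the patch gives the exits a head start that covers the errors \<open>M\<close> in the heights and the rounding.
\<close>

definition late :: real where "late = 5 * M + 3 * h"

lemma exits_outnumber_late_entries:
  assumes bal: "card (starts_on a b x) = card (stops_on a b x)"
    and Q: "Q \<in> entries x d l" "hgt Q < d - late"
  shows "card {Q'\<in>{Q'\<in>entries x d l. hgt Q' < d - late}.
      snd (point D Q (start Q)) \<le> snd (point D Q' (start Q'))}
    < card {P\<in>exits x d l. snd (point D Q (start Q)) \<le> snd (point D P (stop P))}"
    (is "card ?L < card ?R")
proof -
  define y where "y = snd (point D Q (start Q))"
  define m where "m = card (starts_on a b x)"
  \<comment> \<open>In units of \<open>h\<close> this is the length of the band from
    \<open>y + 3 * M\<close> to \<open>d - M\<close>. Whatever the errors, exits in this band belong
    to the patch and are not below the start of \<open>Q\<close>; there are at least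
    \<open>m * (X - 1)\<close> of them. The competing entries lie between \<open>y - M\<close> and
    \<open>d - late\<close>, a band shorter by \<open>3 * h\<close>, so they number at most
    \<open>m * (X - 2)\<close>.\<close>
  define X where "X = (d - 4 * M - y) / h"
  have Qp: "Q \<in> patch_strands D a b d l" and Qs: "Q \<in> strands D a b" and Qx: "fst (point D Q (start Q)) = x"
    using Q(1) by (simp_all add: entries_def patch_iff)
  have yQ: "\<bar>y - hgt Q\<bar> \<le> M" unfolding y_def by (rule M[OF Qs strandD(5)[OF Qs]])
  have ylow: "d - l - 2 * M \<le> y" using yQ patch_hgt(1)[OF Qp] by linarith
  let ?A = "{P. rebase 0 P \<in> starts_on a b x \<and> y - M \<le> hgt P \<and> hgt P \<le> d - late}"
  let ?B = "{P. rebase 0 P \<in> stops_on a b x \<and> y + 3 * M \<le> hgt P \<and> hgt P \<le> d - M}"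
  have "?L \<subseteq> ?A"
  proof
    fix P assume "P \<in> ?L"
    then have P: "P \<in> entries x d l" "hgt P < d - late" "y \<le> snd (point D P (start P))"
      by (simp_all add: y_def)
    then have Ps: "P \<in> strands D a b" by (simp add: entries_def patch_iff)
    have "y - M \<le> hgt P" using M[OF Ps strandD(5)[OF Ps]] P(3) by linarith
    then show "P \<in> ?A" using P Ps by (simp add: starts_on_iff entries_def)
  qed
  then have "card ?L \<le> card ?A" by (rule card_mono[OF card_hgt_between(1)[OF sub_base(1)]])
  then have "real (card ?L) \<le> real (card ?A)" by (rule of_nat_mono)
  also have "real (card ?A) \<le> m * max 0 ((d - late - (y - M)) / h + 1)"
    unfolding m_def by (rule card_hgt_between(2)[OF sub_base(1)])
  also have "(d - late - (y - M)) / h + 1 = X - 2"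
    unfolding X_def late_def using h_pos by (simp add: field_simps)
  also have "max 0 (X - 2) = X - 2"
  proof -
    have "3 * h \<le> d - 4 * M - y" using Q(2) yQ unfolding late_def by linarith
    then have "3 \<le> X" unfolding X_def using h_pos by (simp add: field_simps)
    then show ?thesis by simp
  qed
  finally have L: "real (card ?L) \<le> m * (X - 2)" .
  have "?B \<subseteq> ?R"
  proof
    fix P assume P: "P \<in> ?B"
    then have Ps: "P \<in> strands D a b" and Px: "fst (point D P (stop P)) = x"
      and hP: "y + 3 * M \<le> hgt P" "hgt P \<le> d - M"
      by (simp_all add: stops_on_iff)
    have "P \<in> patch_strands D a b d l" by (rule in_patch[OF Ps _ hP(2)]) (use hP(1) ylow in linarith)
    moreover have "y \<le> snd (point D P (stop P))"
      using M[OF Ps strandD(6)[OF Ps]] hP(1) M0 by linarith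
    ultimately show "P \<in> ?R" using Px by (simp add: exits_def y_def)
  qed
  then have "card ?B \<le> card ?R"
    by (rule card_mono[rotated]) (rule finite_subset[OF _ finite_entries(2)], auto)
  then have "real (card ?B) \<le> real (card ?R)" by (rule of_nat_mono)
  moreover have "m * ((d - M - (y + 3 * M)) / h - 1) \<le> real (card ?B)"
    unfolding m_def bal by (rule card_hgt_between(3)[OF sub_base(2)])
  moreover have "(d - M - (y + 3 * M)) / h = X" unfolding X_def by simp
  ultimately have R: "m * (X - 1) \<le> real (card ?R)" by simp
  have "rebase 0 Q \<in> starts_on a b x" using Qs Qx by (simp add: starts_on_iff)
  \<comment> \<open>The entry \<open>Q\<close> itself shows that there is a class of entries,
    without which the inequality would not be strict.\<close>
  then have "m > 0" unfolding m_def using finite_subset[OF sub_base(1) finite_base] by (auto simp: card_gt_0_iff)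
  then have "m * (X - 2) < m * (X - 1)" by simp
  then have "real (card ?L) < real (card ?R)" using L R by linarith
  then show ?thesis by simp
qed

text \<open>A strand starting on a side is an entry, and by assumption at most \<open>late\<close>
  below the top. Any other strand starts at an interaction between the sides, which must lie above
  or below the rectangle; its \<open>hgt\<close> is off by at most \<open>M\<close>, and
  \<open>late\<close> is at least \<open>M\<close>.\<close>

lemma free_start_cases:
  assumes P: "P \<in> patch_strands D a b d l" and src: "source d l P = None"
    and na: "\<not> (P \<in> entries a d l \<and> hgt P < d - late)" and nb: "\<not> (P \<in> entries b d l \<and> hgt P < d - late)"
  shows "hgt P \<le> d - l + M \<or> d - late \<le> hgt P"
proof (rule ccontr)
  assume n: "\<not> ?thesis"
  have Ps: "P \<in> strands D a b" using P by (simp add: patch_iff)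
  have ne: "fst (point D P (start P)) \<noteq> a" "fst (point D P (start P)) \<noteq> b"
    using na nb n P by (auto simp: entries_def)
  then have s0: "start P = 0" using strandD(7)[OF Ps] by simp
  have inab: "fst (point D P 0) \<in> {a<..<b}"
    using strand_ends_inside(1)[OF Ps] ne unfolding s0 by simp
  have "snd (point D P 0) \<notin> {d - l..d}"
    using src s0 inab unfolding source_def by (auto simp: mem_Times_iff)
  moreover have "\<bar>snd (point D P 0) - hgt P\<bar> \<le> M" by (rule M[OF Ps]) simp
  moreover have "late \<ge> M" using M0 h_pos by (simp add: late_def)
  ultimately show False using n by auto
qed

text \<open>Bounds the strands in a band of length \<open>2 * M\<close> around the bottom of the
  patch and in a band of length \<open>M + late\<close> at its top. Neither \<open>d\<close> nor
  \<open>l\<close> occurs, so one number of threads serves all lengths.\<close>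

definition free_bound :: nat where
  "free_bound = nat \<lceil>real (card (base_strands a b)) * (2 * M / h + 1) +
     real (card (base_strands a b)) * ((M + late) / h + 1)\<rceil>"

lemma card_free_starts:
  assumes F: "F \<subseteq> patch_strands D a b d l"
    and free: "\<And>P. P \<in> F \<Longrightarrow> hgt P \<le> d - l + M \<or> d - late \<le> hgt P"
  shows "card F \<le> free_bound"
proof -
  let ?A = "\<lambda>u v. {P. rebase 0 P \<in> base_strands a b \<and> u \<le> hgt P \<and> hgt P \<le> v}"
  have late0: "late \<ge> 0" using M0 h_pos by (simp add: late_def)
  have "F \<subseteq> ?A (d - l - M) (d - l + M) \<union> ?A (d - late) (d + M)"
  proof
    fix P assume P: "P \<in> F"
    then have Pp: "P \<in> patch_strands D a b d l" using F by auto
    then have "rebase 0 P \<in> base_strands a b" by (intro rebase_in_base) (simp add: patch_iff)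
    then show "P \<in> ?A (d - l - M) (d - l + M) \<union> ?A (d - late) (d + M)"
      using free[OF P] patch_hgt[OF Pp] by auto
  qed
  then have "card F \<le> card (?A (d - l - M) (d - l + M) \<union> ?A (d - late) (d + M))"
    by (rule card_mono[rotated]) (intro finite_UnI card_hgt_between(1)[OF subset_refl])
  also have "\<dots> \<le> card (?A (d - l - M) (d - l + M)) + card (?A (d - late) (d + M))" by (rule card_Un_le)
  finally have "real (card F) \<le> real (card (?A (d - l - M) (d - l + M))) + real (card (?A (d - late) (d + M)))"
    by linarith
  also have "real (card (?A (d - l - M) (d - l + M))) \<le> card (base_strands a b) * max 0 ((d - l + M - (d - l - M)) / h + 1)"
    by (rule card_hgt_between(2)[OF subset_refl])
  also have "max 0 ((d - l + M - (d - l - M)) / h + 1) = 2 * M / h + 1" using M0 h_pos by simp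
  also have "real (card (?A (d - late) (d + M))) \<le> card (base_strands a b) * max 0 ((d + M - (d - late)) / h + 1)"
    by (rule card_hgt_between(2)[OF subset_refl])
  also have "max 0 ((d + M - (d - late)) / h + 1) = (M + late) / h + 1" using M0 h_pos late0 by simp
  finally have "real (card F) \<le> real (card (base_strands a b)) * (2 * M / h + 1) +
      real (card (base_strands a b)) * ((M + late) / h + 1)" by simp
  then show ?thesis unfolding free_bound_def by linarith
qed

lemma trail_continues:
  assumes "trail (source d l) (target d l) w"
  shows "w \<noteq> [] \<and> successively (continues D a b) w"
proof -
  have suc: "successively (\<lambda>x y. target d l x = source d l y \<and> target d l x \<noteq> None) w"
    using assms by (simp add: trail_def)
  have "successively (continues D a b) w"
  proof (rule successively_mono[OF suc])
    fix P Q assume PQ: "target d l P = source d l Q \<and> target d l P \<noteq> None"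
    then obtain z where "target d l P = Some z" by blast
    then have "target d l P = Some z" "source d l Q = Some z" using PQ by simp_all
    then show "continues D a b P Q"
      unfolding target_Some source_Some continues_def Let_def by simp
  qed
  then show ?thesis using assms by (simp add: trail_def)
qed

text \<open>Each join removes one entry from the multiset of first strands. The routes that remain
  are therefore as many as the free starts other than the joined entries, and these lie near the top
  or the bottom.\<close>

theorem patch_workable:
  assumes nc: "no_contractible_directed_cycles D"
    and bala: "card (starts_on a b a) = card (stops_on a b a)"
    and balb: "card (starts_on a b b) = card (stops_on a b b)"
  shows "\<exists>ws. length ws = 2 * free_bound \<and> works_patch D a b d l ws"
proof -
  let ?S = "patch_strands D a b d l"
  let ?t = "source d l" and ?h = "target d l" and ?R = "continues D a b"
  have "\<exists>N. (\<Sum>w\<in>#N. mset w) = mset_set ?S \<and> (\<forall>w. w \<in># N \<longrightarrow> trail ?t ?h w) \<and>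
    image_mset hd N = mset_set {x\<in>?S. ?t x = None} \<and> image_mset last N = mset_set {x\<in>?S. ?h x = None}"
  proof (rule trail_decomposition[OF finite_patch patch_balanced])
    fix T assume T: "T \<subseteq> ?S" "T \<noteq> {}" "\<forall>x\<in>T. ?t x \<noteq> None \<and> ?h x \<noteq> None"
      "\<forall>x\<in>T. \<forall>y\<in>?S. {?t x, ?h x} \<inter> {?t y, ?h y} \<noteq> {} \<longrightarrow> y \<in> T"
    show False by (rule patch_open_ended[OF nc T])
  qed
  then obtain N where N: "(\<Sum>w\<in>#N. mset w) = mset_set ?S"
    and tr: "\<forall>w. w \<in># N \<longrightarrow> trail ?t ?h w"
    and hdN: "image_mset hd N = mset_set {x\<in>?S. ?t x = None}"
    and lastN: "image_mset last N = mset_set {x\<in>?S. ?h x = None}"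
    by (elim exE conjE)
  define F where "F x = {Q\<in>entries x d l. hgt Q < d - late}" for x
  define E where "E x = exits x d l" for x
  define en where "en Q = snd (point D Q (start Q))" for Q
  define ex where "ex P = snd (point D P (stop P))" for P
  have finF: "finite (F x)" and finE: "finite (E x)" for x
    unfolding F_def E_def using finite_entries by simp_all
  have Fs: "F x \<subseteq> {P\<in>?S. ?t P = None}" if "x \<in> {a, b}" for x
    using that unfolding F_def entries_def by (auto simp: source_def)
  have Es: "E x \<subseteq> {P\<in>?S. ?h P = None}" if "x \<in> {a, b}" for x
    using that unfolding E_def exits_def by (auto simp: target_def)
  have FE: "F a \<inter> F b = {}" "E a \<inter> E b = {}"
    using ab unfolding F_def E_def entries_def exits_def by auto
  have finS: "finite {P\<in>?S. Q P}" for Q using finite_patch by simp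
  have R: "?R P Q" if "P \<in> E x" "Q \<in> F x" "en Q \<le> ex P" "x \<in> {a, b}" for P Q x
    using that unfolding continues_def Let_def E_def F_def entries_def exits_def en_def ex_def by auto
  have out: "card {Q'\<in>F x. en Q \<le> en Q'} < card {P\<in>E x. en Q \<le> ex P}"
    if "Q \<in> F x" "x \<in> {a, b}" for Q x
  proof -
    have "card (starts_on a b x) = card (stops_on a b x)" using that(2) bala balb by auto
    moreover have "Q \<in> entries x d l" "hgt Q < d - late" using that(1) by (simp_all add: F_def)
    ultimately show ?thesis
      unfolding F_def E_def en_def ex_def by (rule exits_outnumber_late_entries)
  qed
  have join: "\<exists>N' X. X \<subseteq> E x \<and> card X = card (F x) \<and> (\<Sum>w\<in>#N'. mset w) = (\<Sum>w\<in>#N. mset w) \<and>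
      (\<forall>w. w \<in># N' \<longrightarrow> w \<noteq> [] \<and> successively ?R w) \<and>
      image_mset hd N = image_mset hd N' + mset_set (F x) \<and>
      image_mset last N = image_mset last N' + mset_set X"
    if x: "x \<in> {a, b}" and FN: "mset_set (F x) \<subseteq># image_mset hd N"
      and EN: "mset_set (E x) \<subseteq># image_mset last N"
      and suc: "\<forall>w. w \<in># N \<longrightarrow> w \<noteq> [] \<and> successively ?R w" for x and N
  proof (rule join_routes[OF finF finE FN EN, where en = en and ex = ex])
    fix P Q assume PQ: "P \<in> E x" "Q \<in> F x" "en Q \<le> ex P"
    show "?R P Q" by (rule R[OF PQ x])
  next
    fix Q assume Q: "Q \<in> F x"
    show "card {Q'\<in>F x. en Q \<le> en Q'} < card {P\<in>E x. en Q \<le> ex P}" by (rule out[OF Q x])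
  qed (use suc in simp)
  have Fa: "mset_set (F a) \<subseteq># image_mset hd N"
    unfolding hdN by (rule subset_imp_msubset_mset_set[OF Fs finS]) simp
  have Ea: "mset_set (E a) \<subseteq># image_mset last N"
    unfolding lastN by (rule subset_imp_msubset_mset_set[OF Es finS]) simp
  have "\<forall>w. w \<in># N \<longrightarrow> w \<noteq> [] \<and> successively ?R w"
    by (intro allI impI) (rule trail_continues[OF tr[rule_format]])
  from join[OF insertI1 Fa Ea this]
  obtain N1 X1 where X1: "X1 \<subseteq> E a"
    and N1: "(\<Sum>w\<in>#N1. mset w) = (\<Sum>w\<in>#N. mset w)"
    and suc1: "\<forall>w. w \<in># N1 \<longrightarrow> w \<noteq> [] \<and> successively ?R w"
    and hd1: "image_mset hd N = image_mset hd N1 + mset_set (F a)"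
    and last1: "image_mset last N = image_mset last N1 + mset_set X1"
    by (elim exE conjE)
  \<comment> \<open>The two sides do not interfere: no strand starts on both or stops on both, so
    the joins at \<open>a\<close> leave all entries and exits at \<open>b\<close> available.\<close>
  have "mset_set (F b \<union> F a) = mset_set (F b) + mset_set (F a)"
    by (rule mset_set_Union[OF finF finF]) (use FE(1) in blast)
  moreover have "mset_set (F b \<union> F a) \<subseteq># image_mset hd N"
    unfolding hdN by (rule subset_imp_msubset_mset_set[OF _ finS]) (use Fs[of a] Fs[of b] in simp)
  ultimately have Fb: "mset_set (F b) \<subseteq># image_mset hd N1" unfolding hd1 by simp
  have "mset_set (E b \<union> X1) = mset_set (E b) + mset_set X1"
    by (rule mset_set_Union[OF finE finite_subset[OF X1 finE]]) (use FE(2) X1 in blast)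
  moreover have "mset_set (E b \<union> X1) \<subseteq># image_mset last N"
    unfolding lastN
  proof (rule subset_imp_msubset_mset_set[OF _ finS])
    show "E b \<union> X1 \<subseteq> {P\<in>?S. ?h P = None}" using Es[of a] Es[of b] X1 by blast
  qed
  ultimately have Eb: "mset_set (E b) \<subseteq># image_mset last N1" unfolding last1 by simp
  from join[OF insertI2[OF singletonI] Fb Eb suc1]
  obtain N2 X2 where N2: "(\<Sum>w\<in>#N2. mset w) = (\<Sum>w\<in>#N1. mset w)"
    and suc2: "\<forall>w. w \<in># N2 \<longrightarrow> w \<noteq> [] \<and> successively ?R w"
    and hd2: "image_mset hd N1 = image_mset hd N2 + mset_set (F b)"
    and last2: "image_mset last N1 = image_mset last N2 + mset_set X2"
    by (elim exE conjE)
  define K where "K = {P\<in>?S. ?t P = None} - (F b \<union> F a)"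
  have "image_mset hd N2 + mset_set (F b \<union> F a) = mset_set {P\<in>?S. ?t P = None}"
    using hd1 hd2 hdN mset_set_Union[OF finF[of b] finF[of a]] FE(1) by (simp add: Int_commute add.assoc)
  moreover have "{P\<in>?S. ?t P = None} = K \<union> (F b \<union> F a)" using Fs[of a] Fs[of b] by (auto simp: K_def)
  moreover have "mset_set (K \<union> (F b \<union> F a)) = mset_set K + mset_set (F b \<union> F a)"
    by (rule mset_set_Union) (use finS[of "\<lambda>P. ?t P = None"] finF in \<open>simp_all add: K_def\<close>, auto)
  ultimately have hdK: "image_mset hd N2 = mset_set K" by (simp only: add_right_imp_eq)
  have "size N2 = card K" using arg_cong[OF hdK, of size] by simp
  also have "card K \<le> free_bound"
  proof (rule card_free_starts[of _ d l])
    show "K \<subseteq> ?S" by (auto simp: K_def)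
    fix P assume "P \<in> K"
    then show "hgt P \<le> d - l + M \<or> d - late \<le> hgt P"
      by (intro free_start_cases) (auto simp: K_def F_def)
  qed
  finally have size: "size N2 \<le> free_bound" .
  obtain ws0 where ws0: "mset ws0 = N2" using ex_mset by blast
  have len: "length ws0 \<le> free_bound" using size unfolding ws0[symmetric] by simp
  \<comment> \<open>Each route is followed by two threads, and idle threads bring the total to a
    number that does not depend on the length.\<close>
  define ws where "ws = ws0 @ ws0 @ replicate (2 * free_bound - 2 * length ws0) []"
  have "works_patch D a b d l ws"
    unfolding works_patch_def
  proof (intro conjI ballI)
    have all: "(\<Sum>w\<in>#N2. mset w) = mset_set ?S" unfolding N2 N1 N ..
    fix w assume w: "w \<in> set ws"
    have w': "w = [] \<or> w \<in># N2" using w unfolding ws_def ws0[symmetric] by auto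
    show "set w \<subseteq> ?S"
    proof
      fix P assume P: "P \<in> set w"
      then have "w \<in># N2" using w' by auto
      then have "P \<in># (\<Sum>w\<in>#N2. mset w)" using P unfolding in_Union_mset_iff by auto
      then show "P \<in> ?S" unfolding all using finite_patch by simp
    qed
    show "successively ?R w" using w' suc2 by auto
    show "w \<noteq> [] \<longrightarrow> point D (hd w) (start (hd w)) \<notin> rect d l \<and> point D (last w) (stop (last w)) \<notin> rect d l"
    proof (intro impI conjI)
      assume "w \<noteq> []"
      then have wN: "w \<in># N2" using w' by simp
      have "hd w \<in># image_mset hd N" unfolding hd1 hd2 using wN by simp
      then have "hd w \<in> {P\<in>?S. ?t P = None}" unfolding hdN using finS by simp
      then have hw: "hd w \<in> strands D a b" "?t (hd w) = None" by (simp_all add: patch_iff)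
      show "point D (hd w) (start (hd w)) \<notin> rect d l"
        using strandD(7)[OF hw(1)] hw(2) unfolding source_def by (auto simp: mem_Times_iff split: if_splits)
      have "last w \<in># image_mset last N" unfolding last1 last2 using wN by simp
      then have "last w \<in> {P\<in>?S. ?h P = None}" unfolding lastN using finS by simp
      then have lw: "last w \<in> strands D a b" "?h (last w) = None" by (simp_all add: patch_iff)
      show "point D (last w) (stop (last w)) \<notin> rect d l"
        using strandD(8)[OF lw(1)] lw(2) unfolding target_def by (auto simp: mem_Times_iff split: if_splits)
    qed
  next
    fix P assume P: "P \<in> ?S"
    have "(\<Sum>w\<leftarrow>ws0. count_list w P) = count (\<Sum>w\<in>#mset ws0. mset w) P"
      by (induction ws0) (simp_all add: count_mset)
    also have "\<dots> = 1" unfolding ws0 N2 N1 N using P finite_patch by simp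
    finally have one: "(\<Sum>w\<leftarrow>ws0. count_list w P) = 1" .
    have "(\<Sum>w\<leftarrow>replicate k []. count_list w P) = 0" for k by (induction k) simp_all
    then show "(\<Sum>w\<leftarrow>ws. count_list w P) = 2" unfolding ws_def by (simp add: one)
  qed
  moreover have "length ws = 2 * free_bound" using len by (simp add: ws_def)
  ultimately show ?thesis by blast
qed

end

section \<open>Thread conservation\<close>

context toroidal_ground
begin

lemma strip_exists:
  assumes "general_position D a" "general_position D b" "a < b"
  obtains M where "strip D a b M"
proof -
  have "\<exists>M. strip D a b M"
  proof (rule base_heights_bounded[OF assms(1,2)])
    fix M assume M: "0 \<le> M" "\<And>P t. \<lbrakk>P \<in> strands D a b; t \<in> {0..1}\<rbrakk> \<Longrightarrow> \<bar>snd (point D P t) - hgt P\<bar> \<le> M"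
    have "strip D a b M"
      by (intro strip.intro strip_axioms.intro toroidal_ground_axioms) (fact assms M)+
    then show "\<exists>M. strip D a b M" by (rule exI)
  qed
  then show thesis using that by (elim exE)
qed

lemma general_position_shift:
  assumes "general_position D c"
  shows "general_position D (c + p)"
proof -
  have "to_torus D z \<in> meridian D (c + p) \<longleftrightarrow> to_torus D z \<in> meridian D c" for z
  proof -
    have "(\<exists>j::int. fst z = c + p + of_int j * p) \<longleftrightarrow> (\<exists>j::int. fst z = c + of_int j * p)"
    proof
      assume "\<exists>j::int. fst z = c + p + of_int j * p"
      then obtain j :: int where "fst z = c + p + of_int j * p" by (rule exE)
      then show "\<exists>j::int. fst z = c + of_int j * p"
        by (intro exI[of _ "j + 1"]) (simp add: algebra_simps)
    next
      assume "\<exists>j::int. fst z = c + of_int j * p"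
      then obtain j :: int where "fst z = c + of_int j * p" by (rule exE)
      then show "\<exists>j::int. fst z = c + p + of_int j * p"
        by (intro exI[of _ "j - 1"]) (simp add: algebra_simps)
    qed
    then show ?thesis unfolding meridian_iff .
  qed
  then show ?thesis using assms unfolding general_position_def by simp
qed

text \<open>A single strip suffices, from \<open>c\<close> to its translate by the horizontal
  period: both sides lie over the same meridian, so general position at \<open>c\<close> covers
  both.\<close>

theorem conserving_imp_equal_crossings:
  assumes tc: "thread_conserving D" and c: "general_position D c"
  shows "card (rightward_crossings D c) = card (leftward_crossings D c)"
proof -
  note gp = c general_position_shift[OF c]
  have cc: "c < c + p" using p_pos by simp
  obtain M where "strip D c (c + p) M" by (rule strip_exists[OF gp cc])
  then interpret strip D c "c + p" M .
  obtain n where n: "\<forall>l\<ge>0. \<exists>ws. length ws = n \<and> works_patch D c (c + p) 0 l ws"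
    using tc gp cc unfolding thread_conserving_def by blast
  have "card (starts_on c (c + p) c) = card (stops_on c (c + p) c)"
    by (rule conserving_balanced[of n 0]) (use n in simp)
  then show ?thesis using side_excess(1)[OF gp cc] by (simp add: net_crossings_def)
qed

text \<open>The assumption concerns one meridian and the conclusion all strips; invariance of the
  net crossing number carries the equality to both sides of every strip.\<close>

theorem equal_crossings_imp_conserving:
  assumes nc: "no_contractible_directed_cycles D" and c: "general_position D c"
    and eq: "card (rightward_crossings D c) = card (leftward_crossings D c)"
  shows "thread_conserving D"
  unfolding thread_conserving_def
proof (intro allI impI)
  fix a b d assume "a < b \<and> general_position D a \<and> general_position D b"
  then have gp: "general_position D a" "general_position D b" and ab: "a < b" by simp_all
  obtain M where "strip D a b M" by (rule strip_exists[OF gp ab])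
  then interpret strip D a b M .
  have "card (starts_on a b a) = card (stops_on a b a)" "card (starts_on a b b) = card (stops_on a b b)"
    using side_excess[OF gp ab] net_crossings_invariant[OF gp(1) c] net_crossings_invariant[OF gp(2) c] eq
    by (simp_all add: net_crossings_def)
  from patch_workable[OF nc this]
  show "\<exists>n. \<forall>l\<ge>0. \<exists>ws. length ws = n \<and> works_patch D a b d l ws" by blast
qed

end

theorem theorem3p4:
  fixes D :: "('a, 'b) ground" and c :: real
  assumes "two_regular (digraph D)"
    and "toroidal_embedding D"
    and "no_contractible_directed_cycles D"
    and "general_position D c"
  shows "thread_conserving D \<longleftrightarrow>
    card (rightward_crossings D c) = card (leftward_crossings D c)"
proof -
  interpret toroidal_ground D by (rule toroidal_ground.intro[OF assms(1,2)])
  show ?thesis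
    using conserving_imp_equal_crossings[OF _ assms(4)] equal_crossings_imp_conserving[OF assms(3,4)]
    by (rule iffI)
qed

end
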